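(* There exists, up to scale, a two-parameter family of extremal Kähler metrics on $\mathbb P(\mathcal O_{\mathbb CP^1\times\mathbb CP^1}\oplus\mathcal O_{\mathbb CP^1\times\mathbb CP^1}(1,-1))$: one for every value of $a>0$ and $c>0$.
   Context: A Kähler metric is extremal if it is a critical point of $\int S^2\,d\mathrm{vol}$ among Kähler metrics in its Kähler class; equivalently the gradient of the scalar curvature $S$ is a holomorphic vector field. The manifold $M=\mathbb P(\mathcal O\oplus\mathcal O(1,-1))$ over $\mathbb CP^1\times\mathbb CP^1$ is a six-dimensional (real) toric manifold. The parameters $a,c>0$ describe its symplectic structures: up to scale the moment polytope is $$\{(x,y,z)\in\mathbb R^3:\ -1\le x\le1,\ y\ge-1,\ z\ge-1,\ x+y\le a,\ z-x\le c\}.$$ In symplectic coordinates $(x_1,x_2,x_3,\phi_1,\phi_2,\phi_3)$, $(x_1,x_2,x_3)=(x,y,z)$, a $T^3$-invariant Kähler metric with this polytope has the form $g=\sum h^{ij}dx_idx_j+\sum h_{ij}d\phi_id\phi_j$ with $(h^{ij})=(h_{ij})^{-1}=\big(\frac{\partial^2\Phi}{\partial x_i\partial x_j}\big)$ and $\Phi=\Phi_0+f$, where $\Phi_0=\frac12[(1+x)\log(1+x)+(1-x)\log(1-x)+(1+y)\log(1+y)+(1+z)\log(1+z)+(a-x-y)\log(a-x-y)+(c+x-z)\log(c+x-z)]$ and the second derivatives of $f$ are smooth on the polytope. The metrics of the family are of cohomogeneity one, with $f=f(x)$. *)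

theory Defs
  imports "HOL-Analysis.Analysis"
begin

definition dirderiv :: "('a::real_normed_vector \<Rightarrow> 'b::real_normed_vector) \<Rightarrow> 'a \<Rightarrow> 'a \<Rightarrow> 'b" where
  "dirderiv f x v = frechet_derivative f (at x) v"

text \<open>For an open set \<open>S\<close> in a finite-dimensional space, \<open>Ck_on k S f\<close> says that \<open>f\<close> is of class
  \<open>C\<^sup>k\<close> on \<open>S\<close>.\<close>

primrec Ck_on :: "nat \<Rightarrow> 'a::real_normed_vector set \<Rightarrow> ('a \<Rightarrow> 'b::real_normed_vector) \<Rightarrow> bool" where
  "Ck_on 0 S f \<longleftrightarrow> continuous_on S f"
| "Ck_on (Suc k) S f \<longleftrightarrow>
     (\<forall>x\<in>S. f differentiable (at x)) \<and> (\<forall>v. Ck_on k S (\<lambda>x. dirderiv f x v))"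

definition smooth_on :: "'a::real_normed_vector set \<Rightarrow> ('a \<Rightarrow> 'b::real_normed_vector) \<Rightarrow> bool" where
  "smooth_on S f \<longleftrightarrow> (\<forall>k. Ck_on k S f)"


section \<open>Riemannian metrics on a coordinate domain\<close>

type_synonym 'a metric = "'a \<Rightarrow> 'a \<Rightarrow> 'a \<Rightarrow> real"

definition riemannian :: "('a::euclidean_space) metric \<Rightarrow> bool" where
  "riemannian g \<longleftrightarrow>
     (\<forall>x. bilinear (g x)) \<and> (\<forall>x u v. g x u v = g x v u) \<and> (\<forall>x u. u \<noteq> 0 \<longrightarrow> 0 < g x u u) \<and>
     (\<forall>u v. smooth_on UNIV (\<lambda>x. g x u v))"

definition sharp :: "('a::euclidean_space) metric \<Rightarrow> 'a \<Rightarrow> ('a \<Rightarrow> real) \<Rightarrow> 'a" where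
  "sharp g x \<alpha> = (THE z. \<forall>w. g x z w = \<alpha> w)"

definition gradient :: "('a::euclidean_space) metric \<Rightarrow> ('a \<Rightarrow> real) \<Rightarrow> 'a \<Rightarrow> 'a" where
  "gradient g f x = sharp g x (dirderiv f x)"

text \<open>\<open>christoffel g x u v\<close> is the Levi-Civita derivative at \<open>x\<close> of the constant vector field \<open>v\<close> in
  direction \<open>u\<close>; the formula is Koszul's, for constant (hence commuting) vector fields.\<close>

definition christoffel :: "('a::euclidean_space) metric \<Rightarrow> 'a \<Rightarrow> 'a \<Rightarrow> 'a \<Rightarrow> 'a" where
  "christoffel g x u v = sharp g x (\<lambda>w.
     (dirderiv (\<lambda>y. g y v w) x u + dirderiv (\<lambda>y. g y u w) x v - dirderiv (\<lambda>y. g y u v) x w) / 2)"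

definition curvature :: "('a::euclidean_space) metric \<Rightarrow> 'a \<Rightarrow> 'a \<Rightarrow> 'a \<Rightarrow> 'a \<Rightarrow> 'a" where
  "curvature g x u v w =
     dirderiv (\<lambda>y. christoffel g y v w) x u - dirderiv (\<lambda>y. christoffel g y u w) x v
     + christoffel g x u (christoffel g x v w) - christoffel g x v (christoffel g x u w)"

text \<open>In the next two definitions the standard inner product only serves to write the trace of an
  endomorphism, which does not depend on it.\<close>

definition ricci :: "('a::euclidean_space) metric \<Rightarrow> 'a \<Rightarrow> 'a \<Rightarrow> 'a \<Rightarrow> real" where
  "ricci g x v w = (\<Sum>b\<in>Basis. curvature g x b v w \<bullet> b)"

definition scalar_curvature :: "('a::euclidean_space) metric \<Rightarrow> 'a \<Rightarrow> real" where
  "scalar_curvature g x = (\<Sum>b\<in>Basis. sharp g x (ricci g x b) \<bullet> b)"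


section \<open>Complex coordinates\<close>

abbreviation J :: "complex^'n \<Rightarrow> complex^'n" where
  "J v \<equiv> \<i> *s v"

definition kaehler_form :: "(complex^'n) metric \<Rightarrow> (complex^'n) metric" where
  "kaehler_form g x u v = g x (J u) v"

text \<open>The second condition is that the Kaehler form is closed.\<close>

definition kaehler :: "(complex^'n) metric \<Rightarrow> bool" where
  "kaehler g \<longleftrightarrow> riemannian g \<and>
     (\<forall>x u v. g x (J u) (J v) = g x u v) \<and>
     (\<forall>x u v w. dirderiv (\<lambda>y. kaehler_form g y v w) x u + dirderiv (\<lambda>y. kaehler_form g y w u) x v
               + dirderiv (\<lambda>y. kaehler_form g y u v) x w = 0)"

text \<open>A real vector field on a complex manifold, written in holomorphic coordinates as a map into
  \<open>\<complex>\<^sup>n\<close>, is holomorphic iff this map is.\<close>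

definition holomorphic_field :: "(complex^'n \<Rightarrow> complex^'n) \<Rightarrow> bool" where
  "holomorphic_field X \<longleftrightarrow>
     (\<forall>x. \<exists>D. (X has_derivative D) (at x) \<and> (\<forall>v. D (J v) = J (D v)))"


section \<open>The manifold\<close>

text \<open>The total space of \<open>\<O>(d)\<close> over \<open>\<complex>P\<^sup>1\<close> consists of the pairs \<open>(z, s)\<close>, \<open>z \<noteq> 0\<close>, modulo
  \<open>(z, s) \<sim> (\<lambda>z, \<lambda>\<^sup>d s)\<close>. So a point of \<open>\<P>(\<O> \<oplus> \<O>(1,-1))\<close> is given by \<open>z\<close>, \<open>w\<close>, \<open>p\<close> in
  \<open>\<complex>\<^sup>2 - {0}\<close>, modulo \<open>(z, w, p\<^sub>1, p\<^sub>2) \<sim> (\<lambda>z, \<mu>w, \<nu>p\<^sub>1, \<nu>\<lambda>\<mu>\<^sup>-\<^sup>1p\<^sub>2)\<close>.\<close>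

type_synonym hom = "(complex^2) \<times> (complex^2) \<times> (complex^2)"

definition hom_coords :: "hom set" where
  "hom_coords = {(z, w, p). z \<noteq> 0 \<and> w \<noteq> 0 \<and> p \<noteq> 0}"

definition hom_rel :: "(hom \<times> hom) set" where
  "hom_rel = {((z, w, p), (z', w', p')). (z, w, p) \<in> hom_coords \<and>
     (\<exists>l m n. l \<noteq> 0 \<and> m \<noteq> 0 \<and> n \<noteq> 0 \<and> z' = l *s z \<and> w' = m *s w \<and>
        p'$1 = n * p$1 \<and> p'$2 = n * l / m * p$2)}"

definition proj_bundle :: "hom set set" where
  "proj_bundle = hom_coords // hom_rel"

text \<open>The holomorphic atlas consists of eight charts, whose inverses \<open>chart \<sigma>\<close> are injective maps
  from \<open>\<complex>\<^sup>3\<close> into the manifold. The first coordinate is the one along the fibre, the other two are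
  those on the two factors of the base, and \<open>\<sigma>\<close> tells which of the two standard affine coordinates
  is used in each of the three places.\<close>

definition affine_lift :: "bool \<Rightarrow> complex \<Rightarrow> complex^2" where
  "affine_lift b t = (if b then vector [t, 1] else vector [1, t])"

definition chart_lift :: "bool^3 \<Rightarrow> complex^3 \<Rightarrow> hom" where
  "chart_lift \<sigma> p =
     (affine_lift (\<sigma>$2) (p$2), affine_lift (\<sigma>$3) (p$3), affine_lift (\<sigma>$1) (p$1))"

definition chart :: "bool^3 \<Rightarrow> complex^3 \<Rightarrow> hom set" where
  "chart \<sigma> p = hom_rel `` {chart_lift \<sigma> p}"

definition coord :: "bool^3 \<Rightarrow> hom set \<Rightarrow> complex^3" where
  "coord \<sigma> = inv (chart \<sigma>)"

lemma hom_relE: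
  assumes "((z, w, p), (z', w', p')) \<in> hom_rel"
  obtains l m n where "l \<noteq> 0" "m \<noteq> 0" "n \<noteq> 0" "z' = l *s z" "w' = m *s w"
    "p'$1 = n * p$1" "p'$2 = n * l / m * p$2" "(z, w, p) \<in> hom_coords"
  using assms unfolding hom_rel_def by blast

lemma hom_relI:
  assumes "l \<noteq> 0" "m \<noteq> 0" "n \<noteq> 0" "z' = l *s z" "w' = m *s w"
    "p'$1 = n * p$1" "p'$2 = n * l / m * p$2" "(z, w, p) \<in> hom_coords"
  shows "((z, w, p), (z', w', p')) \<in> hom_rel"
  using assms unfolding hom_rel_def by blast

lemma equiv_hom_rel: "equiv hom_coords hom_rel"
proof (rule equivI)
  show "hom_rel \<subseteq> hom_coords \<times> hom_coords"
    by (auto simp: hom_rel_def hom_coords_def vec_eq_iff forall_2)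
  show "refl_on hom_coords hom_rel"
    by (auto simp: refl_on_def intro!: hom_relI[where l=1 and m=1 and n=1])
  show "sym hom_rel"
  proof (rule symI, clarify)
    fix z w p z' w' p' assume "((z, w, p), (z', w', p')) \<in> hom_rel"
    then obtain l m n where h: "l \<noteq> 0" "m \<noteq> 0" "n \<noteq> 0" "z' = l *s z" "w' = m *s w"
      "p'$1 = n * p$1" "p'$2 = n * l / m * p$2" "(z, w, p) \<in> hom_coords" by (rule hom_relE)
    then show "((z', w', p'), (z, w, p)) \<in> hom_rel"
      by (intro hom_relI[where l="1/l" and m="1/m" and n="1/n"])
        (auto simp: hom_coords_def vec_eq_iff forall_2)
  qed
  show "trans hom_rel"
  proof (rule transI, clarify)
    fix z w p z' w' p' z'' w'' p''
    assume "((z, w, p), (z', w', p')) \<in> hom_rel" "((z', w', p'), (z'', w'', p'')) \<in> hom_rel"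
    then obtain l m n l' m' n' where
      "l \<noteq> 0" "m \<noteq> 0" "n \<noteq> 0" "z' = l *s z" "w' = m *s w"
      "p'$1 = n * p$1" "p'$2 = n * l / m * p$2" "(z, w, p) \<in> hom_coords"
      "l' \<noteq> 0" "m' \<noteq> 0" "n' \<noteq> 0" "z'' = l' *s z'" "w'' = m' *s w'"
      "p''$1 = n' * p'$1" "p''$2 = n' * l' / m' * p'$2"
      by (elim hom_relE) blast
    then show "((z, w, p), (z'', w'', p'')) \<in> hom_rel"
      by (intro hom_relI[where l="l'*l" and m="m'*m" and n="n'*n"])
        (auto simp: vector_smult_assoc)
  qed
qed

lemma chart_lift_in_hom_coords: "chart_lift \<sigma> p \<in> hom_coords"
  by (auto simp: chart_lift_def affine_lift_def hom_coords_def vec_eq_iff forall_2)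

lemma inj_chart: "inj (chart \<sigma>)"
proof (rule injI)
  fix p q assume "chart \<sigma> p = chart \<sigma> q"
  then have "(chart_lift \<sigma> p, chart_lift \<sigma> q) \<in> hom_rel"
    using eq_equiv_class[OF _ equiv_hom_rel chart_lift_in_hom_coords] by (simp add: chart_def)
  then show "p = q"
    by (auto simp: chart_lift_def affine_lift_def vec_eq_iff forall_2 forall_3
        elim!: hom_relE split: if_splits)
qed

lemma proj_bundle_eq_charts: "proj_bundle = (\<Union>\<sigma>. range (chart \<sigma>))"
proof
  show "(\<Union>\<sigma>. range (chart \<sigma>)) \<subseteq> proj_bundle"
    by (auto simp: proj_bundle_def chart_def intro!: quotientI chart_lift_in_hom_coords)
  show "proj_bundle \<subseteq> (\<Union>\<sigma>. range (chart \<sigma>))"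
  proof
    fix P assume "P \<in> proj_bundle"
    then obtain z w p where P: "P = hom_rel `` {(z, w, p)}" and h: "(z, w, p) \<in> hom_coords"
      unfolding proj_bundle_def by (metis quotientE prod_cases3)
    define \<sigma> :: "bool^3" where "\<sigma> = (\<chi> i. if i = 1 then p$1 = 0 else if i = 2 then z$1 = 0 else w$1 = 0)"
    define l where "l = (if z$1 = 0 then 1 / z$2 else 1 / z$1)"
    define m where "m = (if w$1 = 0 then 1 / w$2 else 1 / w$1)"
    define n where "n = (if p$1 = 0 then m / (l * p$2) else 1 / p$1)"
    define q :: "complex^3" where "q = vector [if p$1 = 0 then n * p$1 else n * l / m * p$2,
      if z$1 = 0 then l * z$1 else l * z$2, if w$1 = 0 then m * w$1 else m * w$2]"
    have "((z, w, p), chart_lift \<sigma> q) \<in> hom_rel"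
      unfolding chart_lift_def using h
      by (intro hom_relI[where l=l and m=m and n=n])
        (auto simp: hom_coords_def vec_eq_iff forall_2 l_def m_def n_def q_def \<sigma>_def affine_lift_def)
    then have "P = chart \<sigma> q"
      unfolding P chart_def by (rule equiv_class_eq[OF equiv_hom_rel])
    then show "P \<in> (\<Union>\<sigma>. range (chart \<sigma>))" by blast
  qed
qed


section \<open>Metrics on the manifold\<close>

text \<open>A tensor on the manifold is the family of its expressions in the charts; the second condition
  below is the transformation rule.\<close>

type_synonym bundle_metric = "bool^3 \<Rightarrow> (complex^3) metric"

definition kaehler_metric :: "bundle_metric \<Rightarrow> bool" where
  "kaehler_metric g \<longleftrightarrow> (\<forall>\<sigma>. kaehler (g \<sigma>)) \<and>
     (\<forall>\<sigma> \<tau> p q. chart \<sigma> p = chart \<tau> q \<longrightarrow>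
        (\<forall>u v. g \<sigma> p u v =
           g \<tau> q (dirderiv (coord \<tau> \<circ> chart \<sigma>) p u) (dirderiv (coord \<tau> \<circ> chart \<sigma>) p v)))"

definition extremal :: "bundle_metric \<Rightarrow> bool" where
  "extremal g \<longleftrightarrow> (\<forall>\<sigma>. holomorphic_field (gradient (g \<sigma>) (scalar_curvature (g \<sigma>))))"


section \<open>The torus action and symplectic coordinates\<close>

definition torus_act :: "real^3 \<Rightarrow> hom \<Rightarrow> hom" where
  "torus_act \<theta> = (\<lambda>(z, w, p). (vector [z$1, cis (\<theta>$2) * z$2], vector [w$1, cis (\<theta>$3) * w$2],
                              vector [p$1, cis (\<theta>$1) * p$2]))"

definition torus_map :: "bool^3 \<Rightarrow> real^3 \<Rightarrow> complex^3 \<Rightarrow> complex^3" where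
  "torus_map \<sigma> \<theta> p = coord \<sigma> (torus_act \<theta> ` chart \<sigma> p)"

definition torus_invariant :: "bundle_metric \<Rightarrow> bool" where
  "torus_invariant g \<longleftrightarrow> (\<forall>\<sigma> \<theta> p u v. g \<sigma> p u v =
     g \<sigma> (torus_map \<sigma> \<theta> p) (dirderiv (torus_map \<sigma> \<theta>) p u) (dirderiv (torus_map \<sigma> \<theta>) p v))"

text \<open>The vector field \<open>\<partial>/\<partial>\<phi>\<^sub>j\<close>.\<close>

definition torus_field :: "bool^3 \<Rightarrow> 3 \<Rightarrow> complex^3 \<Rightarrow> complex^3" where
  "torus_field \<sigma> j p = vector_derivative (\<lambda>t. torus_map \<sigma> (axis j t) p) (at 0)"

text \<open>The sign convention is the one for which \<open>\<omega> = \<Sum>\<^sub>j dx\<^sub>j \<and> d\<phi>\<^sub>j\<close>.\<close>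

definition moment_map :: "bundle_metric \<Rightarrow> (hom set \<Rightarrow> real^3) \<Rightarrow> bool" where
  "moment_map g x \<longleftrightarrow> (\<forall>\<sigma> j p.
     ((\<lambda>q. x (chart \<sigma> q) $ j) has_derivative (\<lambda>v. kaehler_form (g \<sigma>) p v (torus_field \<sigma> j p))) (at p))"

definition moment_polytope :: "real \<Rightarrow> real \<Rightarrow> (real^3) set" where
  "moment_polytope a c = {x. -1 \<le> x$1 \<and> x$1 \<le> 1 \<and> -1 \<le> x$2 \<and> -1 \<le> x$3 \<and>
     x$1 + x$2 \<le> a \<and> x$3 - x$1 \<le> c}"

definition Phi0 :: "real \<Rightarrow> real \<Rightarrow> real^3 \<Rightarrow> real" where
  "Phi0 a c x = (let l = (\<lambda>t. t * ln t) in
     (l (1 + x$1) + l (1 - x$1) + l (1 + x$2) + l (1 + x$3) + l (a - x$1 - x$2) + l (c + x$1 - x$3)) / 2)"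

definition hessian :: "(real^'n \<Rightarrow> real) \<Rightarrow> real^'n \<Rightarrow> real^'n^'n" where
  "hessian F x = (\<chi> i j. dirderiv (\<lambda>y. dirderiv F y (axis j 1)) x (axis i 1))"

text \<open>On the open orbit of the complexified torus, where the coordinates of the chart with
  \<open>\<sigma> = (False, False, False)\<close> do not vanish, \<open>\<phi>\<^sub>j\<close> is the argument of the \<open>j\<close>-th of them, so that
  \<open>d\<phi>\<^sub>j(v) = Im (v\<^sub>j / p\<^sub>j)\<close>.\<close>

definition has_symplectic_potential ::
    "bundle_metric \<Rightarrow> (hom set \<Rightarrow> real^3) \<Rightarrow> (real^3 \<Rightarrow> real) \<Rightarrow> bool" where
  "has_symplectic_potential g x \<Phi> \<longleftrightarrow> (\<forall>p. (\<forall>j. p$j \<noteq> 0) \<longrightarrow> (\<forall>u v.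
     let \<sigma> = (\<chi> _. False);
         dx = dirderiv (\<lambda>q. x (chart \<sigma> q)) p;
         d\<phi> = (\<lambda>v. \<chi> j. Im (v$j / p$j));
         H = hessian \<Phi> (x (chart \<sigma> p))
     in g \<sigma> p u v = (\<Sum>i\<in>UNIV. \<Sum>j\<in>UNIV. H$i$j * dx u$i * dx v$j)
                  + (\<Sum>i\<in>UNIV. \<Sum>j\<in>UNIV. matrix_inv H$i$j * d\<phi> u$i * d\<phi> v$j)))"

end

theory Submission
  imports Defs
begin

text \<open>
  The metric is found by the Calabi ansatz: on each fibre the moment map \<open>x\<close> of the fibrewise circle
  action is a function \<open>X\<close> of the squared norm \<open>t = |s|\<^sup>2 (1 + |w|\<^sup>2) / (1 + |z|\<^sup>2)\<close>, where \<open>s\<close> is the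
  fibre coordinate and \<open>z\<close>, \<open>w\<close> are affine coordinates on the base, and with \<open>A = a + 1\<close>,
  \<open>B = c + 1\<close> the metric is
  \<open>\<Theta>(x) |\<partial> ln t|\<^sup>2 + 2 (A - x) |dz|\<^sup>2 / (1 + |z|\<^sup>2)\<^sup>2 + 2 (B + x) |dw|\<^sup>2 / (1 + |w|\<^sup>2)\<^sup>2\<close>
  with \<open>2 t X' = \<Theta>(X)\<close>. Put \<open>\<Theta> = F / vol\<close> with \<open>vol = (A - x) (B + x)\<close>. The scalar curvature is
  \<open>(4 (A + B) - F'') / vol\<close>; if it is affine in \<open>x\<close>, its gradient is a multiple of the Euler field
  of the fibres and hence holomorphic. This makes \<open>F\<close> a quintic polynomial which the boundary
  conditions at \<open>x = -1\<close> and \<open>x = 1\<close> determine, and \<open>F = (1 - x\<^sup>2) Q\<close>, where the Bernstein coefficients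
  of \<open>Q\<close> are positive for all \<open>a, c > 0\<close>, so that \<open>\<Theta> > 0\<close> inside. Interchanging the two sections
  of the bundle amounts to \<open>x \<mapsto> -x\<close>, \<open>A \<leftrightarrow> B\<close>, so the charts at infinity have the same form.
  On the symplectic side, \<open>f'' = 1/\<Theta> - 1/(1 - x\<^sup>2) - 1/(2(A - x)) - 1/(2(B + x))\<close>, and the poles cancel.
\<close>

section \<open>Smooth functions\<close>

text \<open>The metric closes up smoothly over the two end sections when \<open>\<Theta>\<close>
  vanishes at -1 and 1 with slopes 2 and -2, that is, when \<open>Q = vol\<close> there. Hence
  \<open>Q = vol + (1 - x^2) (l0 + l1 x)\<close>, and divisibility of \<open>4 (A + B) - F''\<close>
  by \<open>vol\<close> gives two linear equations for \<open>l0\<close>, \<open>l1\<close>. The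
  relation \<open>2 t X' = \<Theta>(X)\<close> degenerates at t = 0, so it is integrated for t as a
  function of x: \<open>2 / \<Theta> = 2 / (1 - x^2) - 2 (l0 + l1 x) / Q\<close>. The singular part
  gives the factor (1 + x) / (1 - x), the rest a regular antiderivative \<open>\<rho>\<close>.
  Continuing x slightly below -1 makes t = 0 an interior point, so that the inverse function
  \<open>X\<close> is smooth there. Curvature is that of the real metric, built from Koszul's
  formula. For a Kaehler metric the Levi-Civita connection is the Chern connection, whose
  coefficients are the holomorphic derivative of \<open>H\<close> with an index raised. Ricci
  curvature then needs only the antiholomorphic derivative of their trace, which stands in for the
  derivative of ln det H.\<close>

lemma dirderiv_eq: "(f has_derivative f') (at x) \<Longrightarrow> dirderiv f x = f'"
  unfolding dirderiv_def by (metis frechet_derivative_at)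

lemma has_derivative_dirderiv: "f differentiable (at x) \<Longrightarrow> (f has_derivative dirderiv f x) (at x)"
  unfolding dirderiv_def by (simp add: frechet_derivative_works)

lemma dirderiv_cong_open:
  assumes "open S" "x \<in> S" "\<And>y. y \<in> S \<Longrightarrow> f y = g y" "f differentiable (at x)"
  shows "g differentiable (at x)" "dirderiv g x = dirderiv f x"
proof -
  have "(g has_derivative dirderiv f x) (at x)"
    using has_derivative_transform_within_open[OF has_derivative_dirderiv[OF assms(4)] assms(1,2)] assms(3)
    by blast
  then show "g differentiable (at x)" "dirderiv g x = dirderiv f x"
    by (auto simp: differentiable_def dirderiv_eq)
qed

lemma Ck_on_cong:
  assumes "open S" "\<And>y. y \<in> S \<Longrightarrow> f y = g y" "Ck_on k S f"
  shows "Ck_on k S g"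
  using assms(2,3)
proof (induction k arbitrary: f g)
  case 0
  then show ?case by (metis Ck_on.simps(1) continuous_on_cong)
next
  case (Suc k)
  have "g differentiable (at x)" "dirderiv g x = dirderiv f x" if "x \<in> S" for x
    using dirderiv_cong_open[OF assms(1) that, of f g] Suc.prems that by auto
  then show ?case
    using Suc.prems Suc.IH by (simp only: Ck_on.simps(2)) metis
qed

text \<open>On an open set \<open>dirderiv f\<close> may be replaced by a formula valid only on that
  set; the closure rules below differentiate through this rule.\<close>

lemma Ck_on_SucI:
  assumes "open S" "\<And>x. x \<in> S \<Longrightarrow> (f has_derivative f' x) (at x)" "\<And>v. Ck_on k S (\<lambda>x. f' x v)"
  shows "Ck_on (Suc k) S f"
proof -
  have "Ck_on k S (\<lambda>x. dirderiv f x v)" for v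
    by (rule Ck_on_cong[OF assms(1) _ assms(3)[of v]]) (simp add: dirderiv_eq[OF assms(2)])
  then show ?thesis
    using assms(2) by (auto simp: differentiable_def)
qed

lemma Ck_on_Suc_lower: "Ck_on (Suc k) S f \<Longrightarrow> Ck_on k S f"
proof (induction k arbitrary: f)
  case 0
  then show ?case
    by (auto intro!: continuous_at_imp_continuous_on differentiable_imp_continuous_within)
next
  case (Suc k)
  have "Ck_on k S (\<lambda>x. dirderiv f x v)" for v
    using Suc.prems by (intro Suc.IH) (simp only: Ck_on.simps(2)[where f=f])
  then show ?case using Suc.prems by (simp only: Ck_on.simps(2)) blast
qed

lemma Ck_on_const: "Ck_on k S (\<lambda>x. c)"
  by (induction k arbitrary: c) (auto simp: dirderiv_eq[OF has_derivative_const])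

lemma Ck_on_bounded_linear: "bounded_linear L \<Longrightarrow> Ck_on k S L"
proof (cases k)
  case (Suc m)
  assume L: "bounded_linear L"
  have d: "(L has_derivative L) (at x)" for x
    using bounded_linear_imp_has_derivative[OF L] .
  show ?thesis
    using d by (auto simp: Suc differentiable_def Ck_on_const dirderiv_eq[OF d])
qed (simp add: linear_continuous_on)

lemma Ck_on_linear_compose:
  assumes "bounded_linear L" "open S"
  shows "Ck_on k S f \<Longrightarrow> Ck_on k S (\<lambda>x. L (f x))"
proof (induction k arbitrary: f)
  case 0
  then show ?case using assms by (auto intro: bounded_linear.continuous_on)
next
  case (Suc k)
  then have "(f has_derivative dirderiv f x) (at x)" if "x \<in> S" for x
    using that by (simp add: has_derivative_dirderiv)
  then show ?case
    using Suc assms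
    by (intro Ck_on_SucI[where f'="\<lambda>x v. L (dirderiv f x v)"]) (auto intro: bounded_linear.has_derivative)
qed

lemma Ck_on_add:
  assumes "open S"
  shows "Ck_on k S f \<Longrightarrow> Ck_on k S g \<Longrightarrow> Ck_on k S (\<lambda>x. f x + g x)"
proof (induction k arbitrary: f g)
  case 0
  then show ?case by (auto intro: continuous_intros)
next
  case (Suc k)
  then show ?case
    by (intro Ck_on_SucI[where f'="\<lambda>x v. dirderiv f x v + dirderiv g x v"])
      (auto intro!: has_derivative_add has_derivative_dirderiv simp: assms)
qed

lemma Ck_on_bilinear:
  assumes "bounded_bilinear bop" "open S"
  shows "Ck_on k S f \<Longrightarrow> Ck_on k S g \<Longrightarrow> Ck_on k S (\<lambda>x. bop (f x) (g x))"
proof (induction k arbitrary: f g)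
  case 0
  then show ?case using assms by (auto intro: bounded_bilinear.continuous_on)
next
  case (Suc k)
  have "Ck_on k S (\<lambda>x. bop (f x) (dirderiv g x v) + bop (dirderiv f x v) (g x))" for v
    using Suc.prems by (intro Ck_on_add assms Suc.IH) (auto intro: Ck_on_Suc_lower)
  then show ?case
    using Suc.prems
    by (intro Ck_on_SucI[where f'="\<lambda>x v. bop (f x) (dirderiv g x v) + bop (dirderiv f x v) (g x)"])
      (auto intro!: bounded_bilinear.FDERIV[OF assms(1)] has_derivative_dirderiv simp: assms)
qed

text \<open>Because \<open>\<phi>\<close> is real-valued, the derivative of \<open>h\<close> is
  determined by its value in direction 1, which is again a function of one real variable, so the
  induction hypothesis applies to it.\<close>

lemma Ck_on_compose:
  fixes h :: "real \<Rightarrow> 'b::real_normed_vector"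
  assumes "open S" "\<And>x. x \<in> S \<Longrightarrow> \<phi> x \<in> V"
  shows "Ck_on k V h \<Longrightarrow> Ck_on k S \<phi> \<Longrightarrow> Ck_on k S (\<lambda>x. h (\<phi> x))"
proof (induction k arbitrary: h)
  case 0
  then show ?case using assms by (auto intro: continuous_on_compose2)
next
  case (Suc k)
  have "((\<lambda>x. h (\<phi> x)) has_derivative (\<lambda>v. dirderiv \<phi> x v *\<^sub>R dirderiv h (\<phi> x) 1)) (at x)" if "x \<in> S" for x
  proof -
    have h: "(h has_derivative dirderiv h (\<phi> x)) (at (\<phi> x))"
      using Suc.prems assms that by (simp add: has_derivative_dirderiv)
    have \<phi>: "(\<phi> has_derivative dirderiv \<phi> x) (at x)"
      using Suc.prems that by (simp add: has_derivative_dirderiv)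
    have "dirderiv h (\<phi> x) (dirderiv \<phi> x v) = dirderiv \<phi> x v *\<^sub>R dirderiv h (\<phi> x) 1" for v
      using linear_cmul[OF has_derivative_linear[OF h], of "dirderiv \<phi> x v" 1] by simp
    then show ?thesis
      using has_derivative_compose[OF \<phi> h] by simp
  qed
  moreover have "Ck_on k S (\<lambda>x. dirderiv \<phi> x v *\<^sub>R dirderiv h (\<phi> x) 1)" for v
    using Suc.prems
    by (intro Ck_on_bilinear[OF bounded_bilinear_scaleR] assms Suc.IH) (auto intro: Ck_on_Suc_lower)
  ultimately show ?case
    by (intro Ck_on_SucI[where f'="\<lambda>x v. dirderiv \<phi> x v *\<^sub>R dirderiv h (\<phi> x) 1"] assms)
qed

lemma Ck_on_subset: "Ck_on k U f \<Longrightarrow> V \<subseteq> U \<Longrightarrow> Ck_on k V f"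
  by (induction k arbitrary: f) (auto intro: continuous_on_subset)

lemma smooth_on_subset: "smooth_on U f \<Longrightarrow> V \<subseteq> U \<Longrightarrow> smooth_on V f"
  unfolding smooth_on_def using Ck_on_subset by blast

lemma smooth_on_const: "smooth_on S (\<lambda>x. c)"
  by (simp add: smooth_on_def Ck_on_const)

lemma smooth_on_bounded_linear: "bounded_linear L \<Longrightarrow> smooth_on S L"
  by (simp add: smooth_on_def Ck_on_bounded_linear)

lemma smooth_on_ident: "smooth_on S (\<lambda>x. x)"
  by (simp add: smooth_on_bounded_linear bounded_linear_ident)

lemma smooth_on_linear_compose:
  "bounded_linear L \<Longrightarrow> open S \<Longrightarrow> smooth_on S f \<Longrightarrow> smooth_on S (\<lambda>x. L (f x))"
  by (simp add: smooth_on_def Ck_on_linear_compose)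

lemma smooth_on_add:
  "open S \<Longrightarrow> smooth_on S f \<Longrightarrow> smooth_on S g \<Longrightarrow> smooth_on S (\<lambda>x. f x + g x)"
  by (simp add: smooth_on_def Ck_on_add)

lemma smooth_on_minus: "open S \<Longrightarrow> smooth_on S f \<Longrightarrow> smooth_on S (\<lambda>x. - f x)"
  using smooth_on_linear_compose[OF bounded_linear_minus[OF bounded_linear_ident]] by blast

lemma smooth_on_diff:
  "open S \<Longrightarrow> smooth_on S f \<Longrightarrow> smooth_on S g \<Longrightarrow> smooth_on S (\<lambda>x. f x - g x)"
  using smooth_on_add[of S f "\<lambda>x. - g x"] by (simp add: smooth_on_minus)

lemma smooth_on_mult:
  fixes f g :: "'a::real_normed_vector \<Rightarrow> 'b::real_normed_algebra"
  shows "open S \<Longrightarrow> smooth_on S f \<Longrightarrow> smooth_on S g \<Longrightarrow> smooth_on S (\<lambda>x. f x * g x)"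
  by (simp add: smooth_on_def Ck_on_bilinear bounded_bilinear_mult)

lemma smooth_on_power:
  fixes f :: "'a::real_normed_vector \<Rightarrow> 'b::real_normed_algebra_1"
  shows "open S \<Longrightarrow> smooth_on S f \<Longrightarrow> smooth_on S (\<lambda>x. f x ^ n)"
  by (induction n) (auto intro: smooth_on_const smooth_on_mult)

lemma smooth_on_compose:
  fixes h :: "real \<Rightarrow> 'b::real_normed_vector"
  assumes "open S" "\<And>x. x \<in> S \<Longrightarrow> \<phi> x \<in> V" "smooth_on V h" "smooth_on S \<phi>"
  shows "smooth_on S (\<lambda>x. h (\<phi> x))"
  unfolding smooth_on_def
  by (rule allI, rule Ck_on_compose[OF assms(1,2)]) (use assms(3,4) in \<open>simp_all add: smooth_on_def\<close>)

text \<open>Transfers regularity to functions known only through their derivative, such as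
  \<open>\<rho>\<close> and the symplectic potential.\<close>

lemma smooth_on_antiderivative:
  fixes f :: "real \<Rightarrow> real"
  assumes "open S" "\<And>x. x \<in> S \<Longrightarrow> (f has_real_derivative f' x) (at x)" "smooth_on S f'"
  shows "smooth_on S f"
proof -
  have "Ck_on (Suc k) S f" for k
  proof (rule Ck_on_SucI[where f'="\<lambda>x v. f' x * v", OF assms(1)])
    show "(f has_derivative (*) (f' x)) (at x)" if "x \<in> S" for x
      by (rule has_field_derivative_imp_has_derivative[OF assms(2)[OF that]])
    show "Ck_on k S (\<lambda>x. f' x * v)" for v
      by (rule Ck_on_bilinear[OF bounded_bilinear_mult assms(1) _ Ck_on_const])
        (use assms(3) in \<open>simp add: smooth_on_def\<close>)
  qed
  then show ?thesis
    unfolding smooth_on_def by (meson Ck_on_Suc_lower)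
qed

text \<open>A bootstrapping argument: each derivative of a solution is as regular as the solution.\<close>

lemma smooth_on_autonomous_ode:
  fixes f V :: "real \<Rightarrow> real"
  assumes "open S" "\<And>x. x \<in> S \<Longrightarrow> (f has_real_derivative V (f x)) (at x)"
    and "\<And>x. x \<in> S \<Longrightarrow> f x \<in> W" "smooth_on W V"
  shows "smooth_on S f"
proof -
  have "Ck_on k S f" for k
  proof (induction k)
    case 0
    show ?case
      unfolding Ck_on.simps by (intro continuous_at_imp_continuous_on ballI DERIV_isCont[OF assms(2)])
  next
    case (Suc k)
    show ?case
    proof (rule Ck_on_SucI[where f'="\<lambda>x v. V (f x) * v", OF assms(1)])
      show "(f has_derivative (*) (V (f x))) (at x)" if "x \<in> S" for x
        by (rule has_field_derivative_imp_has_derivative[OF assms(2)[OF that]])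
      have "Ck_on k S (\<lambda>x. V (f x))"
        by (rule Ck_on_compose[OF assms(1,3) _ Suc]) (use assms(4) in \<open>auto simp: smooth_on_def\<close>)
      then show "Ck_on k S (\<lambda>x. V (f x) * v)" for v
        by (rule Ck_on_bilinear[OF bounded_bilinear_mult assms(1) _ Ck_on_const])
    qed
  qed
  then show ?thesis by (simp add: smooth_on_def)
qed

text \<open>The reciprocal solves y' = - y^2, so the bootstrapping argument applies.\<close>

lemma smooth_on_inverse_real: "smooth_on {0<..} (inverse :: real \<Rightarrow> real)"
  by (rule smooth_on_autonomous_ode[where V="\<lambda>x. - (x * x)" and W=UNIV])
    (auto intro!: derivative_eq_intros smooth_on_minus smooth_on_mult smooth_on_ident simp: power2_eq_square)

lemma smooth_on_exp: "smooth_on UNIV (exp :: real \<Rightarrow> real)"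
  by (rule smooth_on_autonomous_ode[where V="\<lambda>x. x" and W=UNIV]) (auto intro!: derivative_eq_intros smooth_on_ident)

lemma smooth_on_inverse:
  fixes f :: "'a::real_normed_vector \<Rightarrow> real"
  assumes "open S" "smooth_on S f" "\<And>x. x \<in> S \<Longrightarrow> f x > 0"
  shows "smooth_on S (\<lambda>x. inverse (f x))"
  using smooth_on_compose[OF assms(1) _ smooth_on_inverse_real assms(2)] assms(3) by auto

lemma smooth_on_divide:
  fixes f g :: "'a::real_normed_vector \<Rightarrow> real"
  assumes "open S" "smooth_on S f" "smooth_on S g" "\<And>x. x \<in> S \<Longrightarrow> g x > 0"
  shows "smooth_on S (\<lambda>x. f x / g x)"
  unfolding divide_inverse by (intro smooth_on_mult smooth_on_inverse assms) 

text \<open>Both mixed derivatives are limits of the same symmetric second difference of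
  \<open>f\<close>, by two applications of the mean value theorem in either order.\<close>

lemma dirderiv_commute_real:
  fixes f :: "'a::real_normed_vector \<Rightarrow> real"
  assumes "Ck_on 2 UNIV f"
  shows "dirderiv (\<lambda>y. dirderiv f y u) x v = dirderiv (\<lambda>y. dirderiv f y v) x u"
proof -
  have d1: "(f has_derivative dirderiv f y) (at y)" for y
    using assms by (auto simp: numeral_2_eq_2 intro: has_derivative_dirderiv)
  have d2: "((\<lambda>y. dirderiv f y u) has_derivative dirderiv (\<lambda>y. dirderiv f y u) y) (at y)" for y u
    using assms by (auto simp: numeral_2_eq_2 intro: has_derivative_dirderiv)
  have c: "continuous_on UNIV (\<lambda>y. dirderiv (\<lambda>y. dirderiv f y u) y v)" for u v
    using assms by (auto simp: numeral_2_eq_2)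
  have line: "((\<lambda>s. F (y + s *\<^sub>R u)) has_real_derivative F' (y + s *\<^sub>R u) u) (at s)"
    if "\<And>y. (F has_derivative F' y) (at y)" for F :: "'a \<Rightarrow> real" and F' y u s
  proof -
    have "((\<lambda>s. F (y + s *\<^sub>R u)) has_derivative (\<lambda>r. F' (y + s *\<^sub>R u) (r *\<^sub>R u))) (at s)"
      by (rule has_derivative_compose[OF _ that]) (auto intro!: derivative_eq_intros)
    moreover have "F' (y + s *\<^sub>R u) (r *\<^sub>R u) = F' (y + s *\<^sub>R u) u * r" for r
      using linear_cmul[OF has_derivative_linear[OF that]] by simp
    ultimately show ?thesis by (simp add: has_field_derivative_def)
  qed
  \<comment> \<open>The mean value theorem is applied along \<open>u\<close> to the difference in
    direction \<open>v\<close>, then along \<open>v\<close> to the resulting derivative.\<close>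
  have mv: "\<exists>s r. 0 < s \<and> s < h \<and> 0 < r \<and> r < h \<and>
      f (x + h *\<^sub>R u + h *\<^sub>R v) - f (x + h *\<^sub>R u) - f (x + h *\<^sub>R v) + f x
        = h * (h * dirderiv (\<lambda>y. dirderiv f y u) (x + s *\<^sub>R u + r *\<^sub>R v) v)"
    if h: "h > 0" for h u v
  proof -
    let ?\<phi> = "\<lambda>s. f (x + h *\<^sub>R v + s *\<^sub>R u) - f (x + s *\<^sub>R u)"
    have "\<And>s. (?\<phi> has_real_derivative dirderiv f (x + h *\<^sub>R v + s *\<^sub>R u) u - dirderiv f (x + s *\<^sub>R u) u) (at s)"
      by (intro DERIV_diff line d1)
    then obtain s where s: "0 < s" "s < h"
      "?\<phi> h - ?\<phi> 0 = (h - 0) * (dirderiv f (x + h *\<^sub>R v + s *\<^sub>R u) u - dirderiv f (x + s *\<^sub>R u) u)"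
      using MVT2[OF h, of ?\<phi> "\<lambda>s. dirderiv f (x + h *\<^sub>R v + s *\<^sub>R u) u - dirderiv f (x + s *\<^sub>R u) u"]
      by blast
    let ?\<psi> = "\<lambda>r. dirderiv f (x + s *\<^sub>R u + r *\<^sub>R v) u"
    have "\<And>r. (?\<psi> has_real_derivative dirderiv (\<lambda>y. dirderiv f y u) (x + s *\<^sub>R u + r *\<^sub>R v) v) (at r)"
      by (intro line d2)
    then obtain r where "0 < r" "r < h"
      "?\<psi> h - ?\<psi> 0 = (h - 0) * dirderiv (\<lambda>y. dirderiv f y u) (x + s *\<^sub>R u + r *\<^sub>R v) v"
      using MVT2[OF h, of ?\<psi> "\<lambda>r. dirderiv (\<lambda>y. dirderiv f y u) (x + s *\<^sub>R u + r *\<^sub>R v) v"]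
      by blast
    then show ?thesis
      using s by (intro exI[of _ s] exI[of _ r]) (simp add: algebra_simps)
  qed
  let ?F = "\<lambda>y. dirderiv (\<lambda>y. dirderiv f y u) y v"
  let ?G = "\<lambda>y. dirderiv (\<lambda>y. dirderiv f y v) y u"
  have "\<bar>?F x - ?G x\<bar> < e" if "e > 0" for e
  proof -
    have "\<exists>d>0. \<forall>y. dist y x < d \<longrightarrow> \<bar>?F y - ?F x\<bar> < e / 2"
      using c[of u v] \<open>e > 0\<close> unfolding continuous_on_iff dist_real_def by (metis UNIV_I half_gt_zero)
    then obtain d1 where d1: "d1 > 0" "\<And>y. dist y x < d1 \<Longrightarrow> \<bar>?F y - ?F x\<bar> < e / 2" by blast
    have "\<exists>d>0. \<forall>y. dist y x < d \<longrightarrow> \<bar>?G y - ?G x\<bar> < e / 2"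
      using c[of v u] \<open>e > 0\<close> unfolding continuous_on_iff dist_real_def by (metis UNIV_I half_gt_zero)
    then obtain d2 where d2: "d2 > 0" "\<And>y. dist y x < d2 \<Longrightarrow> \<bar>?G y - ?G x\<bar> < e / 2" by blast
    \<comment> \<open>This size keeps all intermediate points inside both continuity radii; the
      summand 1 covers u = v = 0.\<close>
    define h where "h = min d1 d2 / (norm u + norm v + 1)"
    have np: "norm u + norm v + 1 > 0" by (simp add: add_nonneg_pos)
    have h: "h > 0" using d1 d2 np by (simp add: h_def)
    have close: "dist (x + (s *\<^sub>R u + r *\<^sub>R v)) x < min d1 d2"
      if "0 < s" "s < h" "0 < r" "r < h" for s r
    proof -
      have "norm (s *\<^sub>R u + r *\<^sub>R v) \<le> s * norm u + r * norm v"
        using norm_triangle_ineq[of "s *\<^sub>R u" "r *\<^sub>R v"] that by simp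
      also have "\<dots> \<le> h * norm u + h * norm v"
        using that by (intro add_mono mult_right_mono) auto
      also have "\<dots> < h * (norm u + norm v + 1)"
        using h by (simp add: algebra_simps)
      also have "\<dots> = min d1 d2" using np by (simp add: h_def)
      finally show ?thesis by (simp add: dist_norm)
    qed
    obtain s r where sr: "0 < s" "s < h" "0 < r" "r < h"
      "f (x + h *\<^sub>R u + h *\<^sub>R v) - f (x + h *\<^sub>R u) - f (x + h *\<^sub>R v) + f x = h * (h * ?F (x + s *\<^sub>R u + r *\<^sub>R v))"
      using mv[OF h] by blast
    obtain s' r' where sr': "0 < s'" "s' < h" "0 < r'" "r' < h"
      "f (x + h *\<^sub>R v + h *\<^sub>R u) - f (x + h *\<^sub>R v) - f (x + h *\<^sub>R u) + f x = h * (h * ?G (x + s' *\<^sub>R v + r' *\<^sub>R u))"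
      using mv[OF h] by blast
    have "h * (h * ?F (x + s *\<^sub>R u + r *\<^sub>R v)) = h * (h * ?G (x + s' *\<^sub>R v + r' *\<^sub>R u))"
      using sr(5) sr'(5) by (simp add: algebra_simps)
    then have eq: "?F (x + (s *\<^sub>R u + r *\<^sub>R v)) = ?G (x + (r' *\<^sub>R u + s' *\<^sub>R v))"
      using h by (simp add: add_ac)
    show ?thesis
      using d1(2)[of "x + (s *\<^sub>R u + r *\<^sub>R v)"] d2(2)[of "x + (r' *\<^sub>R u + s' *\<^sub>R v)"]
        close[OF sr(1-4)] close[OF sr'(3,4,1,2)] eq by (simp add: abs_if split: if_splits)
  qed
  then have "\<not> 0 < \<bar>?F x - ?G x\<bar>" by blast
  then show ?thesis by simp
qed

section \<open>Kaehler metrics in a holomorphic chart\<close>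

lemma scaleR_eq_smult: "r *\<^sub>R (v :: complex^'n) = complex_of_real r *s v"
  by (simp add: vec_eq_iff) (simp add: scaleR_conv_of_real)

lemma sum_Basis_complex_vec:
  fixes f :: "complex^'n \<Rightarrow> complex^'n"
  shows "(\<Sum>b\<in>Basis. f b \<bullet> b) = (\<Sum>i\<in>UNIV. Re (f (axis i 1) $ i) + Im (f (axis i \<i>) $ i))"
proof -
  have "(\<Sum>b\<in>Basis. f b \<bullet> b) = (\<Sum>b\<in>(\<Union>i. {axis i 1, axis i \<i>}). f b \<bullet> b)"
    by (rule sum.cong) (auto simp: Basis_vec_def Basis_complex_def)
  also have "\<dots> = (\<Sum>i\<in>UNIV. \<Sum>b\<in>{axis i 1, axis i \<i>}. f b \<bullet> b)"
    by (rule sum.UNION_disjoint) (auto simp: axis_eq_axis)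
  also have "\<dots> = (\<Sum>i\<in>UNIV. Re (f (axis i 1) $ i) + Im (f (axis i \<i>) $ i))"
    by (rule sum.cong) (auto simp: inner_axis axis_eq_axis inner_complex_def)
  finally show ?thesis .
qed

lemma axis_ii: "axis i \<i> = \<i> *s (axis i 1 :: complex^'n)"
  by (simp add: vec_eq_iff axis_def)

text \<open>The basis vectors \<open>axis i 1\<close> and \<open>axis i \<i>\<close> contribute
  equally here; for an antilinear map their contributions cancel.\<close>

lemma real_trace_complex_linear:
  fixes f :: "complex^'n \<Rightarrow> complex^'n"
  assumes "\<And>v. f (\<i> *s v) = \<i> *s f v"
  shows "(\<Sum>b\<in>Basis. f b \<bullet> b) = 2 * Re (\<Sum>i\<in>UNIV. f (axis i 1) $ i)"
  by (simp add: sum_Basis_complex_vec axis_ii assms flip: sum.distrib)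
    (simp add: sum_distrib_left)

lemma real_trace_antilinear:
  fixes f :: "complex^'n \<Rightarrow> complex^'n"
  assumes "\<And>v. f (\<i> *s v) = - (\<i> *s f v)"
  shows "(\<Sum>b\<in>Basis. f b \<bullet> b) = 0"
  by (simp add: sum_Basis_complex_vec axis_ii assms)

lemma has_derivative_vec_nth: "((\<lambda>y. y $ i) has_derivative (\<lambda>c. c $ i)) F"
  by (rule bounded_linear_imp_has_derivative) (rule bounded_linear_vec_nth)

lemma has_derivative_cart:
  fixes f :: "'a::euclidean_space \<Rightarrow> 'b::euclidean_space^'n"
  assumes "\<And>i. ((\<lambda>y. f y $ i) has_derivative (\<lambda>v. f' v $ i)) (at x)"
  shows "(f has_derivative f') (at x)"
proof (subst has_derivative_componentwise_within, intro ballI)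
  fix b :: "'b^'n" assume "b \<in> Basis"
  then obtain i a where b: "b = axis i a" by (auto simp: Basis_vec_def)
  show "((\<lambda>y. f y \<bullet> b) has_derivative (\<lambda>v. f' v \<bullet> b)) (at x)"
    unfolding b inner_axis by (rule has_derivative_inner_left[OF assms])
qed

text \<open>\<open>K\<close> is the part of the derivative of \<open>H\<close> which is complex linear in the direction; its
  symmetry is the Kaehler condition.\<close>

locale hermitian_metric =
  fixes H :: "complex^'n \<Rightarrow> complex^'n \<Rightarrow> complex^'n \<Rightarrow> complex"
    and K :: "complex^'n \<Rightarrow> complex^'n \<Rightarrow> complex^'n \<Rightarrow> complex^'n \<Rightarrow> complex"
  assumes H_add: "H x (u + u') v = H x u v + H x u' v"
    and H_smult: "H x (a *s u) v = a * H x u v"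
    and H_cnj: "H x v u = cnj (H x u v)"
    and H_pos: "u \<noteq> 0 \<Longrightarrow> 0 < Re (H x u u)"
    and H_smooth: "smooth_on UNIV (\<lambda>x. Re (H x u v))"
    and H_deriv: "((\<lambda>y. H y u v) has_derivative (\<lambda>c. K y c u v + cnj (K y c v u))) (at y)"
    and K_commute: "K y c u v = K y u c v"
    and K_add: "K y (c + d) u v = K y c u v + K y d u v"
    and K_smult: "K y (a *s c) u v = a * K y c u v"
    and K_smult_right: "K y c u (a *s v) = cnj a * K y c u v"
begin

definition g :: "(complex^'n) metric" where
  "g x u v = Re (H x u v)"

lemma H_zero: "H x 0 v = 0"
  using H_smult[of x 0 0 v] by simp

lemma H_sum: "finite I \<Longrightarrow> H x (\<Sum>i\<in>I. F i) v = (\<Sum>i\<in>I. H x (F i) v)"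
  by (induction I rule: finite_induct) (auto simp: H_add H_zero)

lemma K_zero: "K x 0 u v = 0"
  using K_smult[of x 0 0] by simp

lemma K_sum: "finite I \<Longrightarrow> K x (\<Sum>i\<in>I. F i) u v = (\<Sum>i\<in>I. K x (F i) u v)"
  by (induction I rule: finite_induct) (auto simp: K_add K_zero)

lemma H_minus: "H x (- u) v = - H x u v"
  using H_smult[of x "-1" u v] by simp

lemma H_diff: "H x (u - u') v = H x u v - H x u' v"
  using H_add[of x u "- u'" v] by (simp add: H_minus)

lemma H_add_right: "H x v (u + u') = H x v u + H x v u'"
  by (metis H_add H_cnj complex_cnj_add)

lemma H_smult_right: "H x v (a *s u) = cnj a * H x v u"
  by (metis H_smult H_cnj complex_cnj_mult)

lemma H_eqD:
  assumes "\<And>w. H x u w = H x v w"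
  shows "u = v"
proof (rule ccontr)
  assume "u \<noteq> v"
  then have "0 < Re (H x (u - v) (u - v))" by (simp add: H_pos)
  then show False by (simp add: H_diff assms)
qed

text \<open>The real part recovers the imaginary part through \<open>\<i> *s w\<close>. This is the
  uniqueness behind the definite description in \<open>sharp\<close>.\<close>

lemma Re_H_eqD:
  assumes "\<And>w. Re (H x u w) = Re (H x v w)"
  shows "u = v"
proof (rule H_eqD)
  fix w
  have *: "Im (H x u w) = Re (H x u (\<i> *s w))" for u
    by (simp add: H_smult_right)
  show "H x u w = H x v w"
    by (rule complex_eqI) (simp_all only: * assms)
qed

lemma bilinear_g: "bilinear (g x)"
  by (auto simp: bilinear_def g_def H_add H_add_right H_smult H_smult_right scaleR_eq_smult
      intro!: linearI)

lemma riemannian_g: "riemannian g"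
proof -
  have "g x u v = g x v u" for x u v
    unfolding g_def by (subst H_cnj) simp
  then show ?thesis
    using H_smooth H_pos bilinear_g by (auto simp: riemannian_def g_def)
qed

lemma dirderiv_g: "dirderiv (\<lambda>y. g y u v) x c = Re (K x c u v) + Re (K x c v u)"
proof -
  have "((\<lambda>y. g y u v) has_derivative (\<lambda>c. Re (K x c u v + cnj (K x c v u)))) (at x)"
    unfolding g_def by (rule has_derivative_Re[OF H_deriv])
  then show ?thesis by (simp add: dirderiv_eq)
qed

text \<open>The exterior derivative is a cyclic sum of six imaginary parts of \<open>K\<close>,
  which cancel in pairs by the symmetry \<open>K_commute\<close>.\<close>

lemma kaehler_g: "kaehler g"
proof -
  have 1: "g x (J u) (J v) = g x u v" for x u v
    by (simp add: g_def H_smult H_smult_right)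
  have K_right: "K x c (\<i> *s u) v = \<i> * K x c u v" for x c u v
    by (metis K_commute K_smult)
  have "dirderiv (\<lambda>y. kaehler_form g y v w) x u = - Im (K x u v w) + Im (K x u w v)" for x u v w
    unfolding kaehler_form_def dirderiv_g by (simp add: K_right K_smult_right)
  then show ?thesis
    unfolding kaehler_def using riemannian_g 1
    by (simp add: K_commute[of _ v u for u v])
qed

lemma sharp_g:
  assumes "\<And>w. Re (H x z w) = \<alpha> w"
  shows "sharp g x \<alpha> = z"
  unfolding sharp_def g_def
  by (rule the_equality) (use assms in \<open>auto intro!: Re_H_eqD[of x]\<close>)

text \<open>In Koszul's formula the symmetry of \<open>K\<close> cancels everything except
  \<open>Re (K x u v w)\<close>: the Levi-Civita and Chern connections coincide.\<close>

lemma christoffel_g: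
  assumes "\<And>w. H x z w = K x u v w"
  shows "christoffel g x u v = z"
  unfolding christoffel_def dirderiv_g
proof (rule sharp_g)
  fix w
  show "Re (H x z w) = (Re (K x u v w) + Re (K x u w v) + (Re (K x v u w) + Re (K x v w u))
      - (Re (K x w u v) + Re (K x w v u))) / 2"
    using K_commute[of x v u w] K_commute[of x w u v] K_commute[of x w v u] by (simp add: assms)
qed

end

section \<open>The Chern connection and its curvature\<close>

locale hermitian_metric_connection = hermitian_metric +
  fixes \<Gamma>
  assumes H_\<Gamma>: "H x (\<Gamma> x u v) w = K x u v w"
    and \<Gamma>_differentiable: "(\<lambda>y. \<Gamma> y u v) differentiable (at x)"
begin

abbreviation "\<Gamma>' x c u v \<equiv> dirderiv (\<lambda>y. \<Gamma> y u v) x c"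

text \<open>The derivative of \<open>\<Gamma>\<close> is only real linear in its direction
  \<open>c\<close>. Its antilinear (antiholomorphic) part carries the curvature; the linear part
  will cancel.\<close>

definition antilinear_\<Gamma>' where
  "antilinear_\<Gamma>' x c u v = (1/2) *s (\<Gamma>' x c u v + \<i> *s \<Gamma>' x (\<i> *s c) u v)"

definition linear_\<Gamma>' where
  "linear_\<Gamma>' x c u v = (1/2) *s (\<Gamma>' x c u v - \<i> *s \<Gamma>' x (\<i> *s c) u v)"

lemma \<Gamma>_commute: "\<Gamma> x u v = \<Gamma> x v u"
  by (rule H_eqD[of x]) (metis H_\<Gamma> K_commute)

lemma \<Gamma>_smult: "\<Gamma> x (a *s u) v = a *s \<Gamma> x u v"
  by (rule H_eqD[of x]) (simp add: H_smult H_\<Gamma> K_smult)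

lemma \<Gamma>_deriv: "((\<lambda>y. \<Gamma> y u v) has_derivative (\<lambda>c. \<Gamma>' x c u v)) (at x)"
  using has_derivative_dirderiv[OF \<Gamma>_differentiable] .

lemma \<Gamma>'_minus: "\<Gamma>' x (- c) u v = - \<Gamma>' x c u v"
  using linear_neg[OF has_derivative_linear[OF \<Gamma>_deriv]] by metis

lemma \<Gamma>'_ii: "\<Gamma>' x (\<i> *s (\<i> *s c)) u v = - \<Gamma>' x c u v"
  by (simp add: vector_smult_assoc vector_smult_lneg \<Gamma>'_minus)

lemma \<Gamma>'_smult_right: "\<Gamma>' x c u (a *s v) = a *s \<Gamma>' x c u v"
proof -
  have "bounded_linear (\<lambda>v::complex^'a. a *s v)"
    by (auto simp: linear_conv_bounded_linear[symmetric] scaleR_eq_smult vector_add_ldistrib vector_smult_assoc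
        mult.commute intro!: linearI)
  then have "((\<lambda>y. a *s \<Gamma> y u v) has_derivative (\<lambda>c. a *s \<Gamma>' x c u v)) (at x)"
    by (rule bounded_linear.has_derivative[OF _ \<Gamma>_deriv])
  moreover have "(\<lambda>y. \<Gamma> y u (a *s v)) = (\<lambda>y. a *s \<Gamma> y u v)"
    by (metis \<Gamma>_commute \<Gamma>_smult)
  ultimately show ?thesis by (simp add: dirderiv_eq)
qed

lemma \<Gamma>'_commute: "\<Gamma>' x c u v = \<Gamma>' x c v u"
  by (metis \<Gamma>_commute)

lemma \<Gamma>'_smult_left: "\<Gamma>' x c (a *s u) v = a *s \<Gamma>' x c u v"
  by (simp only: \<Gamma>'_commute[where v=v] \<Gamma>'_smult_right)

lemma \<Gamma>'_split: "\<Gamma>' x c u v = linear_\<Gamma>' x c u v + antilinear_\<Gamma>' x c u v"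
  by (simp add: linear_\<Gamma>'_def antilinear_\<Gamma>'_def vec_eq_iff algebra_simps)

lemma antilinear_\<Gamma>'_ii: "antilinear_\<Gamma>' x (\<i> *s c) u v = - (\<i> *s antilinear_\<Gamma>' x c u v)"
  unfolding antilinear_\<Gamma>'_def \<Gamma>'_ii
  by (simp add: vec_eq_iff algebra_simps)

lemma antilinear_\<Gamma>'_smult_right: "antilinear_\<Gamma>' x c u (a *s v) = a *s antilinear_\<Gamma>' x c u v"
  unfolding antilinear_\<Gamma>'_def \<Gamma>'_smult_right by (simp add: vec_eq_iff algebra_simps)

text \<open>\<open>H_deriv\<close> is stated for constant vectors, so the moving argument is
  expanded in the standard basis and the product rule applied to its coefficients.\<close>

lemma has_derivative_H_moving:
  assumes "(\<gamma> has_derivative \<gamma>') (at x)"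
  shows "((\<lambda>y. H y (\<gamma> y) z) has_derivative
          (\<lambda>c. H x (\<gamma>' c) z + K x c (\<gamma> x) z + cnj (K x c z (\<gamma> x)))) (at x)"
proof -
  have ex: "H y v z = (\<Sum>i\<in>UNIV. v $ i * H y (axis i 1) z)" for y v z
    by (subst basis_expansion[of v, symmetric]) (simp only: H_sum finite H_smult)
  have K1: "K y c v z = (\<Sum>i\<in>UNIV. v $ i * K y c (axis i 1) z)" for y c v
    by (subst basis_expansion[of v, symmetric]) (simp only: K_commute[of y c] K_sum finite K_smult)
  \<comment> \<open>Linearity in the last slot of \<open>K\<close> comes from \<open>H\<close>: by
    \<open>H_\<Gamma>\<close>, the left side is \<open>H y v (\<Gamma> y c z)\<close>.\<close>
  have K2: "cnj (K y c z v) = (\<Sum>i\<in>UNIV. v $ i * cnj (K y c z (axis i 1)))" for y c v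
    by (simp only: H_\<Gamma>[symmetric] H_cnj[symmetric]) (rule ex)
  have \<gamma>: "((\<lambda>y. \<gamma> y $ i) has_derivative (\<lambda>c. \<gamma>' c $ i)) (at x)" for i
    by (rule has_derivative_compose[OF assms has_derivative_vec_nth])
  have "((\<lambda>y. \<Sum>i\<in>UNIV. \<gamma> y $ i * H y (axis i 1) z) has_derivative
      (\<lambda>c. \<Sum>i\<in>UNIV. \<gamma> x $ i * (K x c (axis i 1) z + cnj (K x c z (axis i 1)))
        + \<gamma>' c $ i * H x (axis i 1) z)) (at x)"
    by (intro has_derivative_sum has_derivative_mult \<gamma> H_deriv)
  then show ?thesis
    by (simp add: ex[symmetric] K1[symmetric] K2[symmetric] distrib_left sum.distrib add_ac)
qed

text \<open>The \<open>(2,0)\<close> part of the curvature vanishes: \<open>linear_\<Gamma>' c v w + \<Gamma> c (\<Gamma> v w)\<close> is dual to a second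
  derivative of \<open>H\<close>, hence symmetric in \<open>c\<close> and \<open>v\<close>.\<close>

lemma linear_\<Gamma>'_commute:
  "linear_\<Gamma>' x c v w + \<Gamma> x c (\<Gamma> x v w) = linear_\<Gamma>' x v c w + \<Gamma> x v (\<Gamma> x c w)"
proof (rule H_eqD[of x])
  fix z
  define DK where "DK c v w z = H x (\<Gamma>' x c v w) z + K x c (\<Gamma> x v w) z + cnj (K x c z (\<Gamma> x v w))" for c v w z
  have DK: "((\<lambda>y. K y v w z) has_derivative (\<lambda>c. DK c v w z)) (at x)" for v w z
    using has_derivative_H_moving[OF \<Gamma>_deriv] unfolding DK_def H_\<Gamma> .
  \<comment> \<open>This is the symmetry of the second derivatives of the real function
    \<open>g y w z\<close>.\<close>
  have re: "Re (DK c v w z) + Re (DK c v z w) = Re (DK v c w z) + Re (DK v c z w)" for c v w z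
  proof -
    have "dirderiv (\<lambda>y. dirderiv (\<lambda>y. g y w z) y v) x c = Re (DK c v w z) + Re (DK c v z w)" for v c
      unfolding dirderiv_g
      by (subst dirderiv_eq[of _ "\<lambda>c. Re (DK c v w z) + Re (DK c v z w)"])
        (auto intro!: has_derivative_add has_derivative_Re DK)
    moreover have "Ck_on 2 UNIV (\<lambda>y. g y w z)"
      using H_smooth unfolding smooth_on_def g_def by blast
    ultimately show ?thesis
      using dirderiv_commute_real[of "\<lambda>y. g y w z" v x c] by simp
  qed
  have DK_ii: "DK c v (\<i> *s w) z = \<i> * DK c v w z" "DK c v z (\<i> *s w) = - \<i> * DK c v z w" for c v w z
    unfolding DK_def \<Gamma>'_smult_right H_smult H_smult_right
    by (simp_all add: H_smult H_smult_right K_smult K_smult_right \<Gamma>_commute[of x v "\<i> *s w"] \<Gamma>_smult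
        \<Gamma>_commute[of x w v] K_commute[of x c "\<i> *s _"] K_commute[of x _ c] algebra_simps)
  \<comment> \<open>Replacing \<open>w\<close> by \<open>\<i> *s w\<close> in \<open>re\<close>
    supplies the imaginary part.\<close>
  have S: "DK c v w z + cnj (DK c v z w) = DK v c w z + cnj (DK v c z w)" for c v
  proof (rule complex_eqI)
    show "Re (DK c v w z + cnj (DK c v z w)) = Re (DK v c w z + cnj (DK v c z w))"
      using re[of c v w z] by simp
    show "Im (DK c v w z + cnj (DK c v z w)) = Im (DK v c w z + cnj (DK v c z w))"
      using re[of c v "\<i> *s w" z] by (simp add: DK_ii)
  qed
  have DK_ii2: "DK c (\<i> *s v) w z = \<i> * DK c v w z" for c v w z
    unfolding DK_def \<Gamma>'_smult_left H_smult
    by (simp add: H_smult H_smult_right K_smult K_smult_right \<Gamma>_smult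
        K_commute[of x c "\<i> *s _"] K_commute[of x _ c] algebra_simps)
  have lin: "DK c v w z - \<i> * DK (\<i> *s c) v w z = 2 * H x (linear_\<Gamma>' x c v w + \<Gamma> x c (\<Gamma> x v w)) z" for c v
    unfolding DK_def linear_\<Gamma>'_def
    by (simp add: H_add H_diff H_smult H_\<Gamma> K_smult algebra_simps)
  \<comment> \<open>The four instances extract the part of \<open>S\<close> that is complex linear
    in both directions; the conjugated terms are antilinear in one of them and drop out.\<close>
  have "DK c v w z - \<i> * DK (\<i> *s c) v w z = DK v c w z - \<i> * DK (\<i> *s v) c w z"
    using S[of c v] S[of c "\<i> *s v"] S[of "\<i> *s c" v] S[of "\<i> *s c" "\<i> *s v"]
    unfolding DK_ii2 by (simp add: complex_eq_iff)
  then show "H x (linear_\<Gamma>' x c v w + \<Gamma> x c (\<Gamma> x v w)) z = H x (linear_\<Gamma>' x v c w + \<Gamma> x v (\<Gamma> x c w)) z"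
    unfolding lin by simp
qed

lemma christoffel_\<Gamma>: "christoffel g x u v = \<Gamma> x u v"
  by (rule christoffel_g) (rule H_\<Gamma>)

text \<open>By \<open>linear_\<Gamma>'_commute\<close> the linear parts cancel against the quadratic
  terms in the connection.\<close>

lemma curvature_g:
  "curvature g x u v w = antilinear_\<Gamma>' x u v w - antilinear_\<Gamma>' x v u w"
  using linear_\<Gamma>'_commute[of x u v w]
  unfolding curvature_def christoffel_\<Gamma> \<Gamma>'_split by (simp add: algebra_simps)

text \<open>Of the two curvature terms, one is antilinear in the traced vector and has trace zero;
  the other is the antiholomorphic derivative \<open>Q\<close> of the trace of
  \<open>\<Gamma>\<close>. This replaces the classical formula with ln det H and avoids the
  determinant.\<close>

lemma ricci_g:
  assumes "((\<lambda>y. \<Sum>i\<in>UNIV. \<Gamma> y (axis i 1) w $ i) has_derivative (\<lambda>c. P c + Q c)) (at x)"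
    and P: "P (\<i> *s v) = \<i> * P v" and Q: "Q (\<i> *s v) = - \<i> * Q v"
  shows "ricci g x v w = - 2 * Re (Q v)"
proof -
  have "((\<lambda>y. \<Sum>i\<in>UNIV. \<Gamma> y (axis i 1) w $ i) has_derivative
      (\<lambda>c. \<Sum>i\<in>UNIV. \<Gamma>' x c (axis i 1) w $ i)) (at x)"
    by (intro has_derivative_sum has_derivative_compose[OF \<Gamma>_deriv has_derivative_vec_nth])
  from fun_cong[OF has_derivative_unique[OF assms(1) this]]
  have PQ: "P c + Q c = (\<Sum>i\<in>UNIV. \<Gamma>' x c (axis i 1) w $ i)" for c .
  \<comment> \<open>Combining the values at \<open>v\<close> and \<open>\<i> *s v\<close> isolates
    the antilinear part.\<close>
  have "2 * Q v = (P v + Q v) + \<i> * (P (\<i> *s v) + Q (\<i> *s v))"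
    unfolding P Q by (simp add: algebra_simps)
  also have "\<dots> = 2 * (\<Sum>i\<in>UNIV. antilinear_\<Gamma>' x v (axis i 1) w $ i)"
    unfolding PQ antilinear_\<Gamma>'_def sum_distrib_left
    by (simp add: sum.distrib sum_distrib_left flip: sum_divide_distrib)
  finally have Q_eq: "Q v = (\<Sum>i\<in>UNIV. antilinear_\<Gamma>' x v (axis i 1) w $ i)" by simp
  have "(\<Sum>b\<in>Basis. antilinear_\<Gamma>' x b v w \<bullet> b) = 0"
    by (rule real_trace_antilinear) (rule antilinear_\<Gamma>'_ii)
  moreover have "antilinear_\<Gamma>' x v (\<i> *s b) w = \<i> *s antilinear_\<Gamma>' x v b w" for b
    using antilinear_\<Gamma>'_smult_right[of x v w \<i> b]
    by (simp only: antilinear_\<Gamma>'_def \<Gamma>'_commute[where v=w])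
  then have "(\<Sum>b\<in>Basis. antilinear_\<Gamma>' x v b w \<bullet> b) = 2 * Re (Q v)"
    unfolding Q_eq by (rule real_trace_complex_linear)
  ultimately show ?thesis
    by (simp add: ricci_def curvature_g inner_diff_left sum_subtractf)
qed

lemma scalar_curvature_g:
  assumes "\<And>v w. ricci g x v w = Re (H x (L v) w)" and "\<And>v. L (\<i> *s v) = \<i> *s L v"
  shows "scalar_curvature g x = 2 * Re (\<Sum>i\<in>UNIV. L (axis i 1) $ i)"
proof -
  have "sharp g x (ricci g x b) = L b" for b
    by (rule sharp_g) (simp add: assms)
  then show ?thesis
    unfolding scalar_curvature_def using real_trace_complex_linear[of L, OF assms(2)] by simp
qed

lemma gradient_g:
  assumes "(f has_derivative (\<lambda>w. Re (H x z w))) (at x)"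
  shows "gradient g f x = z"
  unfolding gradient_def dirderiv_eq[OF assms] by (rule sharp_g) simp

end

section \<open>The Calabi ansatz in a chart\<close>

lemma of_real_Re_eq: "complex_of_real (Re z) = (z + cnj z) / 2"
  by (simp add: complex_add_cnj)

lemma has_derivative_of_real_Re:
  assumes "(f has_derivative (\<lambda>c. 2 * Re (h c))) F"
  shows "((\<lambda>y. complex_of_real (f y)) has_derivative (\<lambda>c. h c + cnj (h c))) F"
  using has_derivative_of_real[OF assms] by (simp add: complex_add_cnj)

text \<open>The Fubini--Study metric on the affine line is \<open>q |dt|\<^sup>2\<close>, and \<open>b dt\<close> is the \<open>\<partial>\<close>-derivative of its
  potential \<open>ln (1 + |t|\<^sup>2)\<close>.\<close>

definition Zf :: "complex \<Rightarrow> real" where "Zf t = 1 + (Re t)\<^sup>2 + (Im t)\<^sup>2"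
definition bf :: "complex \<Rightarrow> complex" where "bf t = cnj t / of_real (Zf t)"
definition qf :: "complex \<Rightarrow> real" where "qf t = 1 / (Zf t)\<^sup>2"

lemma Zf_pos: "Zf t > 0"
  by (simp add: Zf_def add_pos_nonneg)

lemma Zf_nz [simp]: "Zf t \<noteq> 0"
  using Zf_pos[of t] by simp

lemma of_real_Zf: "complex_of_real (Zf t) = 1 + t * cnj t"
  by (simp add: Zf_def complex_eq_iff power2_eq_square)

lemma one_plus_mult_cnj_nz [simp]: "1 + t * cnj t \<noteq> 0"
  by (metis Zf_nz of_real_eq_0_iff of_real_Zf)

lemma qf_pos: "qf t > 0"
  by (simp add: qf_def)

lemma Zf_deriv:
  assumes "(f has_derivative f') (at y)"
  shows "((\<lambda>y. Zf (f y)) has_derivative (\<lambda>c. 2 * Zf (f y) * Re (bf (f y) * f' c))) (at y)"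
proof -
  have "((\<lambda>y. Zf (f y)) has_derivative (\<lambda>c. 2 * (Re (f y) * Re (f' c) + Im (f y) * Im (f' c)))) (at y)"
    unfolding Zf_def by (rule derivative_eq_intros assms refl)+ (auto simp: algebra_simps)
  moreover have "Zf (f y) * Re (bf (f y) * f' c) = Re (f y) * Re (f' c) + Im (f y) * Im (f' c)" for c
    by (simp add: bf_def field_simps)
  ultimately show ?thesis by (simp add: mult.assoc)
qed

lemma qf_deriv:
  assumes "(f has_derivative f') (at y)"
  shows "((\<lambda>y. qf (f y)) has_derivative (\<lambda>c. - 4 * qf (f y) * Re (bf (f y) * f' c))) (at y)"
  unfolding qf_def
  by (rule derivative_eq_intros Zf_deriv[OF assms] refl)+
    (auto simp: power2_eq_square field_simps)

text \<open>The conjugate-linear coefficient is the Fubini--Study density, the mixed second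
  derivative of ln (1 + |t|^2).\<close>

lemma bf_deriv:
  assumes "(f has_derivative f') (at y)"
  shows "((\<lambda>y. bf (f y)) has_derivative (\<lambda>c. - (bf (f y))\<^sup>2 * f' c + of_real (qf (f y)) * cnj (f' c))) (at y)"
  unfolding bf_def
  apply (rule derivative_eq_intros Zf_deriv[OF assms] has_derivative_of_real bounded_linear.has_derivative[OF bounded_linear_cnj] assms refl)+
   apply simp
  apply (simp add: of_real_Re_eq bf_def qf_def of_real_Zf power2_eq_square)
  apply (rule ext)
  apply (simp add: divide_simps)
  apply (simp add: algebra_simps)
  done

lemma Zf_smooth: "smooth_on UNIV (\<lambda>y::complex^3. Zf (y $ i))"
proof -
  have "bounded_linear (\<lambda>y::complex^3. Re (y $ i))" "bounded_linear (\<lambda>y::complex^3. Im (y $ i))"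
    using bounded_linear_compose[OF bounded_linear_Re bounded_linear_vec_nth[of i]]
      bounded_linear_compose[OF bounded_linear_Im bounded_linear_vec_nth[of i]] by blast+
  then show ?thesis
    unfolding Zf_def
    by (intro smooth_on_add smooth_on_power smooth_on_const smooth_on_bounded_linear open_UNIV)
qed

text \<open>\<open>X t\<close> is the momentum as a function of the squared fibre norm \<open>t\<close>; \<open>D (X t) = 2 X' t\<close>, and
  \<open>t * D (X t)\<close> is the squared norm of the generator of the fibrewise circle action. The sign \<open>e\<close>
  tells whether the chart is centred at the zero or at the infinity section. \<open>\<kappa>\<close> is the logarithmic
  derivative in \<open>t\<close> of the determinant of the metric.\<close>

locale calabi_chart =
  fixes A B e :: real and X D D' \<kappa>' :: "real \<Rightarrow> real" and T W :: "real set" and s0 s1 :: real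
    and \<kappa> :: "real \<Rightarrow> real"
  defines "\<kappa> \<equiv> \<lambda>x. D' x / 2 - e * D x / (2 * (A - e * x)) + e * D x / (2 * (B + e * x))"
  assumes sign: "e = 1 \<or> e = - 1"
    and X_deriv: "t \<ge> 0 \<Longrightarrow> (X has_real_derivative D (X t) / 2) (at t)"
    and D_deriv: "t \<ge> 0 \<Longrightarrow> (D has_real_derivative D' (X t)) (at (X t))"
    and \<kappa>_deriv: "t \<ge> 0 \<Longrightarrow> (\<kappa> has_real_derivative \<kappa>' (X t)) (at (X t))"
    and D_pos: "t \<ge> 0 \<Longrightarrow> D (X t) > 0"
    and A_pos: "t \<ge> 0 \<Longrightarrow> A - e * X t > 0"
    and B_pos: "t \<ge> 0 \<Longrightarrow> B + e * X t > 0"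
    and X_smooth: "{0..} \<subseteq> T" "smooth_on T X"
    and D_smooth: "X ` T \<subseteq> W" "smooth_on W D"
    and scal: "t \<ge> 0 \<Longrightarrow>
      2 * (- 2 * (\<kappa> (X t) + t * \<kappa>' (X t) * D (X t) / 2) / D (X t)
        + (e * t * \<kappa> (X t) + e + 2) / (A - e * X t) - (e * t * \<kappa> (X t) + e - 2) / (B + e * X t))
      = s1 * X t + s0"
begin

text \<open>The Hermitian norm on the fibre, with base coordinates \<open>y$2\<close> and
  \<open>y$3\<close>. At infinity the fibre coordinate is the reciprocal one and lives in the dual
  bundle, hence the inverted quotient.\<close>

definition N :: "complex^3 \<Rightarrow> real" where
  "N y = (if e = 1 then Zf (y$3) / Zf (y$2) else Zf (y$2) / Zf (y$3))"
definition t :: "complex^3 \<Rightarrow> real" where "t y = ((Re (y$1))\<^sup>2 + (Im (y$1))\<^sup>2) * N y"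
definition x :: "complex^3 \<Rightarrow> real" where "x y = X (t y)"
definition E :: "complex^3 \<Rightarrow> real" where "E y = N y * D (x y)"
definition P :: "complex^3 \<Rightarrow> real" where "P y = 2 * (A - e * x y) * qf (y$2)"
definition M :: "complex^3 \<Rightarrow> real" where "M y = 2 * (B + e * x y) * qf (y$3)"
text \<open>The holomorphic derivative of ln \<open>N\<close>, i.e. the connection form of the line
  bundle; \<open>\<eta>\<close> is then the covariant differential of the fibre coordinate,
  \<open>y$1\<close> times the holomorphic derivative of ln \<open>t\<close>. As
  \<open>E |y$1|^2 = t D\<close>, the term \<open>E |\<eta>|^2\<close> is the fibre part of the
  metric in a form regular at \<open>y$1 = 0\<close>.\<close>

definition \<beta> :: "complex^3 \<Rightarrow> complex^3 \<Rightarrow> complex" where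
  "\<beta> y v = of_real e * (bf (y$3) * v$3 - bf (y$2) * v$2)"
definition \<eta> :: "complex^3 \<Rightarrow> complex^3 \<Rightarrow> complex" where "\<eta> y v = v$1 + y$1 * \<beta> y v"
definition H :: "complex^3 \<Rightarrow> complex^3 \<Rightarrow> complex^3 \<Rightarrow> complex" where
  "H y u v = of_real (E y) * \<eta> y u * cnj (\<eta> y v) + of_real (P y) * u$2 * cnj (v$2)
     + of_real (M y) * u$3 * cnj (v$3)"

lemma N_pos: "N y > 0"
  by (simp add: N_def Zf_pos)

lemma t_nonneg: "t y \<ge> 0"
  using N_pos[of y] by (simp add: t_def)

lemma of_real_t: "complex_of_real (t y) = y$1 * cnj (y$1) * of_real (N y)"
  by (simp add: t_def complex_eq_iff power2_eq_square)

lemma E_pos: "E y > 0" and P_pos: "P y > 0" and M_pos: "M y > 0"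
  using N_pos[of y] D_pos[OF t_nonneg] A_pos[OF t_nonneg] B_pos[OF t_nonneg] qf_pos
  unfolding E_def P_def M_def x_def by (intro mult_pos_pos; simp)+

lemma A_pos': "A - e * x y > 0" and B_pos': "B + e * x y > 0"
  using A_pos B_pos t_nonneg by (auto simp: x_def)

lemma N_deriv: "(N has_derivative (\<lambda>c. 2 * N y * Re (\<beta> y c))) (at y)"
proof (cases "e = 1")
  case True
  then show ?thesis
    unfolding N_def \<beta>_def
    by simp ((rule derivative_eq_intros Zf_deriv[OF has_derivative_vec_nth] refl)+,
      auto simp: power2_eq_square field_simps)
next
  case False
  then have "e = -1" using sign by simp
  then show ?thesis
    unfolding N_def \<beta>_def
    by simp ((rule derivative_eq_intros Zf_deriv[OF has_derivative_vec_nth] refl)+,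
      auto simp: power2_eq_square field_simps)
qed

lemma t_deriv: "(t has_derivative (\<lambda>c. 2 * N y * Re (cnj (y$1) * \<eta> y c))) (at y)"
  unfolding t_def \<eta>_def
  by (rule derivative_eq_intros N_deriv has_derivative_vec_nth refl)+
    (auto simp: power2_eq_square algebra_simps)

lemma x_deriv: "(x has_derivative (\<lambda>c. E y * Re (cnj (y$1) * \<eta> y c))) (at y)"
proof -
  have "(X has_derivative (*) (D (X (t y)) / 2)) (at (t y))"
    using X_deriv[OF t_nonneg] by (rule has_field_derivative_imp_has_derivative)
  from has_derivative_compose[OF t_deriv this] show ?thesis
    by (simp add: x_def[abs_def] E_def mult_ac)
qed

lemma compose_x_deriv:
  assumes "(h has_real_derivative h' (x y)) (at (x y))"
  shows "((\<lambda>y. h (x y)) has_derivative (\<lambda>c. h' (x y) * (E y * Re (cnj (y$1) * \<eta> y c)))) (at y)"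
  using has_derivative_compose[OF x_deriv has_field_derivative_imp_has_derivative[OF assms]] .

lemma Dx_deriv: "((\<lambda>y. D (x y)) has_derivative (\<lambda>c. D' (x y) * (E y * Re (cnj (y$1) * \<eta> y c)))) (at y)"
  by (rule compose_x_deriv) (simp add: x_def D_deriv t_nonneg)

text \<open>\<open>E'\<close>, \<open>P'\<close>, \<open>M'\<close> are the holomorphic derivatives
  of the three real coefficients, each real differential being twice the real part.\<close>

definition E' :: "complex^3 \<Rightarrow> complex^3 \<Rightarrow> complex" where
  "E' y c = of_real (E y) * (\<beta> y c + of_real (D' (x y) * N y / 2) * cnj (y$1) * \<eta> y c)"
definition P' :: "complex^3 \<Rightarrow> complex^3 \<Rightarrow> complex" where
  "P' y c = - of_real (e * E y * qf (y$2)) * cnj (y$1) * \<eta> y c - 2 * of_real (P y) * bf (y$2) * c$2"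
definition M' :: "complex^3 \<Rightarrow> complex^3 \<Rightarrow> complex" where
  "M' y c = of_real (e * E y * qf (y$3)) * cnj (y$1) * \<eta> y c - 2 * of_real (M y) * bf (y$3) * c$3"

lemma E_deriv: "(E has_derivative (\<lambda>c. 2 * Re (E' y c))) (at y)"
  unfolding E_def[abs_def]
  by (rule derivative_eq_intros N_deriv Dx_deriv refl)+ (simp add: E'_def E_def fun_eq_iff field_simps)

lemma P_deriv: "(P has_derivative (\<lambda>c. 2 * Re (P' y c))) (at y)"
  unfolding P_def[abs_def]
  by (rule derivative_eq_intros x_deriv qf_deriv has_derivative_vec_nth refl)+
    (simp add: P_def P'_def algebra_simps)

lemma M_deriv: "(M has_derivative (\<lambda>c. 2 * Re (M' y c))) (at y)"
  unfolding M_def[abs_def]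
  by (rule derivative_eq_intros x_deriv qf_deriv has_derivative_vec_nth refl)+
    (simp add: M_def M'_def algebra_simps)

definition \<beta>' :: "complex^3 \<Rightarrow> complex^3 \<Rightarrow> complex^3 \<Rightarrow> complex" where
  "\<beta>' y c v = of_real e * ((bf (y$2))\<^sup>2 * c$2 * v$2 - (bf (y$3))\<^sup>2 * c$3 * v$3)"
text \<open>The antiholomorphic derivative of the connection form: the curvature of the line bundle,
  a difference of the two Fubini--Study forms.\<close>

definition \<beta>'' :: "complex^3 \<Rightarrow> complex^3 \<Rightarrow> complex^3 \<Rightarrow> complex" where
  "\<beta>'' y c v = of_real e * (of_real (qf (y$3)) * cnj (c$3) * v$3 - of_real (qf (y$2)) * cnj (c$2) * v$2)"

lemma \<beta>_deriv: "((\<lambda>y. \<beta> y v) has_derivative (\<lambda>c. \<beta>' y c v + \<beta>'' y c v)) (at y)"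
  unfolding \<beta>_def[abs_def]
  by (rule derivative_eq_intros bf_deriv has_derivative_vec_nth refl)+
    (simp add: \<beta>'_def \<beta>''_def algebra_simps)

lemma \<eta>_deriv:
  "((\<lambda>y. \<eta> y v) has_derivative (\<lambda>c. c$1 * \<beta> y v + y$1 * (\<beta>' y c v + \<beta>'' y c v))) (at y)"
  unfolding \<eta>_def[abs_def]
  by (rule derivative_eq_intros \<beta>_deriv has_derivative_vec_nth refl)+
    (simp add: algebra_simps)

text \<open>The terms of the derivative of \<open>H\<close> that are complex linear in
  \<open>c\<close>. The factor \<open>cnj (\<eta> y v)\<close> contributes exactly the curvature
  term.\<close>

definition K :: "complex^3 \<Rightarrow> complex^3 \<Rightarrow> complex^3 \<Rightarrow> complex^3 \<Rightarrow> complex" where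
  "K y c u v =
     (E' y c * \<eta> y u + of_real (E y) * (c$1 * \<beta> y u + y$1 * \<beta>' y c u)) * cnj (\<eta> y v)
     + of_real (E y) * \<eta> y u * cnj (y$1) * cnj (\<beta>'' y c v)
     + P' y c * u$2 * cnj (v$2) + M' y c * u$3 * cnj (v$3)"

lemma cnj_\<beta>'': "cnj (\<beta>'' y c v) =
    of_real e * (of_real (qf (y$3)) * c$3 * cnj (v$3) - of_real (qf (y$2)) * c$2 * cnj (v$2))"
  by (simp add: \<beta>''_def)

lemma H_deriv: "((\<lambda>y. H y u v) has_derivative (\<lambda>c. K y c u v + cnj (K y c v u))) (at y)"
  unfolding H_def[abs_def]
  by (rule derivative_eq_intros has_derivative_of_real_Re bounded_linear.has_derivative[OF bounded_linear_cnj]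
      E_deriv P_deriv M_deriv \<eta>_deriv refl)+ (simp add: K_def algebra_simps)

lemma e_square: "complex_of_real e * complex_of_real e = 1" "e * e = 1"
  using sign by auto

text \<open>The point of the ansatz: the derivatives of \<open>A - e * x\<close> and
  \<open>B + e * x\<close> produce terms with \<open>\<eta> y c * u$2\<close> and
  \<open>\<eta> y c * u$3\<close>, and the bundle curvature produces their mirror images with
  \<open>c\<close> and \<open>u\<close> exchanged.\<close>

lemma K_commute: "K y c u v = K y u c v"
  unfolding K_def E'_def P'_def M'_def cnj_\<beta>'' \<beta>'_def \<eta>_def by (simp add: algebra_simps)

lemma \<beta>_smult: "\<beta> y (a *s v) = a * \<beta> y v" and \<eta>_smult: "\<eta> y (a *s v) = a * \<eta> y v"
  by (simp_all add: \<beta>_def \<eta>_def algebra_simps)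

lemma \<beta>_add: "\<beta> y (u + v) = \<beta> y u + \<beta> y v" and \<eta>_add: "\<eta> y (u + v) = \<eta> y u + \<eta> y v"
  by (simp_all add: \<beta>_def \<eta>_def algebra_simps)

lemma H_smooth: "smooth_on UNIV (\<lambda>y. Re (H y u v))"
proof -
  have Zi: "smooth_on UNIV (\<lambda>y::complex^3. inverse (Zf (y $ i)))" for i
    by (rule smooth_on_inverse[OF open_UNIV Zf_smooth]) (rule Zf_pos)
  have N: "smooth_on UNIV N"
    unfolding N_def[abs_def] divide_inverse
    by (cases "e = 1") (auto intro!: smooth_on_mult Zf_smooth Zi)
  have "bounded_linear (\<lambda>y::complex^3. Re (y $ i))" "bounded_linear (\<lambda>y::complex^3. Im (y $ i))" for i
    using bounded_linear_compose[OF bounded_linear_Re bounded_linear_vec_nth[of i]]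
      bounded_linear_compose[OF bounded_linear_Im bounded_linear_vec_nth[of i]] by blast+
  then have "smooth_on UNIV t"
    unfolding t_def[abs_def]
    by (intro smooth_on_add smooth_on_mult N smooth_on_power smooth_on_bounded_linear open_UNIV)
  then have x: "smooth_on UNIV x"
    unfolding x_def[abs_def] using X_smooth t_nonneg
    by (intro smooth_on_compose[where V=T and h=X and \<phi>=t] open_UNIV) auto
  have "X (t y) \<in> W" for y
    using X_smooth(1) D_smooth(1) t_nonneg[of y] by auto
  then have "smooth_on UNIV (\<lambda>y. D (x y))"
    using D_smooth(2) x unfolding x_def
    by (intro smooth_on_compose[where V=W and h=D and \<phi>=x, unfolded x_def] open_UNIV) auto
  then have E: "smooth_on UNIV E"
    unfolding E_def[abs_def] by (intro smooth_on_mult N open_UNIV)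
  have q: "smooth_on UNIV (\<lambda>y::complex^3. qf (y $ i))" for i
    unfolding qf_def divide_inverse power_inverse[symmetric]
    by (intro smooth_on_mult smooth_on_power smooth_on_const Zi open_UNIV)
  have P: "smooth_on UNIV P" and M: "smooth_on UNIV M"
    unfolding P_def[abs_def] M_def[abs_def]
    by (intro smooth_on_mult smooth_on_diff smooth_on_add smooth_on_const q x open_UNIV)+
  have of_real: "smooth_on UNIV (\<lambda>y. complex_of_real (f y))" if "smooth_on UNIV f" for f :: "complex^3 \<Rightarrow> real"
    by (rule smooth_on_linear_compose[OF bounded_linear_of_real open_UNIV that])
  have cnj: "smooth_on UNIV (\<lambda>y. cnj (f y))" if "smooth_on UNIV f" for f :: "complex^3 \<Rightarrow> complex"
    by (rule smooth_on_linear_compose[OF bounded_linear_cnj open_UNIV that])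
  have nth: "smooth_on UNIV (\<lambda>y::complex^3. y $ i)" for i
    by (rule smooth_on_bounded_linear[OF bounded_linear_vec_nth])
  have b: "smooth_on UNIV (\<lambda>y::complex^3. bf (y $ i))" for i
    unfolding bf_def divide_inverse of_real_inverse[symmetric]
    by (intro smooth_on_mult cnj nth of_real Zi open_UNIV)
  have \<eta>: "smooth_on UNIV (\<lambda>y. \<eta> y v)" for v
    unfolding \<eta>_def \<beta>_def
    by (intro smooth_on_add smooth_on_mult smooth_on_diff smooth_on_const b nth open_UNIV)
  have "smooth_on UNIV (\<lambda>y. H y u v)"
    unfolding H_def
    by (intro smooth_on_add smooth_on_mult smooth_on_const of_real cnj E P M \<eta> open_UNIV)
  then show ?thesis
    by (rule smooth_on_linear_compose[OF bounded_linear_Re open_UNIV])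
qed

lemma H_pos: "u \<noteq> 0 \<Longrightarrow> 0 < Re (H y u u)"
proof -
  assume u: "u \<noteq> 0"
  have H: "Re (H y u u) = E y * (norm (\<eta> y u))\<^sup>2 + P y * (norm (u$2))\<^sup>2 + M y * (norm (u$3))\<^sup>2"
    unfolding cmod_power2 by (simp add: H_def power2_eq_square algebra_simps)
  have ge: "E y * (norm (\<eta> y u))\<^sup>2 \<ge> 0" "P y * (norm (u$2))\<^sup>2 \<ge> 0" "M y * (norm (u$3))\<^sup>2 \<ge> 0"
    using E_pos[of y] P_pos[of y] M_pos[of y] by simp_all
  show ?thesis
  proof (cases "u$2 = 0 \<and> u$3 = 0")
    case True
    then have "\<eta> y u \<noteq> 0"
      using u by (auto simp: \<eta>_def \<beta>_def vec_eq_iff forall_3)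
    then have "E y * (norm (\<eta> y u))\<^sup>2 > 0" using E_pos[of y] by simp
    then show ?thesis using H ge by linarith
  next
    case False
    then have "P y * (norm (u$2))\<^sup>2 > 0 \<or> M y * (norm (u$3))\<^sup>2 > 0"
      using P_pos[of y] M_pos[of y] by auto
    then show ?thesis using H ge by linarith
  qed
qed

lemma hermitian_metric_H: "hermitian_metric H K"
proof
  show "H y (u + u') v = H y u v + H y u' v" for y u u' v
    by (simp add: H_def \<eta>_add algebra_simps)
  show "H y (a *s u) v = a * H y u v" for y a u v
    by (simp add: H_def \<eta>_smult algebra_simps)
  show "H y v u = cnj (H y u v)" for y u v
    by (simp add: H_def algebra_simps)
  show "K y (c + d) u v = K y c u v + K y d u v" for y c d u v
    by (simp add: K_def E'_def P'_def M'_def cnj_\<beta>'' \<beta>'_def \<eta>_add \<beta>_add algebra_simps)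
  show "K y (a *s c) u v = a * K y c u v" for y a c u v
    by (simp add: K_def E'_def P'_def M'_def cnj_\<beta>'' \<beta>'_def \<eta>_smult \<beta>_smult algebra_simps)
  show "K y c u (a *s v) = cnj a * K y c u v" for y a c u v
    by (simp add: K_def cnj_\<beta>'' \<eta>_smult algebra_simps)
qed (rule H_pos H_smooth H_deriv K_commute; assumption?)+

section \<open>Connection coefficients of the ansatz\<close>

definition \<Gamma>2 :: "complex^3 \<Rightarrow> complex^3 \<Rightarrow> complex^3 \<Rightarrow> complex" where
  "\<Gamma>2 y u v = - of_real (e * E y / (2 * (A - e * x y))) * cnj (y$1) * (\<eta> y u * v$2 + \<eta> y v * u$2)
     - 2 * bf (y$2) * u$2 * v$2"
definition \<Gamma>3 :: "complex^3 \<Rightarrow> complex^3 \<Rightarrow> complex^3 \<Rightarrow> complex" where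
  "\<Gamma>3 y u v = of_real (e * E y / (2 * (B + e * x y))) * cnj (y$1) * (\<eta> y u * v$3 + \<eta> y v * u$3)
     - 2 * bf (y$3) * u$3 * v$3"
definition \<Gamma>1 :: "complex^3 \<Rightarrow> complex^3 \<Rightarrow> complex^3 \<Rightarrow> complex" where
  "\<Gamma>1 y u v = (of_real (D' (x y) * N y / 2) * cnj (y$1) * \<eta> y u + \<beta> y u) * \<eta> y v + u$1 * \<beta> y v
     + y$1 * \<beta>' y u v - y$1 * of_real e * (bf (y$3) * \<Gamma>3 y u v - bf (y$2) * \<Gamma>2 y u v)"
definition \<Gamma> :: "complex^3 \<Rightarrow> complex^3 \<Rightarrow> complex^3 \<Rightarrow> complex^3" where
  "\<Gamma> y u v = vector [\<Gamma>1 y u v, \<Gamma>2 y u v, \<Gamma>3 y u v]"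

text \<open>In the coframe \<open>\<eta>\<close>, \<open>v$2\<close>, \<open>v$3\<close> the form
  \<open>H\<close> is diagonal, so raising the index means dividing by \<open>E\<close>,
  \<open>P\<close>, \<open>M\<close>. The last summand of \<open>\<Gamma>1\<close> compensates
  \<open>\<beta>\<close> in \<open>\<eta> y (\<Gamma> y u v)\<close>.\<close>

lemma H_\<Gamma>: "H y (\<Gamma> y u v) w = K y u v w"
proof -
  have \<eta>: "\<eta> y (\<Gamma> y u v) = (of_real (D' (x y) * N y / 2) * cnj (y$1) * \<eta> y u + \<beta> y u) * \<eta> y v
      + u$1 * \<beta> y v + y$1 * \<beta>' y u v"
    unfolding \<eta>_def[of y "\<Gamma> y u v"] \<beta>_def[of y "\<Gamma> y u v"]
    by (simp add: \<Gamma>_def \<Gamma>1_def algebra_simps)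
  have 2: "of_real (P y) * \<Gamma>2 y u v = - of_real (e * E y * qf (y$2)) * cnj (y$1) * (\<eta> y u * v$2 + \<eta> y v * u$2)
      - 2 * of_real (P y) * bf (y$2) * u$2 * v$2"
  proof -
    have "P y * (e * E y / (2 * (A - e * x y))) = e * E y * qf (y$2)"
      using A_pos'[of y] by (simp add: P_def)
    then have *: "complex_of_real (P y) * of_real (e * E y / (2 * (A - e * x y))) = of_real (e * E y * qf (y$2))"
      by (simp only: of_real_mult[symmetric])
    show ?thesis unfolding *[symmetric] \<Gamma>2_def by (simp only: algebra_simps mult_minus_left mult_minus_right)
  qed
  have 3: "of_real (M y) * \<Gamma>3 y u v = of_real (e * E y * qf (y$3)) * cnj (y$1) * (\<eta> y u * v$3 + \<eta> y v * u$3)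
      - 2 * of_real (M y) * bf (y$3) * u$3 * v$3"
  proof -
    have "M y * (e * E y / (2 * (B + e * x y))) = e * E y * qf (y$3)"
      using B_pos'[of y] by (simp add: M_def)
    then have *: "complex_of_real (M y) * of_real (e * E y / (2 * (B + e * x y))) = of_real (e * E y * qf (y$3))"
      by (simp only: of_real_mult[symmetric])
    show ?thesis unfolding *[symmetric] \<Gamma>3_def by (simp only: algebra_simps mult_minus_left mult_minus_right)
  qed
  have "H y (\<Gamma> y u v) w = of_real (E y) * \<eta> y (\<Gamma> y u v) * cnj (\<eta> y w)
      + (of_real (P y) * \<Gamma>2 y u v) * cnj (w$2) + (of_real (M y) * \<Gamma>3 y u v) * cnj (w$3)"
    by (simp add: H_def \<Gamma>_def)
  also have "\<dots> = K y u v w"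
    unfolding \<eta> 2 3 K_def E'_def P'_def M'_def cnj_\<beta>'' by (simp add: algebra_simps)
  finally show ?thesis .
qed

text \<open>The locale provides derivatives of \<open>D\<close> and \<open>\<kappa>\<close> but not
  of \<open>D'\<close>; solving for \<open>D'\<close> gives the differentiability that
  \<open>\<Gamma>1\<close> requires.\<close>

lemma D'_eq: "D' = (\<lambda>r. 2 * (\<kappa> r + e * D r / (2 * (A - e * r)) - e * D r / (2 * (B + e * r))))"
  by (simp add: \<kappa>_def)

lemma differentiable_D'x: "(\<lambda>y. D' (x y)) differentiable (at y)"
proof -
  have "(\<lambda>r. 2 * (\<kappa> r + e * D r / (2 * (A - e * r)) - e * D r / (2 * (B + e * r)))) differentiable (at (x y))"
    using A_pos'[of y] B_pos'[of y] D_deriv[OF t_nonneg[of y]] \<kappa>_deriv[OF t_nonneg[of y]]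
    by (intro derivative_intros) (auto simp: x_def real_differentiable_def)
  then have "D' differentiable (at (x y))" by (subst D'_eq)
  then show ?thesis
    using differentiable_chain_at[of x y D'] x_deriv by (auto simp: o_def differentiable_def)
qed

lemma differentiable_of_real:
  "f differentiable F \<Longrightarrow> (\<lambda>y. complex_of_real (f y)) differentiable F"
  unfolding differentiable_def by (blast intro: has_derivative_of_real)

lemma \<Gamma>_differentiable: "(\<lambda>y. \<Gamma> y u v) differentiable (at y)"
proof -
  have nth: "(\<lambda>y::complex^3. y $ i) differentiable (at y)" for i
    using has_derivative_vec_nth differentiable_def by blast
  have cnj: "(\<lambda>y::complex^3. cnj (y $ i)) differentiable (at y)" for i
    using bounded_linear.has_derivative[OF bounded_linear_cnj has_derivative_vec_nth] differentiable_def by blast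
  have real: "E differentiable (at y)" "N differentiable (at y)" "x differentiable (at y)"
    using E_deriv N_deriv x_deriv differentiable_def by blast+
  have \<eta>: "(\<lambda>y. \<eta> y v) differentiable (at y)" and \<beta>: "(\<lambda>y. \<beta> y v) differentiable (at y)" for v
    using \<eta>_deriv \<beta>_deriv differentiable_def by blast+
  have b: "(\<lambda>y::complex^3. bf (y$i)) differentiable (at y)" for i
    using bf_deriv[OF has_derivative_vec_nth] differentiable_def by blast
  note rules = differentiable_add differentiable_diff differentiable_mult differentiable_minus
    differentiable_const differentiable_power differentiable_divide nth cnj real \<eta> \<beta> b
    differentiable_D'x differentiable_of_real
  have 2: "(\<lambda>y. \<Gamma>2 y u v) differentiable (at y)"
    unfolding \<Gamma>2_def by (intro rules) (use A_pos'[of y] in auto)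
  have 3: "(\<lambda>y. \<Gamma>3 y u v) differentiable (at y)"
    unfolding \<Gamma>3_def by (intro rules) (use B_pos'[of y] in auto)
  have 1: "(\<lambda>y. \<Gamma>1 y u v) differentiable (at y)"
    unfolding \<Gamma>1_def \<beta>'_def by (intro rules 2 3) auto
  obtain d1 d2 d3 where d: "((\<lambda>y. \<Gamma>1 y u v) has_derivative d1) (at y)"
      "((\<lambda>y. \<Gamma>2 y u v) has_derivative d2) (at y)" "((\<lambda>y. \<Gamma>3 y u v) has_derivative d3) (at y)"
    using 1 2 3 unfolding differentiable_def by blast
  have "((\<lambda>y. \<Gamma> y u v) has_derivative (\<lambda>c. vector [d1 c, d2 c, d3 c])) (at y)"
  proof (rule has_derivative_cart)
    show "((\<lambda>y. \<Gamma> y u v $ i) has_derivative (\<lambda>c. vector [d1 c, d2 c, d3 c] $ i)) (at y)" for i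
      using exhaust_3[of i] d by (auto simp: \<Gamma>_def)
  qed
  then show ?thesis unfolding differentiable_def by blast
qed

lemma connection_H: "hermitian_metric_connection H K \<Gamma>"
  by (intro hermitian_metric_connection.intro hermitian_metric_H hermitian_metric_connection_axioms.intro
      H_\<Gamma> \<Gamma>_differentiable)

end

section \<open>Ricci and scalar curvature of the ansatz\<close>

context calabi_chart begin

interpretation hermitian_metric_connection H K \<Gamma>
  by (rule connection_H)

text \<open>The holomorphic derivative of ln (E P M), that is of ln det H: \<open>N\<close>
  contributes e and the two Fubini--Study densities contribute -2 in the base coefficients.\<close>

definition lam :: "complex^3 \<Rightarrow> complex^3 \<Rightarrow> complex" where
  "lam y w = of_real (\<kappa> (x y) * N y) * cnj (y$1) * \<eta> y w + of_real (e - 2) * bf (y$3) * w$3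
     - of_real (e + 2) * bf (y$2) * w$2"

lemma trace_\<Gamma>: "(\<Sum>i\<in>UNIV. \<Gamma> y (axis i 1) w $ i) = lam y w"
proof -
  have \<eta>: "\<eta> y (axis 1 1) = 1" "\<eta> y (axis 2 1) = - y$1 * of_real e * bf (y$2)"
      "\<eta> y (axis 3 1) = y$1 * of_real e * bf (y$3)"
    and \<beta>: "\<beta> y (axis 1 1) = 0"
    by (simp_all add: \<eta>_def \<beta>_def axis_def)
  have \<beta>': "\<beta>' y (axis 1 1) w = 0"
    by (simp add: \<beta>'_def axis_def)
  define a b where "a = complex_of_real (E y / (2 * (A - e * x y)))" and "b = complex_of_real (E y / (2 * (B + e * x y)))"
  have ab: "complex_of_real (e * E y / (2 * (A - e * x y))) = of_real e * a"
      "complex_of_real (e * E y / (2 * (B + e * x y))) = of_real e * b"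
    by (simp_all add: a_def b_def)
  have "\<kappa> (x y) * N y = D' (x y) * N y / 2 - e * (E y / (2 * (A - e * x y))) + e * (E y / (2 * (B + e * x y)))"
    unfolding \<kappa>_def E_def by (simp add: algebra_simps)
  then have \<kappa>N: "complex_of_real (\<kappa> (x y) * N y) = of_real (D' (x y) * N y / 2) - of_real e * a + of_real e * b"
    unfolding a_def b_def by (simp only: of_real_mult[symmetric] of_real_add[symmetric] of_real_diff[symmetric])
  have ee: "complex_of_real e * (complex_of_real e * z) = z" for z
    using e_square(1) by (simp add: mult.assoc[symmetric])
  show ?thesis
    unfolding sum_3 \<Gamma>_def lam_def \<kappa>N vector_3 \<Gamma>1_def \<Gamma>2_def \<Gamma>3_def \<eta> \<beta> \<beta>' ab
    by (simp add: axis_def \<beta>_def[of y w] algebra_simps ee)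
qed

definition lam' :: "complex^3 \<Rightarrow> complex^3 \<Rightarrow> complex^3 \<Rightarrow> complex" where
  "lam' y w c = of_real (\<kappa> (x y) * N y) * cnj (y$1) * (\<beta> y c * \<eta> y w + c$1 * \<beta> y w + y$1 * \<beta>' y c w)
     + of_real (\<kappa>' (x y) * N y * E y / 2) * cnj (y$1) * cnj (y$1) * \<eta> y c * \<eta> y w
     - of_real (e - 2) * (bf (y$3))\<^sup>2 * c$3 * w$3 + of_real (e + 2) * (bf (y$2))\<^sup>2 * c$2 * w$2"

text \<open>The antilinear part. The terms with \<open>e * t y * \<kappa>\<close> come from the
  bundle curvature in the derivative of \<open>\<eta>\<close>, using
  \<open>y$1 * cnj (y$1) * N y = t y\<close>.\<close>

definition lam'' :: "complex^3 \<Rightarrow> complex^3 \<Rightarrow> complex^3 \<Rightarrow> complex" where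
  "lam'' y w c = of_real (N y * (\<kappa> (x y) + t y * \<kappa>' (x y) * D (x y) / 2)) * cnj (\<eta> y c) * \<eta> y w
     + of_real ((e * t y * \<kappa> (x y) + e - 2) * qf (y$3)) * cnj (c$3) * w$3
     - of_real ((e * t y * \<kappa> (x y) + e + 2) * qf (y$2)) * cnj (c$2) * w$2"

lemma lam_deriv: "((\<lambda>y. lam y w) has_derivative (\<lambda>c. lam' y w c + lam'' y w c)) (at y)"
proof -
  have "((\<lambda>y. \<kappa> (x y)) has_derivative (\<lambda>c. \<kappa>' (x y) * (E y * Re (cnj (y$1) * \<eta> y c)))) (at y)"
    by (rule compose_x_deriv) (simp add: x_def \<kappa>_deriv t_nonneg)
  then have "((\<lambda>y. \<kappa> (x y)) has_derivative (\<lambda>c. 2 * Re (of_real (\<kappa>' (x y) * E y / 2) * cnj (y$1) * \<eta> y c))) (at y)"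
    by (simp add: algebra_simps add_divide_distrib diff_divide_distrib)
  note \<kappa> = has_derivative_of_real_Re[OF this]
  have "(N has_derivative (\<lambda>c. 2 * Re (of_real (N y) * \<beta> y c))) (at y)"
    using N_deriv[of y] by (simp add: mult.assoc)
  note N = has_derivative_of_real_Re[OF this]
  have "((\<lambda>y. lam y w) has_derivative (\<lambda>c.
     of_real (\<kappa> (x y)) * of_real (N y) * cnj (y$1) * (c$1 * \<beta> y w + y$1 * (\<beta>' y c w + \<beta>'' y c w))
     + (of_real (\<kappa> (x y)) * of_real (N y) * cnj (c$1)
       + (of_real (\<kappa> (x y)) * (of_real (N y) * \<beta> y c + cnj (of_real (N y) * \<beta> y c))
        + (of_real (\<kappa>' (x y) * E y / 2) * cnj (y$1) * \<eta> y c + cnj (of_real (\<kappa>' (x y) * E y / 2) * cnj (y$1) * \<eta> y c)) * of_real (N y)) * cnj (y$1)) * \<eta> y w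
     + of_real (e - 2) * (- (bf (y$3))\<^sup>2 * c$3 + of_real (qf (y$3)) * cnj (c$3)) * w$3
     - of_real (e + 2) * (- (bf (y$2))\<^sup>2 * c$2 + of_real (qf (y$2)) * cnj (c$2)) * w$2)) (at y)"
    unfolding lam_def of_real_mult
    by (rule derivative_eq_intros \<kappa> N bounded_linear.has_derivative[OF bounded_linear_cnj]
      \<eta>_deriv bf_deriv has_derivative_vec_nth refl)+ (simp add: algebra_simps)
  moreover have "lam' y w c + lam'' y w c = (
     of_real (\<kappa> (x y)) * of_real (N y) * cnj (y$1) * (c$1 * \<beta> y w + y$1 * (\<beta>' y c w + \<beta>'' y c w))
     + (of_real (\<kappa> (x y)) * of_real (N y) * cnj (c$1)
       + (of_real (\<kappa> (x y)) * (of_real (N y) * \<beta> y c + cnj (of_real (N y) * \<beta> y c))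
        + (of_real (\<kappa>' (x y) * E y / 2) * cnj (y$1) * \<eta> y c + cnj (of_real (\<kappa>' (x y) * E y / 2) * cnj (y$1) * \<eta> y c)) * of_real (N y)) * cnj (y$1)) * \<eta> y w
     + of_real (e - 2) * (- (bf (y$3))\<^sup>2 * c$3 + of_real (qf (y$3)) * cnj (c$3)) * w$3
     - of_real (e + 2) * (- (bf (y$2))\<^sup>2 * c$2 + of_real (qf (y$2)) * cnj (c$2)) * w$2)" for c
    unfolding lam'_def lam''_def of_real_mult of_real_add of_real_divide of_real_diff of_real_t E_def \<beta>''_def \<eta>_def[of y c]
    by (simp add: algebra_simps add_divide_distrib)
  ultimately show ?thesis by simp
qed

text \<open>\<open>r1\<close>, \<open>r2\<close>, \<open>r3\<close> are the Ricci eigenvalues on the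
  fibre and on the two base factors, and \<open>L\<close> below is the Ricci endomorphism; the
  assumption \<open>scal\<close> says that twice their sum is affine in the momentum.\<close>

definition r1 where "r1 y = - 2 * (\<kappa> (x y) + t y * \<kappa>' (x y) * D (x y) / 2) / D (x y)"
definition r2 where "r2 y = (e * t y * \<kappa> (x y) + e + 2) / (A - e * x y)"
definition r3 where "r3 y = - ((e * t y * \<kappa> (x y) + e - 2) / (B + e * x y))"
definition L :: "complex^3 \<Rightarrow> complex^3 \<Rightarrow> complex^3" where
  "L y v = vector [of_real (r1 y) * \<eta> y v
      - y$1 * of_real e * (bf (y$3) * of_real (r3 y) * v$3 - bf (y$2) * of_real (r2 y) * v$2),
    of_real (r2 y) * v$2, of_real (r3 y) * v$3]"

lemma H_L: "H y (L y v) w = of_real (E y * r1 y) * \<eta> y v * cnj (\<eta> y w)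
  + of_real (P y * r2 y) * v$2 * cnj (w$2) + of_real (M y * r3 y) * v$3 * cnj (w$3)"
proof -
  have "\<eta> y (L y v) = of_real (r1 y) * \<eta> y v"
    unfolding \<eta>_def[of y "L y v"] \<beta>_def[of y "L y v"] by (simp add: L_def algebra_simps)
  then show ?thesis by (simp add: H_def L_def)
qed

lemma ricci_H: "ricci g y v w = Re (H y (L y v) w)"
proof -
  have "ricci g y v w = - 2 * Re (lam'' y w v)"
  proof (rule ricci_g[where P="lam' y w"])
    show "((\<lambda>y. \<Sum>i\<in>UNIV. \<Gamma> y (axis i 1) w $ i) has_derivative (\<lambda>c. lam' y w c + lam'' y w c)) (at y)"
      unfolding trace_\<Gamma> by (rule lam_deriv)
    show "lam' y w (\<i> *s v) = \<i> * lam' y w v"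
      by (simp add: lam'_def \<eta>_smult \<beta>_smult \<beta>'_def algebra_simps)
    show "lam'' y w (\<i> *s v) = - \<i> * lam'' y w v"
      by (simp add: lam''_def \<eta>_smult algebra_simps)
  qed
  moreover have "- 2 * cnj (lam'' y w v) = H y (L y v) w"
  proof -
    have 1: "E y * r1 y = - 2 * (N y * (\<kappa> (x y) + t y * \<kappa>' (x y) * D (x y) / 2))"
      using D_pos[OF t_nonneg[of y]] unfolding E_def r1_def x_def[symmetric] by (simp add: field_simps)
    have 2: "P y * r2 y = 2 * ((e * t y * \<kappa> (x y) + e + 2) * qf (y$2))"
      using A_pos'[of y] unfolding P_def r2_def by (simp add: field_simps)
    have 3: "M y * r3 y = - 2 * ((e * t y * \<kappa> (x y) + e - 2) * qf (y$3))"
      using B_pos'[of y] unfolding M_def r3_def by (simp add: field_simps)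
    show ?thesis
      unfolding H_L 1 2 3 lam''_def by (simp add: algebra_simps)
  qed
  then have "Re (H y (L y v) w) = Re (- 2 * cnj (lam'' y w v))" by simp
  ultimately show ?thesis by simp
qed

lemma scalar_curvature_H: "scalar_curvature g y = s1 * x y + s0"
proof -
  have "scalar_curvature g y = 2 * Re (\<Sum>i\<in>UNIV. L y (axis i 1) $ i)"
    by (rule scalar_curvature_g[OF ricci_H]) (simp add: L_def vec_eq_iff forall_3 \<eta>_smult algebra_simps)
  also have "(\<Sum>i\<in>UNIV. L y (axis i 1) $ i) = of_real (r1 y + r2 y + r3 y)"
    by (simp add: sum_3 L_def \<eta>_def \<beta>_def axis_def)
  finally show ?thesis
    using scal[OF t_nonneg[of y]] by (simp add: x_def[symmetric] r1_def r2_def r3_def)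
qed

lemma x_deriv_H: "(x has_derivative (\<lambda>c. Re (H y (y$1 *s axis 1 1) c))) (at y)"
proof -
  have "\<eta> y (y$1 *s axis 1 1) = y$1"
    by (simp add: \<eta>_def \<beta>_def axis_def)
  then have "H y (y$1 *s axis 1 1) c = of_real (E y) * cnj (cnj (y$1) * \<eta> y c)" for c
    unfolding H_def by (simp add: axis_def)
  then have "Re (H y (y$1 *s axis 1 1) c) = E y * Re (cnj (y$1) * \<eta> y c)" for c
    by (simp del: complex_cnj_mult)
  then show ?thesis using x_deriv by simp
qed

lemma gradient_scalar_curvature: "gradient g (scalar_curvature g) y = of_real s1 *s (y$1 *s axis 1 1)"
proof (rule gradient_g)
  show "(scalar_curvature g has_derivative (\<lambda>w. Re (H y (of_real s1 *s (y$1 *s axis 1 1)) w))) (at y)"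
    unfolding scalar_curvature_H[abs_def] H_smult[of _ "of_real s1"]
    by (rule derivative_eq_intros x_deriv_H refl)+ simp
qed

lemma holomorphic_gradient: "holomorphic_field (gradient g (scalar_curvature g))"
  unfolding holomorphic_field_def
proof (intro allI exI conjI)
  fix y v :: "complex^3"
  have "bounded_linear (\<lambda>y::complex^3. of_real s1 *s (y$1 *s axis 1 1) :: complex^3)"
    unfolding linear_conv_bounded_linear[symmetric]
    by (rule linearI; (unfold scaleR_eq_smult)?; simp add: vec_eq_iff algebra_simps)
  then show "(gradient g (scalar_curvature g) has_derivative (\<lambda>y. of_real s1 *s (y$1 *s axis 1 1))) (at y)"
    unfolding gradient_scalar_curvature[abs_def] by (rule bounded_linear_imp_has_derivative)
  show "of_real s1 *s (J v $ 1 *s axis 1 1) = J (of_real s1 *s (v$1 *s axis 1 1) :: complex^3)"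
    by (simp add: vec_eq_iff)
qed

end

section \<open>Extremal momentum profiles\<close>

lemma antiderivative_exists:
  fixes f :: "real \<Rightarrow> real"
  assumes "continuous_on {a..b} f"
  obtains F where "\<And>x. a < x \<Longrightarrow> x < b \<Longrightarrow> (F has_real_derivative f x) (at x)"
proof -
  obtain F where F: "\<And>x. x \<in> {a..b} \<Longrightarrow> (F has_vector_derivative f x) (at x within {a..b})"
    using antiderivative_continuous[OF assms] by blast
  have "(F has_real_derivative f x) (at x)" if "a < x" "x < b" for x
    using F[of x] that at_within_Icc_at[OF that]
    by (simp add: has_real_derivative_iff_has_vector_derivative)
  then show thesis using that by blast
qed

text \<open>With \<open>F = (1 - x\<^sup>2) Q\<close>, the metric has scalar curvature \<open>(4 (A + B) - F'') / vol\<close>; the two equations for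
  \<open>l0\<close>, \<open>l1\<close> say that \<open>4 (A + B) - F''\<close> vanishes at the zeros \<open>A\<close>, \<open>- B\<close> of \<open>vol\<close>.
  \<open>nsq\<close> is the squared fibre norm as a function of the momentum, and \<open>X\<close> is its inverse.\<close>

locale extremal_profile =
  fixes A B l0 l1 r :: real and \<rho> :: "real \<Rightarrow> real" and vol Q :: "real \<Rightarrow> real"
  defines "vol \<equiv> \<lambda>x. (A - x) * (B + x)" and "Q \<equiv> \<lambda>x. (A - x) * (B + x) + (1 - x\<^sup>2) * (l0 + l1 * x)"
  assumes r: "1 < r" "r < A" "r < B"
    and Q_pos: "\<bar>x\<bar> < r \<Longrightarrow> 0 < Q x"
    and \<rho>_deriv: "\<bar>x\<bar> < r \<Longrightarrow> (\<rho> has_real_derivative - 2 * (l0 + l1 * x) / Q x) (at x)"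
    and l_A: "(6 * A\<^sup>2 - 2) * l0 + (10 * A^3 - 6 * A) * l1 = 2 * (A + B) - 3 * A\<^sup>2 - 2 * A * B + 1"
    and l_B: "(6 * B\<^sup>2 - 2) * l0 - (10 * B^3 - 6 * B) * l1 = 2 * (A + B) - 3 * B\<^sup>2 - 2 * A * B + 1"
begin

text \<open>The interval passes beyond the zero section x = -1, where \<open>nsq\<close> vanishes,
  so that t = 0 is interior to \<open>T\<close>. It stops at 1, the section at infinity, which the
  flipped profile covers.\<close>

definition S where "S = {- r<..<1}"
text \<open>The exponential of the antiderivative of
  \<open>2 / \<Theta> = 2 / (1 - x^2) - 2 (l0 + l1 x) / Q\<close>.\<close>

definition nsq where "nsq x = (1 + x) / (1 - x) * exp (\<rho> x)"
definition T where "T = nsq ` S"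
definition X where "X = the_inv_into S nsq"
text \<open>This is \<open>\<Theta> / nsq\<close> with the common factor 1 + x cancelled, hence
  positive also at x = -1.\<close>

definition D where "D x = (1 - x)\<^sup>2 * Q x * exp (- \<rho> x) / vol x"
definition Q' where "Q' x = A - B - 2 * x - 2 * x * (l0 + l1 * x) + (1 - x\<^sup>2) * l1"
definition D' where
  "D' x = D x * (- 2 / (1 - x) + (Q' x + 2 * (l0 + l1 * x)) / Q x + 1 / (A - x) - 1 / (B + x))"

lemma SD: "x \<in> S \<Longrightarrow> \<bar>x\<bar> < r \<and> x < 1 \<and> A - x > 0 \<and> B + x > 0 \<and> vol x > 0 \<and> Q x > 0"
  using r Q_pos[of x] by (auto simp: S_def vol_def)

lemma open_S: "open S"
  by (simp add: S_def)

lemma Q_eq: "Q x = vol x + (1 - x\<^sup>2) * (l0 + l1 * x)"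
  by (simp add: Q_def vol_def)

lemma Q_deriv: "(Q has_real_derivative Q' x) (at x)"
  unfolding Q_def Q'_def by (auto intro!: derivative_eq_intros simp: power2_eq_square algebra_simps)

lemma vol_deriv: "(vol has_real_derivative A - B - 2 * x) (at x)"
  unfolding vol_def by (auto intro!: derivative_eq_intros simp: power2_eq_square algebra_simps)

lemma D_pos: "x \<in> S \<Longrightarrow> D x > 0"
  using SD[of x] by (simp add: D_def)

lemma nsq_deriv:
  assumes "x \<in> S"
  shows "(nsq has_real_derivative 2 / D x) (at x)"
proof -
  note S = SD[OF assms]
  have "(nsq has_real_derivative (2 / (1 - x)\<^sup>2 * exp (\<rho> x)
      + (1 + x) / (1 - x) * (exp (\<rho> x) * (- 2 * (l0 + l1 * x) / Q x)))) (at x)"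
  proof -
    have a: "((\<lambda>x. (1 + x) / (1 - x)) has_real_derivative 2 / (1 - x)\<^sup>2) (at x)"
      using S by (auto intro!: derivative_eq_intros simp: power2_eq_square)
    have b: "((\<lambda>x. exp (\<rho> x)) has_real_derivative exp (\<rho> x) * (- 2 * (l0 + l1 * x) / Q x)) (at x)"
      using S by (intro DERIV_fun_exp \<rho>_deriv) auto
    show ?thesis
      unfolding nsq_def[abs_def] by (rule DERIV_cong[OF DERIV_mult[OF a b]]) (simp only: mult_ac)
  qed
  also have "2 / (1 - x)\<^sup>2 * exp (\<rho> x) + (1 + x) / (1 - x) * (exp (\<rho> x) * (- 2 * (l0 + l1 * x) / Q x))
      = 2 / (1 - x)\<^sup>2 * exp (\<rho> x) * ((Q x - (1 - x\<^sup>2) * (l0 + l1 * x)) / Q x)"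
  proof -
    define k w where "k = 1 / (1 - x)\<^sup>2" and "w = (l0 + l1 * x) / Q x"
    have k: "(1 + x) / (1 - x) = k * (1 - x\<^sup>2)" "2 / (1 - x)\<^sup>2 = 2 * k"
      using S unfolding k_def by (simp_all add: divide_simps) (simp add: algebra_simps power2_eq_square)
    have w: "(Q x - (1 - x\<^sup>2) * (l0 + l1 * x)) / Q x = 1 - (1 - x\<^sup>2) * w" "- 2 * (l0 + l1 * x) / Q x = - 2 * w"
      using S unfolding w_def by (simp_all add: diff_divide_distrib)
    show ?thesis unfolding k w by (simp add: algebra_simps)
  qed
  also have "\<dots> = 2 / D x"
    using S unfolding Q_eq by (simp add: D_def Q_eq exp_minus field_simps)
  finally show ?thesis .
qed

lemma nsq_strict_mono: "strict_mono_on S nsq"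
proof (rule strict_mono_onI)
  fix x y assume "x \<in> S" "y \<in> S" "x < y"
  then show "nsq x < nsq y"
    by (intro DERIV_pos_imp_increasing[where f=nsq])
      (auto simp: S_def intro!: exI[of _ "2 / D _"] nsq_deriv[unfolded S_def] D_pos[unfolded S_def])
qed

lemma inj_nsq: "inj_on nsq S"
  by (rule strict_mono_on_imp_inj_on[OF nsq_strict_mono])

lemma X_nsq: "x \<in> S \<Longrightarrow> X (nsq x) = x"
  unfolding X_def by (rule the_inv_into_f_f[OF inj_nsq])

lemma nsq_X: "t \<in> T \<Longrightarrow> nsq (X t) = t" and X_in_S: "t \<in> T \<Longrightarrow> X t \<in> S"
  by (auto simp: T_def X_nsq)

lemma continuous_nsq: "continuous_on S nsq"
  by (intro continuous_at_imp_continuous_on ballI DERIV_isCont[OF nsq_deriv])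

lemma open_T: "open T"
  unfolding T_def by (rule invariance_of_domain[OF continuous_nsq open_S inj_nsq])

lemma nonneg_in_T: "{0..} \<subseteq> T"
proof
  fix t :: real assume "t \<in> {0..}"
  then have t: "t \<ge> 0" by simp
  have "continuous_on {-1..1} \<rho>"
    using r by (intro continuous_at_imp_continuous_on ballI DERIV_isCont[OF \<rho>_deriv]) auto
  then have "\<exists>x0\<in>{-1..1}. \<forall>x\<in>{-1..1}. \<rho> x0 \<le> \<rho> x"
    by (intro continuous_attains_inf) auto
  then obtain x0 where x0: "\<And>x. x \<in> {-1..1} \<Longrightarrow> \<rho> x0 \<le> \<rho> x" by blast
  define m where "m = exp (\<rho> x0)"
  have m: "m > 0" by (simp add: m_def)
  \<comment> \<open>Solves y / (1 - y) * m = t; as \<open>m\<close> bounds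
    \<open>exp (\<rho> y)\<close> from below, \<open>nsq y\<close> is at least t and the
    intermediate value theorem applies on [-1, y].\<close>
  define y where "y = t / (t + m)"
  have y: "0 \<le> y" "y < 1" using t m by (auto simp: y_def)
  have "1 - y = m / (t + m)" using t m by (simp add: y_def field_simps)
  then have "t = y / (1 - y) * m" using t m by (simp add: y_def)
  also have "\<dots> \<le> (1 + y) / (1 - y) * exp (\<rho> y)"
    using y x0[of y] by (intro mult_mono divide_right_mono) (auto simp: m_def)
  finally have "t \<le> nsq y" by (simp add: nsq_def)
  moreover have "nsq (-1) = 0" by (simp add: nsq_def)
  moreover have "continuous_on {-1..y} nsq"
    by (rule continuous_on_subset[OF continuous_nsq]) (use y r in \<open>auto simp: S_def\<close>)
  ultimately obtain x where "-1 \<le> x" "x \<le> y" "nsq x = t"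
    using IVT'[of nsq "-1" t y] t y by auto
  then show "t \<in> T" using y r by (auto simp: T_def S_def)
qed

lemma X_deriv:
  assumes "t \<in> T"
  shows "(X has_real_derivative D (X t) / 2) (at t)"
proof -
  have x: "X t \<in> S" by (rule X_in_S[OF assms])
  have "(nsq has_derivative (*) (2 / D (X t))) (at (X t))"
    by (rule has_field_derivative_imp_has_derivative[OF nsq_deriv[OF x]])
  moreover have "(*) (2 / D (X t)) \<circ> (*) (D (X t) / 2) = id"
    using D_pos[OF x] by (auto simp: fun_eq_iff)
  ultimately have "(X has_derivative (*) (D (X t) / 2)) (at (nsq (X t)))"
    using has_derivative_inverse_strong[OF open_S x continuous_nsq X_nsq] by blast
  then show ?thesis by (simp add: nsq_X[OF assms] has_field_derivative_def)
qed

lemma smooth_vol: "smooth_on U vol" and smooth_Q: "smooth_on U Q" if "open U"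
  unfolding vol_def Q_def using that
  by (intro smooth_on_add smooth_on_mult smooth_on_diff smooth_on_const smooth_on_ident smooth_on_power; simp)+

lemma smooth_\<rho>: "smooth_on {-r<..<r} \<rho>"
proof (rule smooth_on_antiderivative)
  show "smooth_on {-r<..<r} (\<lambda>x. - 2 * (l0 + l1 * x) / Q x)"
    by (intro smooth_on_divide smooth_on_add smooth_on_mult smooth_on_const smooth_on_ident smooth_Q)
      (auto intro!: Q_pos)
  show "(\<rho> has_real_derivative - 2 * (l0 + l1 * x) / Q x) (at x)" if "x \<in> {-r<..<r}" for x
    by (rule \<rho>_deriv) (use that in auto)
qed auto

lemma smooth_D: "smooth_on S D"
proof -
  have \<rho>: "smooth_on S \<rho>"
    by (rule smooth_on_subset[OF smooth_\<rho>]) (use r in \<open>auto simp: S_def\<close>)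
  have "smooth_on S (\<lambda>x. exp (- \<rho> x))"
    by (rule smooth_on_compose[OF open_S _ smooth_on_exp smooth_on_minus[OF open_S \<rho>]]) simp
  then show ?thesis
    unfolding D_def[abs_def] using SD
    by (intro smooth_on_divide smooth_on_mult smooth_on_power smooth_on_diff smooth_on_const
        smooth_on_ident smooth_vol smooth_Q open_S) auto
qed

text \<open>\<open>X\<close> solves the autonomous equation X' = D(X) / 2 with smooth right-hand
  side, so it bootstraps itself.\<close>

lemma smooth_X: "smooth_on T X"
proof (rule smooth_on_autonomous_ode[OF open_T X_deriv X_in_S])
  show "smooth_on S (\<lambda>x. D x / 2)"
    using smooth_on_mult[OF open_S smooth_D smooth_on_const[of S "1/2"]] by simp
qed

lemma D_deriv:
  assumes "x \<in> S"
  shows "(D has_real_derivative D' x) (at x)"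
proof -
  note S = SD[OF assms]
  have "(D has_real_derivative
     (((- 2 * (1 - x) * Q x + (1 - x)\<^sup>2 * Q' x) * exp (- \<rho> x)
       + (1 - x)\<^sup>2 * Q x * (exp (- \<rho> x) * (2 * (l0 + l1 * x) / Q x))) * vol x
      - (1 - x)\<^sup>2 * Q x * exp (- \<rho> x) * (A - B - 2 * x)) / (vol x * vol x)) (at x)"
  proof -
    have a: "((\<lambda>x. (1 - x)\<^sup>2 * Q x) has_real_derivative - 2 * (1 - x) * Q x + (1 - x)\<^sup>2 * Q' x) (at x)"
      by (auto intro!: derivative_eq_intros Q_deriv simp: algebra_simps)
    have "- (- 2 * (l0 + l1 * x) / Q x) = 2 * (l0 + l1 * x) / Q x"
      by (simp only: minus_divide_left mult_minus_left minus_minus)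
    then have "((\<lambda>x. - \<rho> x) has_real_derivative 2 * (l0 + l1 * x) / Q x) (at x)"
      using DERIV_minus[OF \<rho>_deriv] S by metis
    then have b: "((\<lambda>x. exp (- \<rho> x)) has_real_derivative exp (- \<rho> x) * (2 * (l0 + l1 * x) / Q x)) (at x)"
      by (rule DERIV_fun_exp)
    show ?thesis
      unfolding D_def[abs_def] using S
      by (intro DERIV_cong[OF DERIV_divide[OF DERIV_mult[OF a b] vol_deriv]]) (auto simp: mult_ac)
  qed
  also have "(((- 2 * (1 - x) * Q x + (1 - x)\<^sup>2 * Q' x) * exp (- \<rho> x)
       + (1 - x)\<^sup>2 * Q x * (exp (- \<rho> x) * (2 * (l0 + l1 * x) / Q x))) * vol x
      - (1 - x)\<^sup>2 * Q x * exp (- \<rho> x) * (A - B - 2 * x)) / (vol x * vol x)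
     = D x * (- 2 / (1 - x) + (Q' x + 2 * (l0 + l1 * x)) / Q x - (A - B - 2 * x) / vol x)"
  proof -
    define L where "L = l0 + l1 * x"
    show ?thesis
      using S unfolding L_def[symmetric] D_def by (simp add: divide_simps) (simp add: algebra_simps power2_eq_square)
  qed
  also have "(A - B - 2 * x) / vol x = - 1 / (A - x) + 1 / (B + x)"
    using S by (simp add: vol_def field_simps)
  also have "D x * (- 2 / (1 - x) + (Q' x + 2 * (l0 + l1 * x)) / Q x - (- 1 / (A - x) + 1 / (B + x))) = D' x"
    unfolding D'_def by (rule arg_cong[where f="(*) (D x)"]) simp
  finally show ?thesis .
qed

definition \<kappa> where
  "\<kappa> x = (1 - x) * exp (- \<rho> x) / (2 * vol x) * (- 2 * Q x + (1 - x) * (Q' x + 2 * (l0 + l1 * x)))"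

text \<open>The summands with \<open>A - x\<close> and \<open>B + x\<close> cancel those that the
  factor 1 / \<open>vol\<close> of \<open>D\<close> puts into \<open>D'\<close>.\<close>

lemma \<kappa>_eq:
  assumes "x \<in> S"
  shows "D' x / 2 - D x / (2 * (A - x)) + D x / (2 * (B + x)) = \<kappa> x"
proof -
  note S = SD[OF assms]
  have "D' x / 2 - D x / (2 * (A - x)) + D x / (2 * (B + x))
      = D x / 2 * (- 2 / (1 - x) + (Q' x + 2 * (l0 + l1 * x)) / Q x)"
    unfolding D'_def by (simp add: algebra_simps add_divide_distrib diff_divide_distrib)
  also have "\<dots> = \<kappa> x"
    using S by (simp add: D_def \<kappa>_def field_simps power2_eq_square)
  finally show ?thesis .
qed

text \<open>\<open>F1\<close> and \<open>F2\<close> are the first two derivatives of F = (1 - x^2)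
  Q.\<close>

definition F1 where "F1 x = - 2 * x * Q x + (1 - x\<^sup>2) * Q' x"
definition F2 where "F2 x = - 2 * Q x - 4 * x * Q' x
  + (1 - x\<^sup>2) * (- 2 - 2 * (l0 + l1 * x) - 4 * x * l1)"

lemma Q'_deriv: "(Q' has_real_derivative - 2 - 2 * (l0 + l1 * x) - 4 * x * l1) (at x)"
  unfolding Q'_def[abs_def] by (auto intro!: derivative_eq_intros simp: algebra_simps)

lemma F1_deriv: "(F1 has_real_derivative F2 x) (at x)"
  unfolding F1_def[abs_def] F2_def
  by (auto intro!: derivative_eq_intros Q_deriv Q'_deriv simp: algebra_simps)

text \<open>The coefficients of the affine factor match the x^3 and x^2 terms. What remains has
  degree at most one and vanishes at \<open>A\<close> and \<open>- B\<close> by \<open>l_A\<close>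
  and \<open>l_B\<close>.\<close>

lemma F2_eq: "4 * (A + B) - F2 x = vol x * (20 * l1 * x + (12 * (l0 + 1) + 20 * (A - B) * l1))"
proof -
  define R0 where "R0 = 4 * (A + B) - (- 2 * A * B + 2 * 0 + (- 2 - 4 * l0)) - A * B * (12 * (l0 + 1) + 20 * (A - B) * l1)"
  define R1 where "R1 = - (- 6 * (A - B) - 12 * l1) - (A * B * 20 * l1 + (A - B) * (12 * (l0 + 1) + 20 * (A - B) * l1))"
  have R: "4 * (A + B) - F2 x - vol x * (20 * l1 * x + (12 * (l0 + 1) + 20 * (A - B) * l1)) = R0 + R1 * x" for x
    unfolding R0_def R1_def F2_def Q_def Q'_def vol_def by algebra
  have "R0 + R1 * A = 0" "R0 + R1 * (- B) = 0"
    unfolding R0_def R1_def using l_A l_B by algebra+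
  then have "R1 * (A + B) = 0" by (simp add: algebra_simps)
  then have "R1 = 0" using r by simp
  then have "R0 + R1 * x = 0" using \<open>R0 + R1 * A = 0\<close> by simp
  then show ?thesis using R[of x] by simp
qed

text \<open>Since \<open>D * vol = F / t\<close> and t d/dt acts as \<open>\<Theta> / 2\<close>
  times d/dx, the logarithmic derivative t \<open>\<kappa>\<close> equals F' / (2 vol) - 1, free of
  exponentials.\<close>

definition \<mu> where "\<mu> x = F1 x / (2 * vol x) - 1"

lemma nsq_\<kappa>:
  assumes "x \<in> S"
  shows "nsq x * \<kappa> x = \<mu> x"
proof -
  note S = SD[OF assms]
  have "nsq x * \<kappa> x = (1 + x) / (2 * vol x) * (- 2 * Q x + (1 - x) * (Q' x + 2 * (l0 + l1 * x)))"
    using S unfolding nsq_def \<kappa>_def by (simp add: exp_minus field_simps)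
  also have "\<dots> = ((1 + x) * (- 2 * Q x + (1 - x) * (Q' x + 2 * (l0 + l1 * x)))) / (2 * vol x)"
    by simp
  also have "(1 + x) * (- 2 * Q x + (1 - x) * (Q' x + 2 * (l0 + l1 * x)))
      = - 2 * x * Q x + (1 - x\<^sup>2) * Q' x - 2 * (Q x - (1 - x\<^sup>2) * (l0 + l1 * x))"
    by (simp add: power2_eq_square algebra_simps)
  also have "Q x - (1 - x\<^sup>2) * (l0 + l1 * x) = vol x" by (simp add: Q_eq)
  also have "(- 2 * x * Q x + (1 - x\<^sup>2) * Q' x - 2 * vol x) / (2 * vol x) = \<mu> x"
    using S by (simp add: \<mu>_def F1_def diff_divide_distrib)
  finally show ?thesis .
qed

lemma \<mu>_deriv:
  assumes "x \<in> S"
  shows "(\<mu> has_real_derivative (F2 x * vol x - F1 x * (A - B - 2 * x)) / (2 * (vol x)\<^sup>2)) (at x)"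
  unfolding \<mu>_def[abs_def] using SD[OF assms]
  by (auto intro!: derivative_eq_intros F1_deriv vol_deriv simp: field_simps power2_eq_square)

lemma \<kappa>_deriv:
  assumes "x \<in> S"
  shows "(\<kappa> has_real_derivative deriv \<kappa> x) (at x)"
proof -
  note S = SD[OF assms]
  have d: "\<rho> differentiable (at x)" "vol differentiable (at x)" "Q differentiable (at x)" "Q' differentiable (at x)"
    unfolding real_differentiable_def using \<rho>_deriv S vol_deriv Q_deriv Q'_deriv by blast+
  then have "(exp \<circ> (\<lambda>x. - \<rho> x)) differentiable (at x)"
    by (intro differentiable_chain_at) (auto intro!: derivative_intros simp: real_differentiable_def intro: DERIV_exp)
  then have "(\<lambda>x. exp (- \<rho> x)) differentiable (at x)" by (simp add: o_def)
  then have "\<kappa> differentiable (at x)"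
    unfolding \<kappa>_def[abs_def] using S d by (intro derivative_intros) auto
  then show ?thesis
    by (simp add: DERIV_deriv_iff_real_differentiable)
qed

lemma scalar_curvature_equation:
  assumes "t \<in> T"
  shows "2 * (- 2 * (\<kappa> (X t) + t * deriv \<kappa> (X t) * D (X t) / 2) / D (X t)
      + (t * \<kappa> (X t) + 3) / (A - X t) - (t * \<kappa> (X t) - 1) / (B + X t))
    = 20 * l1 * X t + (12 * (l0 + 1) + 20 * (A - B) * l1)"
proof -
  define x where "x = X t"
  have x: "x \<in> S" and t: "t = nsq x"
    using X_in_S[OF assms] nsq_X[OF assms] by (simp_all add: x_def)
  note S = SD[OF x]
  have D: "D x > 0" by (rule D_pos[OF x])
  \<comment> \<open>No formula for \<open>deriv \<kappa>\<close> is needed: the combination in the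
    goal is \<open>D / 2\<close> times the derivative of t \<open>\<kappa>\<close> =
    \<open>\<mu>\<close>.\<close>
  have "((\<lambda>x. nsq x * \<kappa> x) has_real_derivative 2 / D x * \<kappa> x + deriv \<kappa> x * nsq x) (at x)"
    by (rule DERIV_mult[OF nsq_deriv[OF x] \<kappa>_deriv[OF x]])
  moreover have "((\<lambda>x. nsq x * \<kappa> x) has_real_derivative (F2 x * vol x - F1 x * (A - B - 2 * x)) / (2 * (vol x)\<^sup>2)) (at x)"
    by (rule has_field_derivative_transform_within_open[OF \<mu>_deriv[OF x] open_S x]) (simp add: nsq_\<kappa>)
  ultimately have eq: "2 / D x * \<kappa> x + deriv \<kappa> x * nsq x = (F2 x * vol x - F1 x * (A - B - 2 * x)) / (2 * (vol x)\<^sup>2)"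
    by (rule DERIV_unique)
  have "2 * (- 2 * (\<kappa> x + t * deriv \<kappa> x * D x / 2) / D x + (t * \<kappa> x + 3) / (A - x) - (t * \<kappa> x - 1) / (B + x))
      = - 2 * (2 / D x * \<kappa> x + deriv \<kappa> x * nsq x) + 2 * ((\<mu> x + 3) / (A - x) - (\<mu> x - 1) / (B + x))"
  proof -
    have "- 2 * (\<kappa> x + nsq x * deriv \<kappa> x * D x / 2) / D x = - (2 / D x * \<kappa> x + deriv \<kappa> x * nsq x)"
      using D by (simp add: field_simps)
    moreover have "2 * (u + v - w) = - 2 * z + 2 * (v - w)" if "u = - z" for u v w z :: real
      using that by simp
    ultimately show ?thesis unfolding t nsq_\<kappa>[OF x] by blast
  qed
  \<comment> \<open>The terms with \<open>F1\<close> cancel, because 1 / (A - x) - 1 / (B + x) is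
    minus the logarithmic derivative of \<open>vol\<close>.\<close>
  also have "\<dots> = (4 * (A + B) - F2 x) / vol x"
    unfolding eq \<mu>_def using S unfolding vol_def
    by (simp add: divide_simps) (simp add: algebra_simps power2_eq_square)
  also have "\<dots> = 20 * l1 * x + (12 * (l0 + 1) + 20 * (A - B) * l1)"
    unfolding F2_eq using S by simp
  finally show ?thesis by (simp add: x_def)
qed

definition \<Theta> where "\<Theta> x = (1 - x\<^sup>2) * Q x / vol x"

lemma nsq_D: "x \<in> S \<Longrightarrow> nsq x * D x = \<Theta> x"
  using SD[of x] by (simp add: nsq_def D_def \<Theta>_def exp_minus field_simps power2_eq_square)

lemma X_bounds:
  assumes "t \<ge> 0"
  shows "X t < 1" "- 1 \<le> X t" "t > 0 \<Longrightarrow> - 1 < X t" "t \<in> T"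
proof -
  show t: "t \<in> T" using assms nonneg_in_T by auto
  note x = SD[OF X_in_S[OF t]]
  show "X t < 1" using x by simp
  have "(1 + X t) / (1 - X t) * exp (\<rho> (X t)) = t"
    using nsq_X[OF t] by (simp add: nsq_def)
  then have "(1 + X t) / (1 - X t) = t / exp (\<rho> (X t))" by (simp add: field_simps)
  then have eq: "1 + X t = t / exp (\<rho> (X t)) * (1 - X t)"
    using x by (simp add: divide_simps)
  show "- 1 \<le> X t" using eq x assms by (smt (verit) divide_nonneg_pos exp_gt_zero mult_nonneg_nonneg)
  show "- 1 < X t" if "t > 0" using eq x that by (smt (verit) divide_pos_pos exp_gt_zero mult_pos_pos)
qed

lemma nsq_nonneg: "- 1 \<le> x \<Longrightarrow> x < 1 \<Longrightarrow> nsq x \<ge> 0" and in_S: "- 1 \<le> x \<Longrightarrow> x < 1 \<Longrightarrow> x \<in> S"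
  using r by (auto simp: nsq_def S_def)

lemma t_D: "t \<in> T \<Longrightarrow> t * D (X t) = \<Theta> (X t)"
  using nsq_D[OF X_in_S] nsq_X by metis

text \<open>By the form of \<open>Q\<close>, the difference
  \<open>1 / \<Theta> - 1 / (1 - x^2)\<close> is \<open>- (l0 + l1 x) / Q\<close>, half the
  derivative of \<open>\<rho>\<close>. So \<open>f1\<close> is explicit and only \<open>f\<close>
  needs an abstract antiderivative.\<close>

lemma potential_exists:
  obtains r' f f1 f2
  where "1 < r'" "smooth_on {-r'<..<r'} f"
    "\<And>x. \<bar>x\<bar> < r' \<Longrightarrow> (f has_real_derivative f1 x) (at x)"
    "\<And>x. \<bar>x\<bar> < r' \<Longrightarrow> (f1 has_real_derivative f2 x) (at x)"
    "\<And>x. \<bar>x\<bar> < 1 \<Longrightarrow> 1 / (1 - x\<^sup>2) + 1 / (2 * (A - x)) + 1 / (2 * (B + x)) + f2 x = 1 / \<Theta> x"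
proof -
  define f2 where "f2 x = - ((l0 + l1 * x) / Q x) - 1 / (2 * (A - x)) - 1 / (2 * (B + x))" for x
  define f1 where "f1 x = \<rho> x / 2 + ln (A - x) / 2 - ln (B + x) / 2" for x
  have pos: "A - x > 0" "B + x > 0" "vol x > 0" "Q x > 0" if "\<bar>x\<bar> < r" for x
    using that r Q_pos[OF that] by (auto simp: vol_def intro!: mult_pos_pos)
  have f1: "(f1 has_real_derivative f2 x) (at x)" if "\<bar>x\<bar> < r" for x
  proof -
    have "(f1 has_real_derivative (- 2 * (l0 + l1 * x) / Q x) / 2 + ((0 - 1) / (A - x)) / 2 - ((0 + 1) / (B + x)) / 2) (at x)"
      unfolding f1_def[abs_def] using pos[OF that]
      by (intro DERIV_diff DERIV_add DERIV_cdivide \<rho>_deriv[OF that] DERIV_ln_divide[THEN DERIV_chain2[where f=ln], THEN DERIV_cong])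
        (auto intro!: derivative_eq_intros)
    also have "(- 2 * (l0 + l1 * x) / Q x) / 2 + ((0 - 1) / (A - x)) / 2 - ((0 + 1) / (B + x)) / 2 = f2 x"
    proof -
      have "(- 2 * u / q) / 2 + ((0 - 1) / y) / 2 - ((0 + 1) / z) / 2 = - (u / q) - 1 / (2 * y) - 1 / (2 * z)" for u q y z :: real
        by simp
      then show ?thesis unfolding f2_def .
    qed
    finally show ?thesis .
  qed
  \<comment> \<open>Antiderivatives are taken on closed intervals, so the radius shrinks a little
    while staying above 1.\<close>
  define r' where "r' = (1 + r) / 2"
  have r': "1 < r'" "r' < r" using r by (auto simp: r'_def)
  have "continuous_on {-r'..r'} f1"
    using r' by (intro continuous_at_imp_continuous_on ballI DERIV_isCont[OF f1]) auto
  then obtain F where F: "\<And>x. - r' < x \<Longrightarrow> x < r' \<Longrightarrow> (F has_real_derivative f1 x) (at x)"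
    using antiderivative_exists by blast
  have "smooth_on {-r'<..<r'} f2"
  proof -
    have pos: "Q x > 0" "2 * (A - x) > 0" "2 * (B + x) > 0" if "x \<in> {-r'<..<r'}" for x
    proof -
      have "\<bar>x\<bar> < r" using that r' by auto
      from pos[OF this] show "Q x > 0" "2 * (A - x) > 0" "2 * (B + x) > 0" by auto
    qed
    show ?thesis
      unfolding f2_def
      by (intro smooth_on_diff smooth_on_minus smooth_on_divide smooth_on_add smooth_on_mult smooth_on_const
          smooth_on_ident smooth_Q open_greaterThanLessThan pos)
  qed
  then have "smooth_on {-r'<..<r'} f1"
    by (rule smooth_on_antiderivative[OF open_greaterThanLessThan f1, rotated]) (use r' in auto)
  then have "smooth_on {-r'<..<r'} F"
    by (rule smooth_on_antiderivative[OF open_greaterThanLessThan, where f'=f1, rotated]) (use F in auto)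
  moreover have "1 / (1 - x\<^sup>2) + 1 / (2 * (A - x)) + 1 / (2 * (B + x)) + f2 x = 1 / \<Theta> x" if "\<bar>x\<bar> < 1" for x
  proof -
    have "x\<^sup>2 < 1" using that by (simp add: abs_square_less_1)
    then have "1 / (1 - x\<^sup>2) - (l0 + l1 * x) / Q x = (Q x - (1 - x\<^sup>2) * (l0 + l1 * x)) / ((1 - x\<^sup>2) * Q x)"
      using pos[of x] that r by (simp add: divide_simps)
    also have "\<dots> = 1 / \<Theta> x" by (simp add: Q_eq \<Theta>_def)
    finally show ?thesis by (simp add: f2_def)
  qed
  ultimately show thesis using that[of r' F f1 f2] F f1 r' by auto
qed

text \<open>Under x to -x the equations \<open>l_A\<close> and \<open>l_B\<close> are exchanged; the
  sign of \<open>\<rho>\<close> turns the squared norm into its reciprocal.\<close>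

lemma flip: "extremal_profile B A l0 (- l1) r (\<lambda>x. - \<rho> (- x))"
proof
  show "0 < (B - x) * (A + x) + (1 - x\<^sup>2) * (l0 + - l1 * x)" if "\<bar>x\<bar> < r" for x
    using Q_pos[of "- x"] that by (simp add: Q_def mult.commute)
  show "((\<lambda>x. - \<rho> (- x)) has_real_derivative
      - 2 * (l0 + - l1 * x) / ((B - x) * (A + x) + (1 - x\<^sup>2) * (l0 + - l1 * x))) (at x)" if "\<bar>x\<bar> < r" for x
  proof -
    have "((\<lambda>x. \<rho> (- x)) has_real_derivative - 2 * (l0 + l1 * - x) / Q (- x) * (- 1)) (at x)"
      by (rule DERIV_chain2[OF \<rho>_deriv]) (use that in \<open>auto intro!: derivative_eq_intros\<close>)
    moreover have "Q (- x) = (B - x) * (A + x) + (1 - x\<^sup>2) * (l0 + - l1 * x)"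
      by (simp add: Q_def mult.commute)
    moreover have "l0 + l1 * - x = l0 + - l1 * x" by simp
    ultimately show ?thesis
      using DERIV_minus by (fastforce simp only: mult_minus_right mult_1_right minus_minus)
  qed
qed (use r l_A l_B in \<open>auto simp: algebra_simps\<close>)

end

section \<open>Solving for the profile, and its positivity\<close>

lemma extremal_profile_exists:
  assumes "A > 1" "B > 1"
  obtains l0 l1 r \<rho> where "extremal_profile A B l0 l1 r \<rho>"
proof -
  define a c where "a = A - 1" and "c = B - 1"
  have ac: "a > 0" "c > 0" and A: "A = 1 + a" and B: "B = 1 + c"
    using assms by (auto simp: a_def c_def)
  define \<alpha>1 \<beta>1 \<gamma>1 where "\<alpha>1 = 6 * A\<^sup>2 - 2" and "\<beta>1 = 10 * A^3 - 6 * A" and "\<gamma>1 = 2 * (A + B) - 3 * A\<^sup>2 - 2 * A * B + 1"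
  define \<alpha>2 \<beta>2 \<gamma>2 where "\<alpha>2 = 6 * B\<^sup>2 - 2" and "\<beta>2 = 10 * B^3 - 6 * B" and "\<gamma>2 = 2 * (A + B) - 3 * B\<^sup>2 - 2 * A * B + 1"
  note defs = \<alpha>1_def \<beta>1_def \<gamma>1_def \<alpha>2_def \<beta>2_def \<gamma>2_def
  \<comment> \<open>Minus the determinant of the linear system for \<open>l0\<close>,
    \<open>l1\<close>, which is then solved by Cramer's rule. In terms of a = A - 1 and c = B - 1 it
    has positive coefficients only.\<close>
  define \<delta> where "\<delta> = \<alpha>1 * \<beta>2 + \<alpha>2 * \<beta>1"
  have "2 * \<delta> = 64 + 288 * c^1 + 288 * c^2 + 80 * c^3 + 288 * a^1 + 1152 * a^1 * c^1 + 1008 * a^1 * c^2 + 240 * a^1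
        * c^3 + 288 * a^2 + 1008 * a^2 * c^1 + 720 * a^2 * c^2 + 120 * a^2 * c^3 + 80 * a^3 + 240 * a^3 *
        c^1 + 120 * a^3 * c^2"
    unfolding \<delta>_def defs A B by (simp add: algebra_simps power_numeral_reduce)
  also have "\<dots> > 0" using ac by (intro add_pos_pos mult_pos_pos zero_less_power) auto
  finally have \<delta>: "\<delta> > 0" by simp
  define l0 l1 where "l0 = (\<gamma>1 * \<beta>2 + \<gamma>2 * \<beta>1) / \<delta>" and "l1 = (\<alpha>2 * \<gamma>1 - \<alpha>1 * \<gamma>2) / \<delta>"
  have \<delta>l: "\<delta> * l0 = \<gamma>1 * \<beta>2 + \<gamma>2 * \<beta>1" "\<delta> * l1 = \<alpha>2 * \<gamma>1 - \<alpha>1 * \<gamma>2"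
    using \<delta> by (simp_all add: l0_def l1_def)
  have "\<alpha>1 * (\<delta> * l0) + \<beta>1 * (\<delta> * l1) = \<delta> * \<gamma>1"
    unfolding \<delta>l unfolding \<delta>_def by (simp add: algebra_simps)
  moreover have "\<alpha>2 * (\<delta> * l0) - \<beta>2 * (\<delta> * l1) = \<delta> * \<gamma>2"
    unfolding \<delta>l unfolding \<delta>_def by (simp add: algebra_simps)
  ultimately have "\<delta> * (\<alpha>1 * l0 + \<beta>1 * l1) = \<delta> * \<gamma>1" "\<delta> * (\<alpha>2 * l0 - \<beta>2 * l1) = \<delta> * \<gamma>2"
    by (simp_all only: distrib_left right_diff_distrib mult.left_commute)
  then have l_eq: "\<alpha>1 * l0 + \<beta>1 * l1 = \<gamma>1" "\<alpha>2 * l0 - \<beta>2 * l1 = \<gamma>2"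
    using \<delta> by simp_all
  \<comment> \<open>The bracket is the coefficient of s^2 m in the Bernstein form below; multiplying
    by \<open>\<delta>\<close> clears the denominators of \<open>l0\<close> and \<open>l1\<close>
    and leaves a polynomial with positive coefficients.\<close>
  have "2 * \<delta> * (4 * (l0 + l1) + (3 * a * c + 4 * a + 2 * c + 4))
      = 8 * (\<delta> * l0) + 8 * (\<delta> * l1) + 2 * \<delta> * (3 * a * c + 4 * a + 2 * c + 4)" by (simp add: algebra_simps)
  also have "\<dots> = 256 + 1280 * c^1 + 1728 * c^2 + 896 * c^3 + 160 * c^4 + 1024 * a^1 + 4096 * a^1 * c^1 + 5760 * a^1 *
        c^2 + 3104 * a^1 * c^3 + 560 * a^1 * c^4 + 2112 * a^2 + 7872 * a^2 * c^1 + 10944 * a^2 * c^2 + 5664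
        * a^2 * c^3 + 960 * a^2 * c^4 + 1472 * a^3 + 5152 * a^3 * c^1 + 6624 * a^3 * c^2 + 2880 * a^3 * c^3
        + 360 * a^3 * c^4 + 320 * a^4 + 1040 * a^4 * c^1 + 1200 * a^4 * c^2 + 360 * a^4 * c^3"
    unfolding \<delta>l unfolding \<delta>_def defs A B by (simp add: algebra_simps power_numeral_reduce)
  also have "\<dots> > 0" using ac by (intro add_pos_pos mult_pos_pos zero_less_power) auto
  finally have Lp: "4 * (l0 + l1) + (3 * a * c + 4 * a + 2 * c + 4) > 0"
    using \<delta> by (simp add: zero_less_mult_iff)
  have "2 * \<delta> * (4 * (l0 - l1) + (3 * a * c + 2 * a + 4 * c + 4))
      = 8 * (\<delta> * l0) - 8 * (\<delta> * l1) + 2 * \<delta> * (3 * a * c + 2 * a + 4 * c + 4)" by (simp add: algebra_simps)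
  also have "\<dots> = 256 + 1024 * c^1 + 2112 * c^2 + 1472 * c^3 + 320 * c^4 + 1280 * a^1 + 4096 * a^1 * c^1 + 7872 * a^1
        * c^2 + 5152 * a^1 * c^3 + 1040 * a^1 * c^4 + 1728 * a^2 + 5760 * a^2 * c^1 + 10944 * a^2 * c^2 +
        6624 * a^2 * c^3 + 1200 * a^2 * c^4 + 896 * a^3 + 3104 * a^3 * c^1 + 5664 * a^3 * c^2 + 2880 * a^3 *
        c^3 + 360 * a^3 * c^4 + 160 * a^4 + 560 * a^4 * c^1 + 960 * a^4 * c^2 + 360 * a^4 * c^3"
    unfolding \<delta>l unfolding \<delta>_def defs A B by (simp add: algebra_simps power_numeral_reduce)
  also have "\<dots> > 0" using ac by (intro add_pos_pos mult_pos_pos zero_less_power) auto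
  finally have Lm: "4 * (l0 - l1) + (3 * a * c + 2 * a + 4 * c + 4) > 0"
    using \<delta> by (simp add: zero_less_mult_iff)
  define Q where "Q x = (A - x) * (B + x) + (1 - x\<^sup>2) * (l0 + l1 * x)" for x
  have Q_pos: "Q x > 0" if x: "x \<in> {-1..1}" for x
  proof -
    define s m where "s = (1 + x) / 2" and "m = (1 - x) / 2"
    have sm: "s \<ge> 0" "m \<ge> 0" "x = s - m" "m = 1 - s" using x by (auto simp: s_def m_def field_simps)
    \<comment> \<open>the Bernstein form of the cubic \<open>Q\<close>\<close>
    have "Q x = (a * c + 2 * a) * s^3 + (a * c + 2 * c) * m^3
        + (4 * (l0 + l1) + (3 * a * c + 4 * a + 2 * c + 4)) * (s\<^sup>2 * m)
        + (4 * (l0 - l1) + (3 * a * c + 2 * a + 4 * c + 4)) * (s * m\<^sup>2)"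
      unfolding Q_def A B sm(3,4) by (simp add: algebra_simps power_numeral_reduce)
    \<comment> \<open>The outer coefficients are the values of \<open>vol\<close> at 1 and -1;
      \<open>s\<close> and \<open>m\<close> never vanish together.\<close>
    moreover have "(a * c + 2 * a) * s^3 + (a * c + 2 * c) * m^3 > 0"
    proof (cases "s = 0")
      case True
      then show ?thesis using ac sm by (simp add: add_pos_pos)
    next
      case False
      then have "(a * c + 2 * a) * s^3 > 0" using ac sm by (simp add: add_pos_pos)
      moreover have "(a * c + 2 * c) * m^3 \<ge> 0" using ac sm by simp
      ultimately show ?thesis by linarith
    qed
    moreover have "(4 * (l0 + l1) + (3 * a * c + 4 * a + 2 * c + 4)) * (s\<^sup>2 * m) \<ge> 0"
      "(4 * (l0 - l1) + (3 * a * c + 2 * a + 4 * c + 4)) * (s * m\<^sup>2) \<ge> 0"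
      using Lp Lm sm by (intro mult_nonneg_nonneg; simp)+
    ultimately show ?thesis by linarith
  qed
  have Q_cont: "continuous_on U Q" for U
    unfolding Q_def by (intro continuous_intros)
  \<comment> \<open>Compactness of [-1, 1] extends positivity to a slightly larger interval, giving
    the room beyond the end sections.\<close>
  have "open {x. Q x > 0}"
    using open_Collect_less[OF continuous_on_const[of UNIV 0] Q_cont[of UNIV]] by simp
  moreover have "{-1..1} \<subseteq> {x. Q x > 0}" using Q_pos by auto
  ultimately obtain e where e: "e > 0" "(\<Union>x\<in>{-1..1}. ball x e) \<subseteq> {x. Q x > 0}"
    using compact_subset_open_imp_ball_epsilon_subset[of "{-1..1::real}"] by auto
  have Q_pos': "Q x > 0" if "\<bar>x\<bar> < 1 + e" for x
  proof -
    \<comment> \<open>The centre is the point of [-1, 1] nearest to x.\<close>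
    have "x \<in> ball (max (- 1) (min 1 x)) e"
      using that e(1) by (auto simp: dist_real_def)
    moreover have "max (- 1) (min 1 x) \<in> {-1..1}" by auto
    ultimately show ?thesis using e(2) by blast
  qed
  define r where "r = (1 + min (1 + e) (min A B)) / 2"
  have r: "1 < r" "r < A" "r < B" "r < 1 + e" using e(1) assms by (auto simp: r_def min_def)
  have "continuous_on {-r..r} (\<lambda>x. - 2 * (l0 + l1 * x) / Q x)"
    using r Q_pos' by (intro continuous_intros Q_cont ballI less_imp_neq[THEN not_sym]) auto
  then obtain \<rho> where \<rho>: "\<And>x. - r < x \<Longrightarrow> x < r \<Longrightarrow> (\<rho> has_real_derivative - 2 * (l0 + l1 * x) / Q x) (at x)"
    using antiderivative_exists by blast
  have "extremal_profile A B l0 l1 r \<rho>"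
  proof
    show "0 < (A - x) * (B + x) + (1 - x\<^sup>2) * (l0 + l1 * x)" if "\<bar>x\<bar> < r" for x
      using Q_pos'[of x] that r by (simp add: Q_def)
    show "(\<rho> has_real_derivative - 2 * (l0 + l1 * x) / ((A - x) * (B + x) + (1 - x\<^sup>2) * (l0 + l1 * x))) (at x)"
      if "\<bar>x\<bar> < r" for x
      using \<rho>[of x] that by (simp add: Q_def abs_less_iff)
  qed (use r l_eq in \<open>simp_all add: defs\<close>)
  then show thesis by (rule that)
qed

section \<open>Gluing the charts\<close>

text \<open>The index \<open>b\<close> is \<open>\<sigma> $ 1\<close>: false near the zero section, true near the section at infinity.\<close>

definition sgn_of where "sgn_of b = (if b then - 1 else 1 :: real)"
lemma Zf_inverse: "u \<noteq> 0 \<Longrightarrow> Zf (1 / u) = Zf u / (cmod u)\<^sup>2"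
proof -
  assume u: "u \<noteq> 0"
  have "complex_of_real (Zf (1 / u)) = complex_of_real (Zf u / (cmod u)\<^sup>2)"
    using u by (simp add: of_real_Zf complex_norm_square field_simps del: of_real_power)
  then show ?thesis by (simp only: of_real_eq_iff)
qed

text \<open>The holomorphic derivative of ln \<open>Zf (1 / u)\<close> = ln \<open>Zf u\<close> - ln
  |u|^2.\<close>

lemma bf_inverse: "u \<noteq> 0 \<Longrightarrow> bf (1 / u) * (- v / u\<^sup>2) = bf u * v - v / u"
  unfolding bf_def of_real_Zf
  by (simp add: divide_simps) (simp add: algebra_simps power2_eq_square)

lemma qf_inverse: "u \<noteq> 0 \<Longrightarrow>
  of_real (qf (1 / u)) * (- v / u\<^sup>2) * cnj (- v' / u\<^sup>2) = of_real (qf u) * v * cnj v'"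
proof -
  assume u: "u \<noteq> 0"
  have "complex_of_real (qf (1 / u)) = of_real (qf u) * (u * cnj u)\<^sup>2"
  proof -
    have "qf (1 / u) = qf u * ((cmod u)\<^sup>2)\<^sup>2"
      unfolding qf_def Zf_inverse[OF u] by (simp add: power_divide)
    then show ?thesis
      by (simp only: of_real_mult of_real_power[of "(cmod u)\<^sup>2" 2] complex_norm_square)
  qed
  then show ?thesis using u by (simp add: power2_eq_square)
qed

text \<open>The flag records whether two charts use different affine coordinates in one place;
  carrying it along treats all 64 pairs of charts at once.\<close>

definition inv_if :: "bool \<Rightarrow> complex \<Rightarrow> complex" where
  "inv_if d u = (if d then 1 / u else u)"
definition inv_if' :: "bool \<Rightarrow> complex \<Rightarrow> complex \<Rightarrow> complex" where
  "inv_if' d u v = (if d then - v / u\<^sup>2 else v)"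

lemma inv_if_deriv:
  assumes "(h has_derivative h') (at y)" "d \<Longrightarrow> h y \<noteq> 0"
  shows "((\<lambda>y. inv_if d (h y)) has_derivative (\<lambda>c. inv_if' d (h y) (h' c))) (at y)"
  unfolding inv_if_def inv_if'_def using assms
  by (cases d) (auto intro!: derivative_eq_intros simp: power2_eq_square)

lemma
  assumes "d \<Longrightarrow> u \<noteq> 0"
  shows bf_inv_if: "bf (inv_if d u) * inv_if' d u v = bf u * v - (if d then v / u else 0)"
    and qf_inv_if: "of_real (qf (inv_if d u)) * inv_if' d u v * cnj (inv_if' d u v') = of_real (qf u) * v * cnj v'"
    and Zf_inv_if: "Zf (inv_if d u) = Zf u / (if d then (cmod u)\<^sup>2 else 1)"
  using assms bf_inverse qf_inverse Zf_inverse by (auto simp: inv_if_def inv_if'_def)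

text \<open>\<open>fibre_factor\<close> is the transition function of the line bundle \<open>\<O>(1,-1)\<close> or of its dual.\<close>

definition fibre_factor :: "bool \<Rightarrow> bool \<Rightarrow> bool \<Rightarrow> complex^3 \<Rightarrow> complex" where
  "fibre_factor b d2 d3 y = inv_if b ((if d2 then 1 / y$2 else 1) * (if d3 then y$3 else 1))"

definition dlog_factor :: "bool \<Rightarrow> bool \<Rightarrow> bool \<Rightarrow> complex^3 \<Rightarrow> complex^3 \<Rightarrow> complex" where
  "dlog_factor b d2 d3 y v = of_real (sgn_of b) * ((if d3 then v$3 / y$3 else 0) - (if d2 then v$2 / y$2 else 0))"

definition base_change :: "bool \<Rightarrow> bool \<Rightarrow> bool \<Rightarrow> complex^3 \<Rightarrow> complex^3" where
  "base_change b d2 d3 y = vector [y$1 * fibre_factor b d2 d3 y, inv_if d2 (y$2), inv_if d3 (y$3)]"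

definition base_change' :: "bool \<Rightarrow> bool \<Rightarrow> bool \<Rightarrow> complex^3 \<Rightarrow> complex^3 \<Rightarrow> complex^3" where
  "base_change' b d2 d3 y v = vector [fibre_factor b d2 d3 y * (v$1 + y$1 * dlog_factor b d2 d3 y v),
     inv_if' d2 (y$2) (v$2), inv_if' d3 (y$3) (v$3)]"

definition fibre_change :: "bool \<Rightarrow> complex^3 \<Rightarrow> complex^3" where
  "fibre_change d y = vector [inv_if d (y$1), y$2, y$3]"

definition fibre_change' :: "bool \<Rightarrow> complex^3 \<Rightarrow> complex^3 \<Rightarrow> complex^3" where
  "fibre_change' d y v = vector [inv_if' d (y$1) (v$1), v$2, v$3]"

section \<open>Charts at the two end sections\<close>

context extremal_profile begin

lemma calabi_chart_zero:
  "calabi_chart A B 1 X D D' (deriv \<kappa>) T S (12 * (l0 + 1) + 20 * (A - B) * l1) (20 * l1)"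
proof
  fix t :: real assume t: "t \<ge> 0"
  have tT: "t \<in> T" and x: "X t \<in> S" using X_bounds(4)[OF t] X_in_S by auto
  show "(X has_real_derivative D (X t) / 2) (at t)" by (rule X_deriv[OF tT])
  show "(D has_real_derivative D' (X t)) (at (X t))" by (rule D_deriv[OF x])
  show "((\<lambda>x. D' x / 2 - 1 * D x / (2 * (A - 1 * x)) + 1 * D x / (2 * (B + 1 * x)))
      has_real_derivative deriv \<kappa> (X t)) (at (X t))"
    by (rule has_field_derivative_transform_within_open[OF \<kappa>_deriv[OF x] open_S x]) (simp only: mult_1 \<kappa>_eq)
  show "D (X t) > 0" "A - 1 * X t > 0" "B + 1 * X t > 0"
    using D_pos[OF x] SD[OF x] by auto
  show "2 * (- 2 * (D' (X t) / 2 - 1 * D (X t) / (2 * (A - 1 * X t)) + 1 * D (X t) / (2 * (B + 1 * X t))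
        + t * deriv \<kappa> (X t) * D (X t) / 2) / D (X t)
      + (1 * t * (D' (X t) / 2 - 1 * D (X t) / (2 * (A - 1 * X t)) + 1 * D (X t) / (2 * (B + 1 * X t))) + 1 + 2) / (A - 1 * X t)
      - (1 * t * (D' (X t) / 2 - 1 * D (X t) / (2 * (A - 1 * X t)) + 1 * D (X t) / (2 * (B + 1 * X t))) + 1 - 2) / (B + 1 * X t))
    = 20 * l1 * X t + (12 * (l0 + 1) + 20 * (A - B) * l1)"
    unfolding mult_1 \<kappa>_eq[OF x] using scalar_curvature_equation[OF tT] by (simp add: add.commute)
qed (use nonneg_in_T smooth_X smooth_D X_in_S in auto)

text \<open>Stated with \<open>A\<close> and \<open>B\<close> exchanged: applied to the flipped
  profile, it returns a chart at infinity with the original order of parameters.\<close>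

lemma calabi_chart_infinity:
  "calabi_chart B A (- 1) X D D' (deriv \<kappa>) T S (12 * (l0 + 1) + 20 * (A - B) * l1) (20 * l1)"
proof
  fix t :: real assume t: "t \<ge> 0"
  have tT: "t \<in> T" and x: "X t \<in> S" using X_bounds(4)[OF t] X_in_S by auto
  have \<kappa>: "D' x / 2 - - 1 * D x / (2 * (B - - 1 * x)) + - 1 * D x / (2 * (A + - 1 * x)) = \<kappa> x" if "x \<in> S" for x
    using \<kappa>_eq[OF that] by simp
  show "(X has_real_derivative D (X t) / 2) (at t)" by (rule X_deriv[OF tT])
  show "(D has_real_derivative D' (X t)) (at (X t))" by (rule D_deriv[OF x])
  show "((\<lambda>x. D' x / 2 - - 1 * D x / (2 * (B - - 1 * x)) + - 1 * D x / (2 * (A + - 1 * x)))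
      has_real_derivative deriv \<kappa> (X t)) (at (X t))"
    by (rule has_field_derivative_transform_within_open[OF \<kappa>_deriv[OF x] open_S x]) (simp add: \<kappa>[symmetric])
  show "D (X t) > 0" "B - - 1 * X t > 0" "A + - 1 * X t > 0"
    using D_pos[OF x] SD[OF x] by auto
  have eq: "(- 1 * t * \<kappa> (X t) + - 1 + 2) / (B - - 1 * X t) - (- 1 * t * \<kappa> (X t) + - 1 - 2) / (A + - 1 * X t)
      = (t * \<kappa> (X t) + 3) / (A - X t) - (t * \<kappa> (X t) - 1) / (B + X t)"
    using SD[OF x] by (simp add: divide_simps) (simp add: algebra_simps)
  show "2 * (- 2 * (D' (X t) / 2 - - 1 * D (X t) / (2 * (B - - 1 * X t)) + - 1 * D (X t) / (2 * (A + - 1 * X t))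
        + t * deriv \<kappa> (X t) * D (X t) / 2) / D (X t)
      + (- 1 * t * (D' (X t) / 2 - - 1 * D (X t) / (2 * (B - - 1 * X t)) + - 1 * D (X t) / (2 * (A + - 1 * X t))) + - 1 + 2) / (B - - 1 * X t)
      - (- 1 * t * (D' (X t) / 2 - - 1 * D (X t) / (2 * (B - - 1 * X t)) + - 1 * D (X t) / (2 * (A + - 1 * X t))) + - 1 - 2) / (A + - 1 * X t))
    = 20 * l1 * X t + (12 * (l0 + 1) + 20 * (A - B) * l1)"
    unfolding \<kappa>[OF x] using eq scalar_curvature_equation[OF tT] by (simp only: add_diff_eq[symmetric] diff_conv_add_uminus add.assoc)
qed (use nonneg_in_T smooth_X smooth_D X_in_S in auto)

end

text \<open>Kept apart from \<open>extremal_profile\<close>, whose flipped copy would otherwise ask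
  for a flipped copy in turn.\<close>

locale extremal_bundle = extremal_profile
begin

sublocale inf: extremal_profile B A l0 "- l1" r "\<lambda>x. - \<rho> (- x)"
    "\<lambda>x. (B - x) * (A + x)" "\<lambda>x. (B - x) * (A + x) + (1 - x\<^sup>2) * (l0 + - l1 * x)"
  by (rule flip) simp_all

definition Xs where "Xs b = (if b then inf.X else X)"
definition Ds where "Ds b = (if b then inf.D else D)"

sublocale ch: calabi_chart A B "sgn_of b" "Xs b" "Ds b" "if b then inf.D' else D'"
    "if b then deriv inf.\<kappa> else deriv \<kappa>" "if b then inf.T else T" "if b then inf.S else S"
    "12 * (l0 + 1) + 20 * (A - B) * l1" "if b then - (20 * l1) else 20 * l1"
    "\<lambda>x. (if b then inf.D' else D') x / 2 - sgn_of b * Ds b x / (2 * (A - sgn_of b * x))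
        + sgn_of b * Ds b x / (2 * (B + sgn_of b * x))" for b
  using calabi_chart_zero inf.calabi_chart_infinity
  by (cases b) (simp_all add: sgn_of_def Xs_def Ds_def algebra_simps)

lemma sgn_of_simps: "sgn_of (\<not> b) = - sgn_of b" "sgn_of b * sgn_of b = 1" "sgn_of b * (sgn_of b * u) = u"
  by (auto simp: sgn_of_def)

lemma inf_nsq: "x \<in> {-1<..<1} \<Longrightarrow> inf.nsq (- x) = 1 / nsq x"
  by (simp add: inf.nsq_def nsq_def exp_minus field_simps)

lemma inf_\<Theta>: "inf.\<Theta> (- x) = \<Theta> x"
  by (simp add: inf.\<Theta>_def \<Theta>_def vol_def Q_def mult.commute)

text \<open>Inverting the fibre coordinate inverts the squared norm, and by \<open>inf_nsq\<close>
  the two momentum functions then differ by a sign.\<close>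

lemma Xs_inverse: "t > 0 \<Longrightarrow> Xs (\<not> b) (1 / t) = - Xs b t"
proof -
  have 1: "inf.X (1 / t) = - X t" if "t > 0" for t
  proof -
    have X: "X t \<in> {-1<..<1}" "nsq (X t) = t"
      using X_bounds[of t] nsq_X[of t] that by auto
    then have "inf.nsq (- X t) = 1 / t" by (simp add: inf_nsq)
    moreover have "- X t \<in> inf.S" using X r by (auto simp: inf.S_def)
    ultimately show ?thesis using inf.X_nsq[of "- X t"] by simp
  qed
  assume "t > 0"
  then show ?thesis using 1[of t] 1[of "1 / t"] by (cases b) (simp_all add: Xs_def)
qed

lemma Xs_bounds:
  assumes "t \<ge> 0"
  shows "Xs b t < 1" "- 1 \<le> Xs b t" "t > 0 \<Longrightarrow> - 1 < Xs b t"
  using X_bounds[OF assms] inf.X_bounds[OF assms] by (auto simp: Xs_def)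

lemma Xs_0: "Xs b 0 = - 1"
proof -
  have "nsq (- 1) = 0" "inf.nsq (- 1) = 0" by (simp_all add: nsq_def inf.nsq_def)
  then show ?thesis
    using X_nsq[OF in_S, of "- 1"] inf.X_nsq[OF inf.in_S, of "- 1"] by (simp add: Xs_def)
qed

text \<open>\<open>sgn_of b * Xs b t\<close> is the global momentum, so the squared length of the
  fibre rotation is the same function \<open>\<Theta>\<close> in both kinds of charts.\<close>

lemma t_Ds: "t \<ge> 0 \<Longrightarrow> t * Ds b (Xs b t) = \<Theta> (sgn_of b * Xs b t)"
  using t_D X_bounds(4) inf.t_D inf.X_bounds(4) inf_\<Theta>[of "- inf.X t"]
  by (auto simp: Xs_def Ds_def sgn_of_def)

text \<open>With \<open>c\<close> the transition function, \<open>N\<close> is divided by |c|^2 and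
  \<open>\<eta>\<close> multiplied by \<open>c\<close>; thus \<open>t\<close> and the momentum are
  invariant and \<open>E |\<eta>|^2\<close> is unchanged. The base terms are Fubini--Study metrics,
  invariant under inversion.\<close>

lemma H_base_change:
  assumes "d2 \<Longrightarrow> y$2 \<noteq> 0" "d3 \<Longrightarrow> y$3 \<noteq> 0"
  shows "ch.H b (base_change b d2 d3 y) (base_change' b d2 d3 y u) (base_change' b d2 d3 y v) = ch.H b y u v"
proof -
  define c where "c = fibre_factor b d2 d3 y"
  let ?y = "base_change b d2 d3 y"
  let ?u = "\<lambda>u. base_change' b d2 d3 y u"
  have c: "c \<noteq> 0" using assms by (auto simp: c_def fibre_factor_def inv_if_def)
  have cc: "(cmod c)\<^sup>2 = (if b then (if d2 then (cmod (y$2))\<^sup>2 else 1) / (if d3 then (cmod (y$3))\<^sup>2 else 1)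
      else (if d3 then (cmod (y$3))\<^sup>2 else 1) / (if d2 then (cmod (y$2))\<^sup>2 else 1))"
    by (simp add: c_def fibre_factor_def inv_if_def norm_mult norm_divide power_divide power_mult_distrib)
  have N: "ch.N b ?y = ch.N b y / (cmod c)\<^sup>2"
    unfolding cc ch.N_def base_change_def using assms
    by (cases b) (simp_all add: Zf_inv_if sgn_of_def)
  have \<beta>: "ch.\<beta> b ?y (?u u) = ch.\<beta> b y u - dlog_factor b d2 d3 y u" for u
    unfolding ch.\<beta>_def base_change_def base_change'_def using assms
    by (simp add: bf_inv_if dlog_factor_def algebra_simps)
  have \<eta>: "ch.\<eta> b ?y (?u u) = c * ch.\<eta> b y u" for u
    unfolding ch.\<eta>_def \<beta> by (simp add: base_change_def base_change'_def c_def algebra_simps)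
  have "(Re (?y$1))\<^sup>2 + (Im (?y$1))\<^sup>2 = ((Re (y$1))\<^sup>2 + (Im (y$1))\<^sup>2) * (cmod c)\<^sup>2"
    unfolding cmod_power2[symmetric] by (simp add: base_change_def c_def norm_mult power_mult_distrib)
  then have t: "ch.t b ?y = ch.t b y"
    unfolding ch.t_def N using c by simp
  have x: "ch.x b ?y = ch.x b y" by (simp add: ch.x_def t)
  have E: "complex_of_real (ch.E b ?y) * (c * cnj c) = of_real (ch.E b y)"
    unfolding ch.E_def N x complex_norm_square[symmetric] of_real_mult[symmetric] using c by simp
  have q: "complex_of_real (qf (?y$2)) * ?u u$2 * cnj (?u v$2) = of_real (qf (y$2)) * u$2 * cnj (v$2)"
    "complex_of_real (qf (?y$3)) * ?u u$3 * cnj (?u v$3) = of_real (qf (y$3)) * u$3 * cnj (v$3)"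
    using assms by (simp_all add: base_change_def base_change'_def qf_inv_if)
  have "ch.H b ?y (?u u) (?u v) = (of_real (ch.E b ?y) * (c * cnj c)) * ch.\<eta> b y u * cnj (ch.\<eta> b y v)
      + of_real (2 * (A - sgn_of b * ch.x b y)) * (complex_of_real (qf (?y$2)) * ?u u$2 * cnj (?u v$2))
      + of_real (2 * (B + sgn_of b * ch.x b y)) * (complex_of_real (qf (?y$3)) * ?u u$3 * cnj (?u v$3))"
    unfolding ch.H_def \<eta> ch.P_def ch.M_def x by (simp add: algebra_simps)
  then show ?thesis
    unfolding E q ch.H_def ch.P_def ch.M_def by (simp add: algebra_simps)
qed

text \<open>Here \<open>N\<close> and \<open>t\<close> become reciprocals and the momentum changes
  sign, as does \<open>sgn_of\<close>. By \<open>t_Ds\<close>, \<open>E\<close> gains |y$1|^4, which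
  compensates \<open>\<eta>\<close> being divided by - (y$1)^2. The index
  \<open>b \<noteq> d\<close> is an exclusive or.\<close>

lemma H_fibre_change:
  assumes "d \<Longrightarrow> y$1 \<noteq> 0"
  shows "ch.H (b \<noteq> d) (fibre_change d y) (fibre_change' d y u) (fibre_change' d y v) = ch.H b y u v"
proof (cases d)
  case False
  have "fibre_change d y = y" "fibre_change' d y u = u" for u
    using False by (simp_all add: fibre_change_def fibre_change'_def inv_if_def inv_if'_def vec_eq_iff forall_3)
  then show ?thesis using False by simp
next
  case True
  then have y: "y$1 \<noteq> 0" and b: "(b \<noteq> d) = (\<not> b)" using assms by auto
  let ?y = "fibre_change d y"
  let ?u = "\<lambda>u. fibre_change' d y u"
  have nth: "?y$1 = 1 / y$1" "?y$2 = y$2" "?y$3 = y$3" "?u u$1 = - u$1 / (y$1)\<^sup>2" "?u u$2 = u$2" "?u u$3 = u$3" for u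
    using True by (simp_all add: fibre_change_def fibre_change'_def inv_if_def inv_if'_def)
  have N: "ch.N (\<not> b) ?y = 1 / ch.N b y"
    unfolding ch.N_def nth by (cases b) (simp_all add: sgn_of_def)
  have n: "(Re (1 / y$1))\<^sup>2 + (Im (1 / y$1))\<^sup>2 = 1 / ((Re (y$1))\<^sup>2 + (Im (y$1))\<^sup>2)"
    unfolding cmod_power2[symmetric] by (simp add: norm_divide power_divide)
  have t: "ch.t (\<not> b) ?y = 1 / ch.t b y"
    unfolding ch.t_def N nth n by simp
  have n_pos: "(Re (y$1))\<^sup>2 + (Im (y$1))\<^sup>2 > 0"
    using y unfolding cmod_power2[symmetric] by simp
  have t_pos: "ch.t b y > 0"
    unfolding ch.t_def using n_pos ch.N_pos by simp
  have x: "ch.x (\<not> b) ?y = - ch.x b y"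
    unfolding ch.x_def t by (rule Xs_inverse[OF t_pos])
  have \<eta>: "ch.\<eta> (\<not> b) ?y (?u u) = - ch.\<eta> b y u / (y$1)\<^sup>2" for u
    unfolding ch.\<eta>_def ch.\<beta>_def nth using y by (simp add: sgn_of_simps field_simps power2_eq_square)
  have "ch.t (\<not> b) ?y * Ds (\<not> b) (ch.x (\<not> b) ?y) = ch.t b y * Ds b (ch.x b y)"
  proof -
    have "sgn_of (\<not> b) * (- ch.x b y) = sgn_of b * ch.x b y" by (simp add: sgn_of_def)
    then show ?thesis
      using t_Ds[where t="ch.t (\<not> b) ?y" and b="\<not> b", OF ch.t_nonneg]
        t_Ds[where t="ch.t b y" and b=b, OF ch.t_nonneg]
      unfolding ch.x_def[symmetric] x by metis
  qed
  then have "Ds (\<not> b) (ch.x (\<not> b) ?y) = (ch.t b y)\<^sup>2 * Ds b (ch.x b y)"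
    using t_pos unfolding t by (simp add: field_simps power2_eq_square)
  then have "ch.E (\<not> b) ?y = ch.E b y * ((Re (y$1))\<^sup>2 + (Im (y$1))\<^sup>2)\<^sup>2"
    unfolding ch.E_def N ch.t_def using ch.N_pos[of b y] by (simp add: field_simps power2_eq_square)
  then have "complex_of_real (ch.E (\<not> b) ?y) = of_real (ch.E b y) * (y$1 * cnj (y$1))\<^sup>2"
    unfolding cmod_power2[symmetric]
    by (simp only: of_real_mult of_real_power[of "(cmod (y$1))\<^sup>2" 2] complex_norm_square)
  moreover have "sgn_of (\<not> b) * (- ch.x b y) = sgn_of b * ch.x b y" by (simp add: sgn_of_def)
  ultimately show ?thesis
    unfolding b ch.H_def \<eta> ch.P_def ch.M_def x nth using y
    by (simp add: power2_eq_square)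
qed

end

section \<open>Transition maps between the charts: base coordinates first, then the fibre
  coordinate\<close>

definition transition :: "bool^3 \<Rightarrow> bool^3 \<Rightarrow> complex^3 \<Rightarrow> complex^3" where
  "transition \<sigma> \<tau> p = fibre_change (\<sigma>$1 \<noteq> \<tau>$1) (base_change (\<sigma>$1) (\<sigma>$2 \<noteq> \<tau>$2) (\<sigma>$3 \<noteq> \<tau>$3) p)"

definition transition' :: "bool^3 \<Rightarrow> bool^3 \<Rightarrow> complex^3 \<Rightarrow> complex^3 \<Rightarrow> complex^3" where
  "transition' \<sigma> \<tau> p v = fibre_change' (\<sigma>$1 \<noteq> \<tau>$1) (base_change (\<sigma>$1) (\<sigma>$2 \<noteq> \<tau>$2) (\<sigma>$3 \<noteq> \<tau>$3) p)
     (base_change' (\<sigma>$1) (\<sigma>$2 \<noteq> \<tau>$2) (\<sigma>$3 \<noteq> \<tau>$3) p v)"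

lemma fibre_factor_nonzero: "(d2 \<Longrightarrow> y$2 \<noteq> 0) \<Longrightarrow> (d3 \<Longrightarrow> y$3 \<noteq> 0) \<Longrightarrow> fibre_factor b d2 d3 y \<noteq> 0"
  by (auto simp: fibre_factor_def inv_if_def)

lemma chart_eqI:
  assumes "(chart_lift \<sigma> p, chart_lift \<tau> q) \<in> hom_rel"
  shows "chart \<sigma> p = chart \<tau> q"
  unfolding chart_def by (rule equiv_class_eq[OF equiv_hom_rel assms])

lemma chart_transition:
  assumes nz: "\<And>i. \<sigma>$i \<noteq> \<tau>$i \<Longrightarrow> p$i \<noteq> 0"
  shows "chart \<sigma> p = chart \<tau> (transition \<sigma> \<tau> p)"
proof (rule chart_eqI)
  \<comment> \<open>The three scalars rescale the homogeneous coordinates so that the entry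
    normalized in the target chart becomes 1.\<close>
  define l where "l = (if \<sigma>$2 \<noteq> \<tau>$2 then 1 / p$2 else 1)"
  define m where "m = (if \<sigma>$3 \<noteq> \<tau>$3 then 1 / p$3 else 1)"
  define n where "n = (if \<sigma>$1 \<noteq> \<tau>$1 then (if \<sigma>$1 then 1 / p$1 else m / (l * p$1)) else if \<sigma>$1 then m / l else 1)"
  have lmn: "l \<noteq> 0" "m \<noteq> 0" "n \<noteq> 0"
    using nz[of 1] nz[of 2] nz[of 3] by (auto simp: l_def m_def n_def)
  show "(chart_lift \<sigma> p, chart_lift \<tau> (transition \<sigma> \<tau> p)) \<in> hom_rel"
    unfolding chart_lift_def
  proof (rule hom_relI[OF lmn])
    show "affine_lift (\<tau>$2) (transition \<sigma> \<tau> p$2) = l *s affine_lift (\<sigma>$2) (p$2)"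
      using nz[of 2] by (auto simp: transition_def fibre_change_def base_change_def inv_if_def
          affine_lift_def l_def vec_eq_iff forall_2)
    show "affine_lift (\<tau>$3) (transition \<sigma> \<tau> p$3) = m *s affine_lift (\<sigma>$3) (p$3)"
      using nz[of 3] by (auto simp: transition_def fibre_change_def base_change_def inv_if_def
          affine_lift_def m_def vec_eq_iff forall_2)
    have f: "fibre_factor b (\<sigma>$2 \<noteq> \<tau>$2) (\<sigma>$3 \<noteq> \<tau>$3) p = inv_if b (l / m)" for b
      by (simp add: fibre_factor_def l_def m_def)
    have t1: "transition \<sigma> \<tau> p$1 = inv_if (\<sigma>$1 \<noteq> \<tau>$1) (p$1 * inv_if (\<sigma>$1) (l / m))"
      by (simp only: transition_def fibre_change_def base_change_def f vector_3)
    show "affine_lift (\<tau>$1) (transition \<sigma> \<tau> p$1)$1 = n * affine_lift (\<sigma>$1) (p$1)$1"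
      "affine_lift (\<tau>$1) (transition \<sigma> \<tau> p$1)$2 = n * l / m * affine_lift (\<sigma>$1) (p$1)$2"
      using nz[of 1] lmn unfolding t1 n_def inv_if_def affine_lift_def by (auto simp: field_simps)
    show "(affine_lift (\<sigma>$2) (p$2), affine_lift (\<sigma>$3) (p$3), affine_lift (\<sigma>$1) (p$1)) \<in> hom_coords"
      using chart_lift_in_hom_coords[of \<sigma> p] by (simp add: chart_lift_def)
  qed
qed

lemma chart_eq_nonzero:
  assumes "chart \<sigma> p = chart \<tau> q" "\<sigma>$i \<noteq> \<tau>$i"
  shows "p$i \<noteq> 0"
proof -
  have "(chart_lift \<sigma> p, chart_lift \<tau> q) \<in> hom_rel"
    using eq_equiv_class[OF _ equiv_hom_rel chart_lift_in_hom_coords] assms(1) by (simp add: chart_def)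
  then obtain l m n where "l \<noteq> 0" "m \<noteq> 0" "n \<noteq> 0"
    "affine_lift (\<tau>$2) (q$2) = l *s affine_lift (\<sigma>$2) (p$2)"
    "affine_lift (\<tau>$3) (q$3) = m *s affine_lift (\<sigma>$3) (p$3)"
    "affine_lift (\<tau>$1) (q$1)$1 = n * affine_lift (\<sigma>$1) (p$1)$1"
    "affine_lift (\<tau>$1) (q$1)$2 = n * l / m * affine_lift (\<sigma>$1) (p$1)$2"
    unfolding chart_lift_def by (elim hom_relE) blast
  then show ?thesis
    using assms(2) exhaust_3[of i]
    by (auto simp: affine_lift_def vec_eq_iff forall_2 split: if_splits)
qed

lemma fibre_factor_deriv:
  assumes "d2 \<Longrightarrow> p$2 \<noteq> 0" "d3 \<Longrightarrow> p$3 \<noteq> 0"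
  shows "(fibre_factor b d2 d3 has_derivative (\<lambda>v. fibre_factor b d2 d3 p * dlog_factor b d2 d3 p v)) (at p)"
proof -
  have 2: "((\<lambda>y. if d2 then 1 / y$2 else 1) has_derivative
      (\<lambda>v. (if d2 then 1 / p$2 else 1) * (- (if d2 then v$2 / p$2 else 0)))) (at p)"
    using assms(1) by (cases d2) (auto intro!: derivative_eq_intros has_derivative_vec_nth simp: power2_eq_square)
  have 3: "((\<lambda>y. if d3 then y$3 else 1) has_derivative
      (\<lambda>v. (if d3 then p$3 else 1) * (if d3 then v$3 / p$3 else 0))) (at p)"
    using assms(2) by (cases d3) (auto intro!: derivative_eq_intros has_derivative_vec_nth)
  have "((\<lambda>y. (if d2 then 1 / y$2 else 1) * (if d3 then y$3 else 1)) has_derivative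
      (\<lambda>v. ((if d2 then 1 / p$2 else 1) * (if d3 then p$3 else 1)) *
        ((if d3 then v$3 / p$3 else 0) - (if d2 then v$2 / p$2 else 0)))) (at p)"
    by (rule has_derivative_eq_rhs[OF has_derivative_mult[OF 2 3]]) (simp add: fun_eq_iff algebra_simps)
  from inv_if_deriv[OF this, of b] show ?thesis
    unfolding fibre_factor_def[abs_def] dlog_factor_def
    by (rule has_derivative_eq_rhs) (use assms in \<open>auto simp: inv_if_def inv_if'_def sgn_of_def fun_eq_iff power2_eq_square left_diff_distrib diff_divide_distrib\<close>)
qed

lemma transition_deriv:
  assumes nz: "\<And>i. \<sigma>$i \<noteq> \<tau>$i \<Longrightarrow> p$i \<noteq> 0"
  shows "(transition \<sigma> \<tau> has_derivative transition' \<sigma> \<tau> p) (at p)"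
proof -
  let ?f = "base_change (\<sigma>$1) (\<sigma>$2 \<noteq> \<tau>$2) (\<sigma>$3 \<noteq> \<tau>$3)"
  let ?f' = "base_change' (\<sigma>$1) (\<sigma>$2 \<noteq> \<tau>$2) (\<sigma>$3 \<noteq> \<tau>$3)"
  have f: "(?f has_derivative ?f' p) (at p)"
  proof (rule has_derivative_cart)
    have 1: "((\<lambda>y. y$1 * fibre_factor (\<sigma>$1) (\<sigma>$2 \<noteq> \<tau>$2) (\<sigma>$3 \<noteq> \<tau>$3) y) has_derivative
        (\<lambda>v. fibre_factor (\<sigma>$1) (\<sigma>$2 \<noteq> \<tau>$2) (\<sigma>$3 \<noteq> \<tau>$3) p * (v$1 + p$1 * dlog_factor (\<sigma>$1) (\<sigma>$2 \<noteq> \<tau>$2) (\<sigma>$3 \<noteq> \<tau>$3) p v))) (at p)"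
      by (rule has_derivative_eq_rhs[OF has_derivative_mult[OF has_derivative_vec_nth fibre_factor_deriv]])
        (use nz in \<open>auto simp: fun_eq_iff algebra_simps\<close>)
    show "((\<lambda>y. ?f y $ i) has_derivative (\<lambda>v. ?f' p v $ i)) (at p)" for i
      using exhaust_3[of i] 1 inv_if_deriv[OF has_derivative_vec_nth, of _ p] nz
      by (auto simp: base_change_def base_change'_def)
  qed
  have g: "(fibre_change (\<sigma>$1 \<noteq> \<tau>$1) has_derivative fibre_change' (\<sigma>$1 \<noteq> \<tau>$1) (?f p)) (at (?f p))"
  proof (rule has_derivative_cart)
    have "?f p $ 1 \<noteq> 0" if "\<sigma>$1 \<noteq> \<tau>$1"
      using nz[OF that] fibre_factor_nonzero[of "\<sigma>$2 \<noteq> \<tau>$2" p "\<sigma>$3 \<noteq> \<tau>$3"] nz by (simp add: base_change_def)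
    then show "((\<lambda>y. fibre_change (\<sigma>$1 \<noteq> \<tau>$1) y $ i) has_derivative (\<lambda>v. fibre_change' (\<sigma>$1 \<noteq> \<tau>$1) (?f p) v $ i)) (at (?f p))" for i
      using exhaust_3[of i] inv_if_deriv[OF has_derivative_vec_nth, of "\<sigma>$1 \<noteq> \<tau>$1" "?f p" 1] has_derivative_vec_nth
      by (auto simp: fibre_change_def fibre_change'_def)
  qed
  show ?thesis
    using has_derivative_compose[OF f g] unfolding transition_def[abs_def] transition'_def[abs_def] .
qed

lemma coord_chart: "coord \<sigma> (chart \<sigma> p) = p"
  unfolding coord_def by (rule inv_f_f[OF inj_chart])

lemma dirderiv_transition:
  assumes "chart \<sigma> p = chart \<tau> q"
  shows "q = transition \<sigma> \<tau> p" "dirderiv (coord \<tau> \<circ> chart \<sigma>) p = transition' \<sigma> \<tau> p"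
proof -
  \<comment> \<open>Outside this open set \<open>coord \<tau> \<circ> chart \<sigma>\<close> takes
    arbitrary values of \<open>inv\<close>; the derivative is found from agreement with
    \<open>transition\<close> on all of it.\<close>
  define U where "U = {p. \<forall>i\<in>{i. \<sigma>$i \<noteq> \<tau>$i}. p$i \<noteq> (0::complex)}"
  have nz: "p$i \<noteq> 0" if "\<sigma>$i \<noteq> \<tau>$i" for i
    using chart_eq_nonzero[OF assms that] .
  have eq: "(coord \<tau> \<circ> chart \<sigma>) y = transition \<sigma> \<tau> y" if "y \<in> U" for y
    using chart_transition[of \<sigma> \<tau> y] that by (simp add: U_def coord_chart)
  have p: "p \<in> U" using nz by (simp add: U_def)
  have "U = (\<Inter>i\<in>{i. \<sigma>$i \<noteq> \<tau>$i}. {p. p$i \<noteq> 0})" by (auto simp: U_def)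
  moreover have "open {p::complex^3. p$i \<noteq> 0}" for i
    by (rule open_Collect_neq) (auto intro!: continuous_intros)
  ultimately have U: "open U" by (simp add: open_INT)
  show "q = transition \<sigma> \<tau> p"
    using eq[OF p] assms coord_chart[of \<tau> q] by simp
  show "dirderiv (coord \<tau> \<circ> chart \<sigma>) p = transition' \<sigma> \<tau> p"
    by (rule dirderiv_eq, rule has_derivative_transform_within_open[OF transition_deriv U p])
      (use nz eq in auto)
qed

context extremal_bundle begin

text \<open>Only the fibre index enters, because the ansatz has the same form in both affine
  coordinates of each base factor.\<close>

definition G :: bundle_metric where
  "G \<sigma> y u v = Re (ch.H (\<sigma>$1) y u v)"

lemma G_eq: "G \<sigma> = hermitian_metric.g (ch.H (\<sigma>$1))"
  by (simp add: G_def fun_eq_iff hermitian_metric.g_def[OF ch.hermitian_metric_H])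

lemma kaehler_metric_G: "kaehler_metric G"
  unfolding kaehler_metric_def
proof (intro conjI allI impI)
  show "kaehler (G \<sigma>)" for \<sigma>
    unfolding G_eq by (rule hermitian_metric.kaehler_g[OF ch.hermitian_metric_H])
  fix \<sigma> \<tau> p q u v assume eq: "chart \<sigma> p = chart \<tau> q"
  let ?p = "base_change (\<sigma>$1) (\<sigma>$2 \<noteq> \<tau>$2) (\<sigma>$3 \<noteq> \<tau>$3) p"
  have nz: "p$i \<noteq> 0" if "\<sigma>$i \<noteq> \<tau>$i" for i
    using chart_eq_nonzero[OF eq that] .
  have nz1: "?p $ 1 \<noteq> 0" if "\<sigma>$1 \<noteq> \<tau>$1"
    using nz[OF that] fibre_factor_nonzero[of "\<sigma>$2 \<noteq> \<tau>$2" p "\<sigma>$3 \<noteq> \<tau>$3"] nz by (simp add: base_change_def)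
  let ?u = "base_change' (\<sigma>$1) (\<sigma>$2 \<noteq> \<tau>$2) (\<sigma>$3 \<noteq> \<tau>$3) p"
  have e: "(\<sigma>$1 \<noteq> (\<sigma>$1 \<noteq> \<tau>$1)) = \<tau>$1" by auto
  have "ch.H (\<sigma>$1 \<noteq> (\<sigma>$1 \<noteq> \<tau>$1)) (fibre_change (\<sigma>$1 \<noteq> \<tau>$1) ?p) (fibre_change' (\<sigma>$1 \<noteq> \<tau>$1) ?p (?u u))
      (fibre_change' (\<sigma>$1 \<noteq> \<tau>$1) ?p (?u v)) = ch.H (\<sigma>$1) ?p (?u u) (?u v)"
    by (rule H_fibre_change) (rule nz1)
  also have "\<dots> = ch.H (\<sigma>$1) p u v"
    by (rule H_base_change) (use nz in auto)
  finally have "ch.H (\<tau>$1) (transition \<sigma> \<tau> p) (transition' \<sigma> \<tau> p u) (transition' \<sigma> \<tau> p v) = ch.H (\<sigma>$1) p u v"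
    unfolding e transition_def transition'_def .
  then show "G \<sigma> p u v = G \<tau> q (dirderiv (coord \<tau> \<circ> chart \<sigma>) p u) (dirderiv (coord \<tau> \<circ> chart \<sigma>) p v)"
    unfolding dirderiv_transition[OF eq] G_def by simp
qed

lemma extremal_G: "extremal G"
  unfolding extremal_def G_eq by (intro allI ch.holomorphic_gradient)

end

section \<open>The torus action and the moment map\<close>

lemma torus_act_hom_rel:
  assumes "(h, h') \<in> hom_rel"
  shows "(torus_act \<theta> h, torus_act \<theta> h') \<in> hom_rel"
proof -
  obtain z w p z' w' p' where h: "h = (z, w, p)" "h' = (z', w', p')" by (metis prod_cases3)
  obtain l m n where r: "l \<noteq> 0" "m \<noteq> 0" "n \<noteq> 0" "z' = l *s z" "w' = m *s w"
    "p'$1 = n * p$1" "p'$2 = n * l / m * p$2" "(z, w, p) \<in> hom_coords"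
    using assms unfolding h by (rule hom_relE)
  show ?thesis
    unfolding h torus_act_def using r
    by (auto intro!: hom_relI[where l=l and m=m and n=n] simp: hom_coords_def vec_eq_iff forall_2)
qed

lemma torus_act_minus: "torus_act (- \<theta>) (torus_act \<theta> h) = h" "torus_act \<theta> (torus_act (- \<theta>) h) = h"
  by (cases h; simp add: torus_act_def vec_eq_iff forall_2 mult.assoc[symmetric] cis_mult)+

lemma torus_act_class: "torus_act \<theta> ` (hom_rel `` {h}) = hom_rel `` {torus_act \<theta> h}"
proof
  show "torus_act \<theta> ` (hom_rel `` {h}) \<subseteq> hom_rel `` {torus_act \<theta> h}"
    using torus_act_hom_rel by blast
  show "hom_rel `` {torus_act \<theta> h} \<subseteq> torus_act \<theta> ` (hom_rel `` {h})"
  proof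
    fix h' assume "h' \<in> hom_rel `` {torus_act \<theta> h}"
    then have "(h, torus_act (- \<theta>) h') \<in> hom_rel"
      using torus_act_hom_rel[of "torus_act \<theta> h" h' "- \<theta>"] by (simp add: torus_act_minus)
    moreover have "h' = torus_act \<theta> (torus_act (- \<theta>) h')" by (simp add: torus_act_minus)
    ultimately show "h' \<in> torus_act \<theta> ` (hom_rel `` {h})" by blast
  qed
qed

text \<open>After rotating, the homogeneous coordinates must be normalized again; renormalizing the
  base factors shifts the fibre angle according to the weights of the bundle.\<close>

definition chart_angles :: "bool^3 \<Rightarrow> real^3 \<Rightarrow> real^3" where
  "chart_angles \<sigma> \<theta> = vector [sgn_of (\<sigma>$1) * (\<theta>$1 - (if \<sigma>$2 then \<theta>$2 else 0) + (if \<sigma>$3 then \<theta>$3 else 0)),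
     sgn_of (\<sigma>$2) * \<theta>$2, sgn_of (\<sigma>$3) * \<theta>$3]"

definition rotate_coords :: "real^3 \<Rightarrow> complex^3 \<Rightarrow> complex^3" where
  "rotate_coords \<alpha> p = (\<chi> i. cis (\<alpha>$i) * p$i)"

lemma torus_map_eq: "torus_map \<sigma> \<theta> p = rotate_coords (chart_angles \<sigma> \<theta>) p"
proof -
  define l where "l = (if \<sigma>$2 then cis (- \<theta>$2) else 1)"
  define m where "m = (if \<sigma>$3 then cis (- \<theta>$3) else 1)"
  define n where "n = (if \<sigma>$1 then m / l * cis (- \<theta>$1) else 1)"
  have lmn: "l \<noteq> 0" "m \<noteq> 0" "n \<noteq> 0" by (auto simp: l_def m_def n_def)
  define \<phi> where "\<phi> = \<theta>$1 - (if \<sigma>$2 then \<theta>$2 else 0) + (if \<sigma>$3 then \<theta>$3 else 0)"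
  have lm: "l = cis (- (if \<sigma>$2 then \<theta>$2 else 0))" "m = cis (- (if \<sigma>$3 then \<theta>$3 else 0))"
    by (simp_all add: l_def m_def)
  have n: "n = (if \<sigma>$1 then cis (- \<phi>) else 1)"
    unfolding n_def lm cis_divide cis_mult by (simp add: \<phi>_def algebra_simps)
  have nlm: "n * l / m * cis (\<theta>$1) = (if \<sigma>$1 then 1 else cis \<phi>)"
    unfolding n lm by (simp add: cis_divide cis_mult) (simp add: \<phi>_def algebra_simps)
  have ca: "chart_angles \<sigma> \<theta> $ 1 = sgn_of (\<sigma>$1) * \<phi>"
    by (simp add: chart_angles_def \<phi>_def)
  have "(torus_act \<theta> (chart_lift \<sigma> p), chart_lift \<sigma> (rotate_coords (chart_angles \<sigma> \<theta>) p)) \<in> hom_rel"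
    unfolding chart_lift_def torus_act_def case_prod_conv
  proof (rule hom_relI[OF lmn])
    show "affine_lift (\<sigma>$2) (rotate_coords (chart_angles \<sigma> \<theta>) p$2)
        = l *s vector [affine_lift (\<sigma>$2) (p$2)$1, cis (\<theta>$2) * affine_lift (\<sigma>$2) (p$2)$2]"
      by (simp add: affine_lift_def rotate_coords_def chart_angles_def sgn_of_def l_def vec_eq_iff forall_2 cis_mult)
    show "affine_lift (\<sigma>$3) (rotate_coords (chart_angles \<sigma> \<theta>) p$3)
        = m *s vector [affine_lift (\<sigma>$3) (p$3)$1, cis (\<theta>$3) * affine_lift (\<sigma>$3) (p$3)$2]"
      by (simp add: affine_lift_def rotate_coords_def chart_angles_def sgn_of_def m_def vec_eq_iff forall_2 cis_mult)
    show "affine_lift (\<sigma>$1) (rotate_coords (chart_angles \<sigma> \<theta>) p$1)$1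
        = n * (vector [affine_lift (\<sigma>$1) (p$1)$1, cis (\<theta>$1) * affine_lift (\<sigma>$1) (p$1)$2] :: complex^2)$1"
      by (simp add: affine_lift_def rotate_coords_def ca sgn_of_def n)
    show "affine_lift (\<sigma>$1) (rotate_coords (chart_angles \<sigma> \<theta>) p$1)$2
        = n * l / m * (vector [affine_lift (\<sigma>$1) (p$1)$1, cis (\<theta>$1) * affine_lift (\<sigma>$1) (p$1)$2] :: complex^2)$2"
      unfolding vector_2 mult.assoc[symmetric] nlm
      by (simp add: affine_lift_def rotate_coords_def ca sgn_of_def)
    show "(vector [affine_lift (\<sigma>$2) (p$2)$1, cis (\<theta>$2) * affine_lift (\<sigma>$2) (p$2)$2],
        vector [affine_lift (\<sigma>$3) (p$3)$1, cis (\<theta>$3) * affine_lift (\<sigma>$3) (p$3)$2],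
        vector [affine_lift (\<sigma>$1) (p$1)$1, cis (\<theta>$1) * affine_lift (\<sigma>$1) (p$1)$2]) \<in> hom_coords"
      by (auto simp: hom_coords_def affine_lift_def vec_eq_iff forall_2)
  qed
  then have "torus_act \<theta> ` chart \<sigma> p = chart \<sigma> (rotate_coords (chart_angles \<sigma> \<theta>) p)"
    unfolding chart_def torus_act_class by (rule equiv_class_eq[OF equiv_hom_rel])
  then show ?thesis by (simp add: torus_map_def coord_chart)
qed

lemma bounded_linear_rotate_coords: "bounded_linear (rotate_coords \<alpha>)"
  unfolding linear_conv_bounded_linear[symmetric] rotate_coords_def
  by (rule linearI) (simp_all add: vec_eq_iff algebra_simps)

lemma dirderiv_torus_map: "dirderiv (torus_map \<sigma> \<theta>) p = rotate_coords (chart_angles \<sigma> \<theta>)"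
  unfolding torus_map_eq[abs_def]
  by (rule dirderiv_eq) (rule bounded_linear_imp_has_derivative[OF bounded_linear_rotate_coords])

text \<open>\<open>torus_field\<close> without its factor \<i>: since \<open>g\<close> is invariant
  under \<open>J\<close>, pairing the Kaehler form with \<open>torus_field\<close> is pairing
  \<open>g\<close> with this field.\<close>

definition infinitesimal_rotation :: "bool^3 \<Rightarrow> 3 \<Rightarrow> complex^3 \<Rightarrow> complex^3" where
  "infinitesimal_rotation \<sigma> j p = (\<chi> i. of_real (chart_angles \<sigma> (axis j 1) $ i) * p$i)"

lemma torus_field_eq: "torus_field \<sigma> j p = J (infinitesimal_rotation \<sigma> j p)"
  unfolding torus_field_def
proof (rule vector_derivative_at)
  have a: "chart_angles \<sigma> (axis j t) $ i = chart_angles \<sigma> (axis j 1) $ i * t" for i t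
    using exhaust_3[of i] by (auto simp: chart_angles_def axis_def algebra_simps)
  show "((\<lambda>t. torus_map \<sigma> (axis j t) p) has_vector_derivative J (infinitesimal_rotation \<sigma> j p)) (at 0)"
    unfolding has_vector_derivative_def
  proof (rule has_derivative_cart)
    fix i
    let ?k = "chart_angles \<sigma> (axis j 1) $ i"
    have "((\<lambda>t. cis (?k * t)) has_derivative (\<lambda>h. (?k * h) *\<^sub>R (\<i> * cis (?k * 0)))) (at 0)"
      by (rule has_derivative_cis[OF has_derivative_mult_right[OF has_derivative_ident]])
    from has_derivative_mult_left[OF this, of "p$i"]
    have "((\<lambda>t. cis (?k * t) * p$i) has_derivative (\<lambda>h. h *\<^sub>R (\<i> * (of_real ?k * p$i)))) (at 0)"
      by (rule has_derivative_eq_rhs) (simp add: fun_eq_iff scaleR_conv_of_real)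
    moreover have "torus_map \<sigma> (axis j t) p $ i = cis (?k * t) * p$i" for t
      by (simp only: torus_map_eq rotate_coords_def vec_lambda_beta a[of t])
    ultimately show "((\<lambda>t. torus_map \<sigma> (axis j t) p $ i) has_derivative
        (\<lambda>h. (h *\<^sub>R J (infinitesimal_rotation \<sigma> j p)) $ i)) (at 0)"
      by (simp add: infinitesimal_rotation_def)
  qed
qed

lemma Zf_rotate: "Zf (cis a * u) = Zf u"
proof -
  have "Zf z = 1 + (cmod z)\<^sup>2" for z by (simp add: Zf_def cmod_power2)
  then show ?thesis by (simp add: norm_mult)
qed

lemma bf_rotate: "bf (cis a * u) * (cis a * v) = bf u * v"
proof -
  have "bf (cis a * u) * (cis a * v) = (cnj (cis a) * cis a) * (cnj u * v) / of_real (Zf u)"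
    unfolding bf_def Zf_rotate by (simp add: mult_ac)
  also have "cnj (cis a) * cis a = 1" by (simp add: cis_cnj cis_mult)
  finally show ?thesis by (simp add: bf_def)
qed

lemma qf_rotate: "qf (cis a * u) = qf u"
  by (simp add: qf_def Zf_rotate)

text \<open>\<open>base_frac\<close> is the normalized moment map \<open>|z\<^sub>2|\<^sup>2 / |z|\<^sup>2\<close> of a factor of the base.\<close>

definition base_frac :: "bool \<Rightarrow> complex \<Rightarrow> real" where
  "base_frac b u = (if b then 1 / Zf u else 1 - 1 / Zf u)"

lemma base_frac_deriv:
  "((\<lambda>y::complex^3. base_frac b (y$i)) has_derivative (\<lambda>v. sgn_of b * (2 * qf (y$i) * Re (cnj (y$i) * v$i)))) (at y)"
proof -
  have "Re (bf u * v) = Re (cnj u * v) / Zf u" for u v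
    by (simp add: bf_def field_simps)
  then have d: "((\<lambda>y::complex^3. 1 / Zf (y$i)) has_derivative (\<lambda>v. - (2 * qf (y$i) * Re (cnj (y$i) * v$i)))) (at y)"
    by (intro has_derivative_eq_rhs[OF has_derivative_divide[OF has_derivative_const Zf_deriv[OF has_derivative_vec_nth]]])
      (auto simp: fun_eq_iff qf_def power2_eq_square field_simps)
  then show ?thesis
    unfolding base_frac_def sgn_of_def
    using d has_derivative_diff[OF has_derivative_const[of 1] d] by (cases b) simp_all
qed

context extremal_bundle begin

lemma torus_invariant_G: "torus_invariant G"
proof -
  have "ch.H b (rotate_coords \<alpha> y) (rotate_coords \<alpha> u) (rotate_coords \<alpha> v) = ch.H b y u v" for b \<alpha> y u v
  proof -
    let ?R = "rotate_coords \<alpha>"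
    have N: "ch.N b (?R y) = ch.N b y"
      by (simp add: ch.N_def rotate_coords_def Zf_rotate)
    have "(Re (?R y$1))\<^sup>2 + (Im (?R y$1))\<^sup>2 = (Re (y$1))\<^sup>2 + (Im (y$1))\<^sup>2"
      unfolding cmod_power2[symmetric] by (simp add: rotate_coords_def norm_mult)
    then have t: "ch.t b (?R y) = ch.t b y" by (simp add: ch.t_def N)
    have x: "ch.x b (?R y) = ch.x b y" by (simp add: ch.x_def t)
    have \<beta>: "ch.\<beta> b (?R y) (?R u) = ch.\<beta> b y u" for u
      by (simp add: ch.\<beta>_def rotate_coords_def bf_rotate)
    have \<eta>: "ch.\<eta> b (?R y) (?R u) = cis (\<alpha>$1) * ch.\<eta> b y u" for u
      unfolding ch.\<eta>_def \<beta> by (simp add: rotate_coords_def algebra_simps)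
    have c: "cis a * u * cnj (cis a * v) = u * cnj v" for a u v
    proof -
      have "cis a * u * cnj (cis a * v) = (cnj (cis a) * cis a) * (u * cnj v)" by (simp add: mult_ac)
      also have "cnj (cis a) * cis a = 1" by (simp add: cis_cnj cis_mult)
      finally show ?thesis by simp
    qed
    show ?thesis
      unfolding ch.H_def ch.P_def ch.M_def ch.E_def x N \<eta> mult.assoc[of "complex_of_real _"] c
      by (simp add: rotate_coords_def qf_rotate c[unfolded complex_cnj_mult])
  qed
  then show ?thesis
    unfolding torus_invariant_def dirderiv_torus_map torus_map_eq G_def by simp
qed

text \<open>The last two components are Fubini--Study moment maps scaled by the sizes
  \<open>A - x\<close> and \<open>B + x\<close> of the base metrics and shifted to start at -1. The
  case \<open>p$1 = 0\<close> is the section at infinity, where x = 1.\<close>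

definition mom :: "hom \<Rightarrow> real^3" where
  "mom = (\<lambda>(z, w, p). let hn = (\<lambda>z. (cmod (z$1))\<^sup>2 + (cmod (z$2))\<^sup>2);
     x = (if p$1 = 0 then 1 else Xs False ((cmod (p$2))\<^sup>2 * hn w / ((cmod (p$1))\<^sup>2 * hn z)))
   in vector [x, (A - x) * ((cmod (z$2))\<^sup>2 / hn z) - 1, (B + x) * ((cmod (w$2))\<^sup>2 / hn w) - 1])"

definition moment :: "hom set \<Rightarrow> real^3" where
  "moment P = mom (SOME h. h \<in> P)"

lemma mom_hom_rel:
  assumes "(h, h') \<in> hom_rel"
  shows "mom h' = mom h"
proof -
  obtain z w p z' w' p' where h: "h = (z, w, p)" "h' = (z', w', p')" by (metis prod_cases3)
  obtain l m n where r: "l \<noteq> 0" "m \<noteq> 0" "n \<noteq> 0" "z' = l *s z" "w' = m *s w"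
    "p'$1 = n * p$1" "p'$2 = n * l / m * p$2" "(z, w, p) \<in> hom_coords"
    using assms unfolding h by (rule hom_relE)
  have q: "(cmod (u * v))\<^sup>2 = (cmod u)\<^sup>2 * (cmod v)\<^sup>2" "(cmod (u / v))\<^sup>2 = (cmod u)\<^sup>2 / (cmod v)\<^sup>2" for u v
    by (simp_all add: norm_mult norm_divide power_mult_distrib power_divide)
  have 1: "(cmod (p'$2))\<^sup>2 * ((cmod (w'$1))\<^sup>2 + (cmod (w'$2))\<^sup>2) / ((cmod (p'$1))\<^sup>2 * ((cmod (z'$1))\<^sup>2 + (cmod (z'$2))\<^sup>2))
    = (cmod (p$2))\<^sup>2 * ((cmod (w$1))\<^sup>2 + (cmod (w$2))\<^sup>2) / ((cmod (p$1))\<^sup>2 * ((cmod (z$1))\<^sup>2 + (cmod (z$2))\<^sup>2))"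
    using r(1-3) unfolding r(4-7) vector_smult_component q distrib_left[symmetric] by simp
  have 2: "(cmod (z'$2))\<^sup>2 / ((cmod (z'$1))\<^sup>2 + (cmod (z'$2))\<^sup>2) = (cmod (z$2))\<^sup>2 / ((cmod (z$1))\<^sup>2 + (cmod (z$2))\<^sup>2)"
    "(cmod (w'$2))\<^sup>2 / ((cmod (w'$1))\<^sup>2 + (cmod (w'$2))\<^sup>2) = (cmod (w$2))\<^sup>2 / ((cmod (w$1))\<^sup>2 + (cmod (w$2))\<^sup>2)"
    using r(1-3) unfolding r(4,5) vector_smult_component q distrib_left[symmetric] by simp_all
  have 3: "p'$1 = 0 \<longleftrightarrow> p$1 = 0" using r by simp
  show ?thesis unfolding mom_def h case_prod_conv Let_def 1 2 3 ..
qed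

lemma moment_class: "h \<in> hom_coords \<Longrightarrow> moment (hom_rel `` {h}) = mom h"
proof -
  assume "h \<in> hom_coords"
  then have "h \<in> hom_rel `` {h}" using equiv_class_self[OF equiv_hom_rel] by blast
  then have "(SOME h'. h' \<in> hom_rel `` {h}) \<in> hom_rel `` {h}" by (rule someI)
  then show ?thesis unfolding moment_def using mom_hom_rel by blast
qed

lemma moment_chart:
  "moment (chart \<sigma> p) = (let x = sgn_of (\<sigma>$1) * ch.x (\<sigma>$1) p in
     vector [x, (A - x) * base_frac (\<sigma>$2) (p$2) - 1, (B + x) * base_frac (\<sigma>$3) (p$3) - 1])"
proof -
  have hn: "(cmod (affine_lift b u$1))\<^sup>2 + (cmod (affine_lift b u$2))\<^sup>2 = Zf u" for b u
    by (simp add: affine_lift_def Zf_def cmod_power2)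
  have fr: "(cmod (affine_lift b u$2))\<^sup>2 / Zf u = base_frac b u" for b u
  proof -
    have "(cmod u)\<^sup>2 = Zf u - 1" by (simp add: Zf_def cmod_power2)
    then show ?thesis by (simp add: affine_lift_def base_frac_def diff_divide_distrib)
  qed
  have eq: "(if affine_lift (\<sigma>$1) (p$1)$1 = 0 then 1
      else Xs False ((cmod (affine_lift (\<sigma>$1) (p$1)$2))\<^sup>2 * Zf (p$3) / ((cmod (affine_lift (\<sigma>$1) (p$1)$1))\<^sup>2 * Zf (p$2))))
    = sgn_of (\<sigma>$1) * ch.x (\<sigma>$1) p"
  proof (cases "\<sigma>$1")
    case False
    have "ch.t False p = (cmod (p$1))\<^sup>2 * (Zf (p$3) / Zf (p$2))"
      unfolding ch.t_def ch.N_def by (simp add: sgn_of_def cmod_power2)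
    moreover have "sgn_of False * u = u" for u by (simp add: sgn_of_def)
    ultimately show ?thesis
      by (simp add: False affine_lift_def ch.x_def)
  next
    case True
    have t: "ch.t True p = (cmod (p$1))\<^sup>2 * (Zf (p$2) / Zf (p$3))"
      unfolding ch.t_def ch.N_def by (simp add: sgn_of_def cmod_power2)
    have s: "sgn_of True * u = - u" for u by (simp add: sgn_of_def)
    show ?thesis
    proof (cases "p$1 = 0")
      case True
      then show ?thesis using \<open>\<sigma>$1\<close> by (simp add: affine_lift_def ch.x_def t Xs_0) (simp add: sgn_of_def)
    next
      case False
      then have "ch.t True p > 0" unfolding t by (simp add: Zf_pos)
      from Xs_inverse[OF this, of True] show ?thesis
        using \<open>\<sigma>$1\<close> False by (simp add: affine_lift_def s ch.x_def t)
    qed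
  qed
  show ?thesis
    unfolding chart_def moment_class[OF chart_lift_in_hom_coords]
    unfolding chart_lift_def mom_def case_prod_conv Let_def hn eq fr ..
qed

end

section \<open>The symplectic potential\<close>

lemma base_frac_bounds: "0 \<le> base_frac b u" "base_frac b u \<le> 1"
proof -
  have "1 / Zf u \<le> 1" "1 / Zf u > 0" by (simp_all add: Zf_def add_pos_nonneg)
  then show "0 \<le> base_frac b u" "base_frac b u \<le> 1" by (auto simp: base_frac_def)
qed

lemma base_frac_surj:
  assumes "0 \<le> m" "m \<le> 1"
  obtains b u where "base_frac b u = m"
proof (cases "m = 1")
  case True
  then have "base_frac True 0 = m" by (simp add: base_frac_def Zf_def)
  then show thesis by (rule that)
next
  case False
  have "Zf (of_real (sqrt (m / (1 - m)))) = 1 / (1 - m)"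
    using assms False by (simp add: Zf_def field_simps)
  then have "base_frac False (of_real (sqrt (m / (1 - m)))) = m" by (simp add: base_frac_def)
  then show thesis by (rule that)
qed

lemma base_frac_mult_cnj: "complex_of_real (base_frac False u) = bf u * u"
proof -
  have "cnj u * u = complex_of_real (Zf u) - 1" by (simp add: of_real_Zf mult.commute)
  then show ?thesis by (simp add: base_frac_def bf_def diff_divide_distrib)
qed

lemma matrix_inv_eqI:
  fixes M M' :: "real^'n^'n"
  assumes "M ** M' = mat 1"
  shows "matrix_inv M = M'"
proof -
  have 2: "M' ** M = mat 1" using assms matrix_left_right_inverse by blast
  then have inv: "M ** matrix_inv M = mat 1"
    using assms unfolding matrix_inv_def by (metis (mono_tags, lifting) someI_ex)
  have "matrix_inv M = (M' ** M) ** matrix_inv M" by (simp add: 2)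
  also have "\<dots> = M'" unfolding matrix_mul_assoc[symmetric] inv by simp
  finally show ?thesis .
qed

text \<open>The second part differentiates the result of the first once more; \<open>k\<close>
  stands for \<open>h' v\<close>, which is constant because every facet function is affine.\<close>

lemma xlnx_deriv:
  fixes h :: "'a::real_normed_vector \<Rightarrow> real"
  assumes "(h has_derivative h') (at y)" "h y > 0"
  shows "((\<lambda>y. h y * ln (h y)) has_derivative (\<lambda>v. (ln (h y) + 1) * h' v)) (at y)"
    and "((\<lambda>y. (ln (h y) + 1) * k) has_derivative (\<lambda>v. h' v * k / h y)) (at y)"
  using assms by (auto intro!: derivative_eq_intros simp: field_simps)

lemma has_derivative_divide_const:
  fixes g :: "'a::real_normed_vector \<Rightarrow> real"
  shows "(g has_derivative g') F \<Longrightarrow> ((\<lambda>y. g y / c) has_derivative (\<lambda>v. g' v / c)) F"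
  by (rule bounded_linear.has_derivative[OF bounded_linear_divide])

text \<open>Each facet function l contributes dl(u) dl(v) / (2 l), and \<open>k\<close> is the
  second derivative of f. Signs stay unsimplified so that each summand matches the differentiated
  term of one facet.\<close>

definition polytope_hessian :: "real \<Rightarrow> real \<Rightarrow> real \<Rightarrow> real^3 \<Rightarrow> real^3 \<Rightarrow> real^3 \<Rightarrow> real" where
  "polytope_hessian a c k y u v = (u$1 * v$1 / (1 + y$1) + (- u$1) * (- v$1) / (1 - y$1) + u$2 * v$2 / (1 + y$2)
     + u$3 * v$3 / (1 + y$3) + (- u$1 - u$2) * (- v$1 - v$2) / (a - y$1 - y$2)
     + (u$1 - u$3) * (v$1 - v$3) / (c + y$1 - y$3)) / 2 + k * u$1 * v$1"

lemma hessian_Phi0: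
  fixes f f1 :: "real \<Rightarrow> real"
  assumes f: "\<And>x. \<bar>x\<bar> < 1 \<Longrightarrow> (f has_real_derivative f1 x) (at x)"
    and f1: "\<And>x. \<bar>x\<bar> < 1 \<Longrightarrow> (f1 has_real_derivative f2 x) (at x)"
    and y: "1 + y$1 > 0" "1 - y$1 > 0" "1 + y$2 > 0" "1 + y$3 > 0" "a - y$1 - y$2 > 0" "c + y$1 - y$3 > 0"
  shows "hessian (\<lambda>y. Phi0 a c y + f (y$1)) y $ i $ j = polytope_hessian a c (f2 (y$1)) y (axis i 1) (axis j 1)"
proof -
  define U :: "(real^3) set" where
    "U = {y. 1 + y$1 > 0 \<and> 1 - y$1 > 0 \<and> 1 + y$2 > 0 \<and> 1 + y$3 > 0 \<and> a - y$1 - y$2 > 0 \<and> c + y$1 - y$3 > 0}"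
  have U: "open U"
    unfolding U_def by (intro open_Collect_conj open_Collect_less continuous_intros)
  note nth = has_derivative_vec_nth
  have lin: "((\<lambda>y::real^3. 1 + y$1) has_derivative (\<lambda>v. v$1)) (at y)" "((\<lambda>y::real^3. 1 - y$1) has_derivative (\<lambda>v. - v$1)) (at y)"
    "((\<lambda>y::real^3. 1 + y$2) has_derivative (\<lambda>v. v$2)) (at y)" "((\<lambda>y::real^3. 1 + y$3) has_derivative (\<lambda>v. v$3)) (at y)"
    "((\<lambda>y::real^3. a - y$1 - y$2) has_derivative (\<lambda>v. - v$1 - v$2)) (at y)"
    "((\<lambda>y::real^3. c + y$1 - y$3) has_derivative (\<lambda>v. v$1 - v$3)) (at y)" for y
    by (auto intro!: derivative_eq_intros nth)
  have fy: "((\<lambda>y. f (y$1)) has_derivative (\<lambda>v. f1 (y$1) * v$1)) (at y)"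
      "((\<lambda>y. f1 (y$1)) has_derivative (\<lambda>v. f2 (y$1) * v$1)) (at y)" if "y \<in> U" for y :: "real^3"
  proof -
    have "\<bar>y$1\<bar> < 1" using that by (auto simp: U_def)
    then show "((\<lambda>y. f (y$1)) has_derivative (\<lambda>v. f1 (y$1) * v$1)) (at y)"
        "((\<lambda>y. f1 (y$1)) has_derivative (\<lambda>v. f2 (y$1) * v$1)) (at y)"
      using has_derivative_compose[OF nth has_field_derivative_imp_has_derivative[OF f]]
        has_derivative_compose[OF nth has_field_derivative_imp_has_derivative[OF f1]] by blast+
  qed
  define D1 where "D1 y v = ((ln (1 + y$1) + 1) * v$1 + (ln (1 - y$1) + 1) * (- v$1) + (ln (1 + y$2) + 1) * v$2
     + (ln (1 + y$3) + 1) * v$3 + (ln (a - y$1 - y$2) + 1) * (- v$1 - v$2)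
     + (ln (c + y$1 - y$3) + 1) * (v$1 - v$3)) / 2 + f1 (y$1) * v$1" for y v :: "real^3"
  have D1: "dirderiv (\<lambda>y. Phi0 a c y + f (y$1)) y v = D1 y v" if "y \<in> U" for y v
  proof -
    have "((\<lambda>y. Phi0 a c y + f (y$1)) has_derivative D1 y) (at y)"
      unfolding Phi0_def Let_def D1_def
      by (intro has_derivative_add has_derivative_divide_const xlnx_deriv(1) lin fy(1) that) (use that in \<open>auto simp: U_def\<close>)
    then show ?thesis by (simp add: dirderiv_eq)
  qed
  have yU: "y \<in> U" using y by (simp add: U_def)
  have "((\<lambda>y. D1 y v) has_derivative (\<lambda>u. polytope_hessian a c (f2 (y$1)) y u v)) (at y)" for v
    unfolding D1_def polytope_hessian_def
    by (intro has_derivative_add has_derivative_divide_const xlnx_deriv(2) lin has_derivative_mult_left fy(2) yU y)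
  then have "((\<lambda>y. dirderiv (\<lambda>y. Phi0 a c y + f (y$1)) y v) has_derivative (\<lambda>u. polytope_hessian a c (f2 (y$1)) y u v)) (at y)" for v
    by (rule has_derivative_transform_within_open[OF _ U yU]) (simp add: D1)
  from dirderiv_eq[OF this] show ?thesis by (simp add: hessian_def)
qed

section \<open>Moment map equation, moment polytope and action-angle form of the metric\<close>

context extremal_bundle begin

interpretation hm: hermitian_metric "ch.H b" "ch.K b" for b
  by (rule ch.hermitian_metric_H)

lemma kaehler_form_torus_field:
  "kaehler_form (G \<sigma>) p v (torus_field \<sigma> j p) = Re (ch.H (\<sigma>$1) p v (infinitesimal_rotation \<sigma> j p))"
  unfolding kaehler_form_def G_def torus_field_eq by (simp add: hm.H_smult hm.H_smult_right)

lemma \<eta>_infinitesimal_rotation: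
  "ch.\<eta> (\<sigma>$1) p (infinitesimal_rotation \<sigma> 1 p) = of_real (sgn_of (\<sigma>$1)) * p$1"
  "ch.\<eta> (\<sigma>$1) p (infinitesimal_rotation \<sigma> 2 p) = - of_real (sgn_of (\<sigma>$1) * base_frac (\<sigma>$2) (p$2)) * p$1"
  "ch.\<eta> (\<sigma>$1) p (infinitesimal_rotation \<sigma> 3 p) = of_real (sgn_of (\<sigma>$1) * base_frac (\<sigma>$3) (p$3)) * p$1"
proof -
  have b: "complex_of_real (base_frac b u) = (if b then 1 - bf u * u else bf u * u)" for b u
    using base_frac_mult_cnj[of u] by (simp add: base_frac_def diff_eq_eq eq_diff_eq add.commute)
  show "ch.\<eta> (\<sigma>$1) p (infinitesimal_rotation \<sigma> 1 p) = of_real (sgn_of (\<sigma>$1)) * p$1"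
    by (simp add: ch.\<eta>_def ch.\<beta>_def infinitesimal_rotation_def chart_angles_def axis_def)
  show "ch.\<eta> (\<sigma>$1) p (infinitesimal_rotation \<sigma> 2 p) = - of_real (sgn_of (\<sigma>$1) * base_frac (\<sigma>$2) (p$2)) * p$1"
    unfolding of_real_mult b
    by (simp add: ch.\<eta>_def ch.\<beta>_def infinitesimal_rotation_def chart_angles_def axis_def sgn_of_def[of "\<sigma>$2"] algebra_simps)
  show "ch.\<eta> (\<sigma>$1) p (infinitesimal_rotation \<sigma> 3 p) = of_real (sgn_of (\<sigma>$1) * base_frac (\<sigma>$3) (p$3)) * p$1"
    unfolding of_real_mult b
    by (simp add: ch.\<eta>_def ch.\<beta>_def infinitesimal_rotation_def chart_angles_def axis_def sgn_of_def[of "\<sigma>$3"] algebra_simps)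
qed

text \<open>Differentiating the product of scale and base fraction gives two terms: the
  Fubini--Study one is the base part of \<open>H\<close>, the one with dx is its
  \<open>\<eta>\<close> part, by \<open>\<eta>_infinitesimal_rotation\<close>.\<close>

lemma moment_map_moment: "moment_map G moment"
  unfolding moment_map_def kaehler_form_torus_field
proof (intro allI)
  fix \<sigma> :: "bool^3" and j :: 3 and p :: "complex^3"
  let ?e = "sgn_of (\<sigma>$1)"
  let ?dx = "\<lambda>v. ch.E (\<sigma>$1) p * Re (cnj (p$1) * ch.\<eta> (\<sigma>$1) p v)"
  have 1: "((\<lambda>q. ?e * ch.x (\<sigma>$1) q) has_derivative (\<lambda>v. ?e * ?dx v)) (at p)"
    by (rule has_derivative_mult_right[OF ch.x_deriv])
  have 2: "((\<lambda>q. (A - ?e * ch.x (\<sigma>$1) q) * base_frac (\<sigma>$2) (q$2) - 1) has_derivative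
      (\<lambda>v. (A - ?e * ch.x (\<sigma>$1) p) * (sgn_of (\<sigma>$2) * (2 * qf (p$2) * Re (cnj (p$2) * v$2)))
         - ?e * ?dx v * base_frac (\<sigma>$2) (p$2))) (at p)"
    by (rule derivative_eq_intros 1 base_frac_deriv refl)+ simp
  have 3: "((\<lambda>q. (B + ?e * ch.x (\<sigma>$1) q) * base_frac (\<sigma>$3) (q$3) - 1) has_derivative
      (\<lambda>v. (B + ?e * ch.x (\<sigma>$1) p) * (sgn_of (\<sigma>$3) * (2 * qf (p$3) * Re (cnj (p$3) * v$3)))
         + ?e * ?dx v * base_frac (\<sigma>$3) (p$3))) (at p)"
    by (rule derivative_eq_intros 1 base_frac_deriv refl)+ simp
  have nth: "infinitesimal_rotation \<sigma> 1 p $ 2 = 0" "infinitesimal_rotation \<sigma> 1 p $ 3 = 0"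
    "infinitesimal_rotation \<sigma> 2 p $ 2 = of_real (sgn_of (\<sigma>$2)) * p$2" "infinitesimal_rotation \<sigma> 2 p $ 3 = 0"
    "infinitesimal_rotation \<sigma> 3 p $ 2 = 0" "infinitesimal_rotation \<sigma> 3 p $ 3 = of_real (sgn_of (\<sigma>$3)) * p$3"
    by (simp_all add: infinitesimal_rotation_def chart_angles_def axis_def)
  have H1: "Re (ch.H (\<sigma>$1) p v (infinitesimal_rotation \<sigma> 1 p)) = ?e * ?dx v" for v
    unfolding ch.H_def \<eta>_infinitesimal_rotation nth by (simp add: algebra_simps)
  have H2: "Re (ch.H (\<sigma>$1) p v (infinitesimal_rotation \<sigma> 2 p)) =
      (A - ?e * ch.x (\<sigma>$1) p) * (sgn_of (\<sigma>$2) * (2 * qf (p$2) * Re (cnj (p$2) * v$2)))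
         - ?e * ?dx v * base_frac (\<sigma>$2) (p$2)" for v
    unfolding ch.H_def \<eta>_infinitesimal_rotation nth ch.P_def by (simp add: algebra_simps)
  have H3: "Re (ch.H (\<sigma>$1) p v (infinitesimal_rotation \<sigma> 3 p)) =
      (B + ?e * ch.x (\<sigma>$1) p) * (sgn_of (\<sigma>$3) * (2 * qf (p$3) * Re (cnj (p$3) * v$3)))
         + ?e * ?dx v * base_frac (\<sigma>$3) (p$3)" for v
    unfolding ch.H_def \<eta>_infinitesimal_rotation nth ch.M_def by (simp add: algebra_simps)
  show "((\<lambda>q. moment (chart \<sigma> q) $ j) has_derivative
      (\<lambda>v. Re (ch.H (\<sigma>$1) p v (infinitesimal_rotation \<sigma> j p)))) (at p)"
    using exhaust_3[of j] 1 2 3 by (auto simp only: moment_chart Let_def vector_3 H1 H2 H3)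
qed

text \<open>Over a fixed first coordinate x the polytope is the rectangle [-1, A - x - 1] times
  [-1, B + x - 1], whose points correspond to the two base fractions.\<close>

lemma image_moment: "moment ` proj_bundle = moment_polytope (A - 1) (B - 1)"
proof
  show "moment ` proj_bundle \<subseteq> moment_polytope (A - 1) (B - 1)"
  proof
    fix y assume "y \<in> moment ` proj_bundle"
    then obtain \<sigma> p where y: "y = moment (chart \<sigma> p)"
      unfolding proj_bundle_eq_charts by blast
    define x where "x = sgn_of (\<sigma>$1) * ch.x (\<sigma>$1) p"
    have "- 1 \<le> ch.x (\<sigma>$1) p" "ch.x (\<sigma>$1) p < 1"
      using Xs_bounds[OF ch.t_nonneg] unfolding ch.x_def by auto
    then have x: "- 1 \<le> x" "x \<le> 1" by (auto simp: x_def sgn_of_def)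
    then have AB: "A - x > 0" "B + x > 0" using r by auto
    define m n where "m = base_frac (\<sigma>$2) (p$2)" and "n = base_frac (\<sigma>$3) (p$3)"
    have mn: "0 \<le> m" "m \<le> 1" "0 \<le> n" "n \<le> 1" by (simp_all add: m_def n_def base_frac_bounds)
    have "(A - x) * m \<ge> 0" "(A - x) * m \<le> (A - x) * 1" "(B + x) * n \<ge> 0" "(B + x) * n \<le> (B + x) * 1"
      using mn AB by (auto intro!: mult_left_mono simp del: mult_1_right)
    then show "y \<in> moment_polytope (A - 1) (B - 1)"
      unfolding y moment_chart Let_def x_def[symmetric] m_def[symmetric] n_def[symmetric]
      using x by (simp add: moment_polytope_def)
  qed
  show "moment_polytope (A - 1) (B - 1) \<subseteq> moment ` proj_bundle"
  proof
    fix y assume "y \<in> moment_polytope (A - 1) (B - 1)"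
    then have y: "- 1 \<le> y$1" "y$1 \<le> 1" "- 1 \<le> y$2" "- 1 \<le> y$3" "y$1 + y$2 \<le> A - 1" "y$3 - y$1 \<le> B - 1"
      by (auto simp: moment_polytope_def)
    have AB: "A - y$1 > 0" "B + y$1 > 0" using y r by auto
    obtain b2 u2 where 2: "base_frac b2 u2 = (y$2 + 1) / (A - y$1)"
      using base_frac_surj[of "(y$2 + 1) / (A - y$1)"] y AB by (auto simp: divide_simps)
    obtain b3 u3 where 3: "base_frac b3 u3 = (y$3 + 1) / (B + y$1)"
      using base_frac_surj[of "(y$3 + 1) / (B + y$1)"] y AB by (auto simp: divide_simps)
    \<comment> \<open>The face \<open>y$1 = 1\<close> is the section at infinity; elsewhere the
      modulus of \<open>u1\<close> is fixed by t = \<open>nsq (y$1)\<close>.\<close>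
    obtain b1 u1 where 1: "sgn_of b1 * ch.x b1 (vector [u1, u2, u3]) = y$1"
    proof (cases "y$1 = 1")
      case True
      have "ch.x True (vector [0, u2, u3]) = - 1" by (simp add: ch.x_def ch.t_def Xs_0)
      then have "sgn_of True * ch.x True (vector [0, u2, u3]) = y$1" using True by (simp only: sgn_of_def) simp
      then show thesis by (rule that)
    next
      case False
      then have y1: "- 1 \<le> y$1" "y$1 < 1" using y by auto
      define N where "N = ch.N False (vector [0, u2, u3])"
      have N: "N > 0" by (simp add: N_def ch.N_pos)
      define u1 where "u1 = complex_of_real (sqrt (nsq (y$1) / N))"
      have "ch.N False (vector [u1, u2, u3]) = N" by (simp add: N_def ch.N_def)
      then have "ch.t False (vector [u1, u2, u3]) = nsq (y$1)"
        using N nsq_nonneg[OF y1] by (simp add: ch.t_def u1_def)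
      then have "ch.x False (vector [u1, u2, u3]) = Xs False (nsq (y$1))"
        by (simp only: ch.x_def)
      also have "\<dots> = y$1"
        using X_nsq[OF in_S[OF y1]] by (simp add: Xs_def)
      finally have "sgn_of False * ch.x False (vector [u1, u2, u3]) = y$1" by (simp only: sgn_of_def) simp
      then show thesis by (rule that)
    qed
    have "moment (chart (\<chi> i. if i = 1 then b1 else if i = 2 then b2 else b3) (vector [u1, u2, u3])) = y"
    proof -
      have \<sigma>: "(\<chi> i. if i = 1 then b1 else if i = 2 then b2 else b3) $ (1::3) = b1"
        "(\<chi> i. if i = 1 then b1 else if i = 2 then b2 else b3) $ (2::3) = b2"
        "(\<chi> i. if i = 1 then b1 else if i = 2 then b2 else b3) $ (3::3) = b3" by simp_all
      show ?thesis
        unfolding moment_chart Let_def \<sigma> vector_3 1 2 3 using AB by (simp add: vec_eq_iff forall_3)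
    qed
    then show "y \<in> moment ` proj_bundle"
      unfolding proj_bundle_eq_charts by blast
  qed
qed

text \<open>The real matrix of \<open>H\<close> in the logarithmic coframe dp_j / p_j on the open
  orbit, which is the matrix (h_ij) of angular metric coefficients.\<close>

definition h_matrix :: "complex^3 \<Rightarrow> real^3^3" where
  "h_matrix p = (let x = ch.x False p; m = base_frac False (p$2); n = base_frac False (p$3) in
     vector [vector [\<Theta> x, - \<Theta> x * m, \<Theta> x * n],
       vector [- \<Theta> x * m, \<Theta> x * m\<^sup>2 + 2 * (A - x) * m * (1 - m), - \<Theta> x * m * n],
       vector [\<Theta> x * n, - \<Theta> x * m * n, \<Theta> x * n\<^sup>2 + 2 * (B + x) * n * (1 - n)]])"

lemma H_eq_h_matrix:
  assumes "\<And>j. p$j \<noteq> 0"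
  shows "ch.H False p u v = (\<Sum>i\<in>UNIV. \<Sum>j\<in>UNIV. of_real (h_matrix p$i$j) * (u$i / p$i) * cnj (v$j / p$j))"
proof -
  define m n where "m = base_frac False (p$2)" and "n = base_frac False (p$3)"
  define x where "x = ch.x False p"
  define w where "w u i = u$i / p$i" for u i
  have pw: "u$i = p$i * w u i" for u i using assms by (simp add: w_def)
  have \<eta>: "ch.\<eta> False p u = p$1 * (w u 1 - of_real m * w u 2 + of_real n * w u 3)" for u
    unfolding ch.\<eta>_def ch.\<beta>_def pw[of u]
    by (simp add: m_def n_def base_frac_mult_cnj sgn_of_def algebra_simps)
  have "ch.t False p * Ds False x = \<Theta> x"
    using t_Ds[where t="ch.t False p" and b=False, OF ch.t_nonneg] by (simp only: ch.x_def x_def) (simp add: sgn_of_def)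
  then have "complex_of_real (\<Theta> x) = of_real (ch.t False p) * of_real (Ds False x)"
    by (simp only: of_real_mult[symmetric])
  then have E: "of_real (ch.E False p) * (p$1 * cnj (p$1)) = complex_of_real (\<Theta> x)"
    unfolding ch.of_real_t ch.E_def x_def by simp
  have q: "complex_of_real (qf z) * (z * cnj z) = of_real (base_frac False z * (1 - base_frac False z))" for z
  proof -
    have "z * cnj z = of_real (Zf z - 1)" by (simp add: of_real_Zf)
    moreover have "qf z * (Zf z - 1) = base_frac False z * (1 - base_frac False z)"
      by (simp add: qf_def base_frac_def power2_eq_square field_simps)
    ultimately show ?thesis by (simp only: of_real_mult[symmetric])
  qed
  have "ch.H False p u v = of_real (ch.E False p) * (p$1 * cnj (p$1)) *
        (w u 1 - of_real m * w u 2 + of_real n * w u 3) * cnj (w v 1 - of_real m * w v 2 + of_real n * w v 3)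
      + of_real (2 * (A - x)) * (complex_of_real (qf (p$2)) * (p$2 * cnj (p$2))) * w u 2 * cnj (w v 2)
      + of_real (2 * (B + x)) * (complex_of_real (qf (p$3)) * (p$3 * cnj (p$3))) * w u 3 * cnj (w v 3)"
    unfolding ch.H_def \<eta> ch.P_def ch.M_def x_def[symmetric] pw[of u] pw[of v]
    by (simp add: sgn_of_def mult_ac)
  also have "\<dots> = (\<Sum>i\<in>UNIV. \<Sum>j\<in>UNIV. of_real (h_matrix p$i$j) * w u i * cnj (w v j))"
    unfolding E q m_def[symmetric] n_def[symmetric] sum_3
    by (simp add: h_matrix_def Let_def m_def[symmetric] n_def[symmetric] x_def[symmetric])
      (simp add: power2_eq_square algebra_simps)
  finally show ?thesis by (simp add: w_def)
qed

text \<open>With w = u / p, the real part of \<open>H\<close> is the form \<open>h\<close> on the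
  real parts of w plus the same form on the imaginary parts. The latter are the angular
  differentials, and the moment map equation says dx = h Re w. Everything thus reduces to the
  Hessian being the inverse of \<open>h\<close>.\<close>

lemma has_symplectic_potential_G:
  fixes f f1 f2 :: "real \<Rightarrow> real"
  assumes f: "\<And>x. \<bar>x\<bar> < 1 \<Longrightarrow> (f has_real_derivative f1 x) (at x)"
    and f1: "\<And>x. \<bar>x\<bar> < 1 \<Longrightarrow> (f1 has_real_derivative f2 x) (at x)"
    and f2: "\<And>x. \<bar>x\<bar> < 1 \<Longrightarrow> 1 / (1 - x\<^sup>2) + 1 / (2 * (A - x)) + 1 / (2 * (B + x)) + f2 x = 1 / \<Theta> x"
  shows "has_symplectic_potential G moment (\<lambda>y. Phi0 (A - 1) (B - 1) y + f (y$1))"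
  unfolding has_symplectic_potential_def Let_def
proof (intro allI impI)
  fix p u v :: "complex^3"
  assume nz: "\<forall>j. p$j \<noteq> 0"
  define \<sigma> :: "bool^3" where "\<sigma> = (\<chi> _. False)"
  have \<sigma>: "\<sigma>$i = False" for i by (simp add: \<sigma>_def)
  define x m n where "x = ch.x False p" and "m = base_frac False (p$2)" and "n = base_frac False (p$3)"
  define y where "y = moment (chart \<sigma> p)"
  define h where "h = h_matrix p"
  define a where "a u = (\<chi> j. Re (u$j / p$j))" for u :: "complex^3"
  have "ch.t False p > 0"
    using nz ch.N_pos[of False p] unfolding ch.t_def cmod_power2[symmetric] by simp
  then have x: "- 1 < x" "x < 1"
    using Xs_bounds[of "ch.t False p" False] unfolding x_def ch.x_def by auto
  then have AB: "A - x > 0" "B + x > 0" using r by auto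
  have "0 < base_frac False w \<and> base_frac False w < 1" if "w \<noteq> 0" for w
  proof -
    have "Zf w = 1 + (cmod w)\<^sup>2" by (simp add: Zf_def cmod_power2)
    then have "Zf w > 1" using that by simp
    then show ?thesis by (simp add: base_frac_def)
  qed
  then have mn: "0 < m" "m < 1" "0 < n" "n < 1" using nz by (auto simp: m_def n_def)
  have y: "y$1 = x" "y$2 = (A - x) * m - 1" "y$3 = (B + x) * n - 1"
    unfolding y_def moment_chart Let_def \<sigma> by (simp_all add: x_def m_def n_def sgn_of_def)
  have \<Theta>: "\<Theta> x > 0"
  proof -
    have "x\<^sup>2 < 1" using x by (simp add: abs_square_less_1)
    then show ?thesis using SD[OF in_S[of x]] x by (simp add: \<Theta>_def)
  qed
  have pos: "1 + y$1 > 0" "1 - y$1 > 0" "1 + y$2 > 0" "1 + y$3 > 0" "A - 1 - y$1 - y$2 > 0" "B - 1 + y$1 - y$3 > 0"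
    and eqs: "1 + y$2 = (A - x) * m" "1 + y$3 = (B + x) * n"
      "A - 1 - y$1 - y$2 = (A - x) * (1 - m)" "B - 1 + y$1 - y$3 = (B + x) * (1 - n)"
  proof -
    show eqs: "1 + y$2 = (A - x) * m" "1 + y$3 = (B + x) * n"
      "A - 1 - y$1 - y$2 = (A - x) * (1 - m)" "B - 1 + y$1 - y$3 = (B + x) * (1 - n)"
      unfolding y by (simp_all add: algebra_simps)
    show "1 + y$1 > 0" "1 - y$1 > 0" using x by (simp_all add: y)
    show "1 + y$2 > 0" "1 + y$3 > 0" "A - 1 - y$1 - y$2 > 0" "B - 1 + y$1 - y$3 > 0"
      unfolding eqs using AB mn by simp_all
  qed
  define Hs where "Hs = hessian (\<lambda>y. Phi0 (A - 1) (B - 1) y + f (y$1)) y"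
  have inv: "Hs ** h = mat 1"
  proof -
    \<comment> \<open>The reciprocals of twice the two slanted facet functions; they are, up to
      sign, the off-diagonal entries of the Hessian.\<close>
    define k l where "k = 1 / (2 * (A - x) * (1 - m))" and "l = 1 / (2 * (B + x) * (1 - n))"
    have kl: "2 * (A - x) * (1 - m) * k = 1" "2 * (B + x) * (1 - n) * l = 1"
      using AB mn by (simp_all add: k_def l_def)
    have H: "Hs$i$j = polytope_hessian (A - 1) (B - 1) (f2 x) y (axis i 1) (axis j 1)" for i j
      unfolding Hs_def y(1)[symmetric] by (rule hessian_Phi0[OF f f1 pos])
    have "(1 / (1 + x) + 1 / (1 - x)) / 2 = 1 / (1 - x\<^sup>2)"
    proof -
      have "1 / (1 + x) + 1 / (1 - x) = 2 / ((1 + x) * (1 - x))"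
        using x by (simp add: divide_simps)
      also have "(1 + x) * (1 - x) = 1 - x\<^sup>2" by (simp add: power2_eq_square algebra_simps)
      finally have "1 / (1 + x) + 1 / (1 - x) = 2 / (1 - x\<^sup>2)" .
      moreover have "2 / q / 2 = 1 / q" for q :: real by simp
      ultimately show ?thesis by metis
    qed
    moreover have "\<bar>x\<bar> < 1" using x by simp
    note f2[OF this]
    ultimately have "(1 / (1 + x) + 1 / (1 - x)) / 2 + f2 x = 1 / \<Theta> x - 1 / (2 * (A - x)) - 1 / (2 * (B + x))"
      by linarith
    moreover have frac: "1 / (d * q) / 2 - 1 / (2 * d) = (1 - q) * (1 / (2 * d * q))" if "d > 0" "q > 0" for d q :: real
      using that by (simp add: field_simps)
    have "1 / ((A - x) * (1 - m)) / 2 - 1 / (2 * (A - x)) = m * k" "1 / ((B + x) * (1 - n)) / 2 - 1 / (2 * (B + x)) = n * l"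
      using frac[of "A - x" "1 - m"] frac[of "B + x" "1 - n"] AB mn unfolding k_def l_def by simp_all
    moreover have "Hs$1$1 = (1 / (1 + x) + 1 / (1 - x)) / 2 + 1 / ((A - x) * (1 - m)) / 2 + 1 / ((B + x) * (1 - n)) / 2 + f2 x"
      unfolding H polytope_hessian_def eqs unfolding y(1) by (simp add: axis_def add_divide_distrib)
    ultimately have H11: "Hs$1$1 = 1 / \<Theta> x + m * k + n * l" by linarith
    have frac2: "1 / (d * q) / 2 + 1 / (d * (1 - q)) / 2 = 1 / (2 * d * (1 - q)) / q" if "d > 0" "0 < q" "q < 1" for d q :: real
    proof -
      have "1 / (d * q) / 2 + 1 / (d * q') / 2 = (q + q') / (2 * d * q' * q)" if "q' > 0" for q'
        using \<open>d > 0\<close> \<open>0 < q\<close> that by (simp add: field_simps)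
      from this[of "1 - q"] that show ?thesis by simp
    qed
    have "Hs$2$2 = 1 / ((A - x) * m) / 2 + 1 / ((A - x) * (1 - m)) / 2" "Hs$3$3 = 1 / ((B + x) * n) / 2 + 1 / ((B + x) * (1 - n)) / 2"
      unfolding H polytope_hessian_def eqs by (simp_all add: axis_def add_divide_distrib)
    then have H22: "Hs$2$2 = k / m" and H33: "Hs$3$3 = l / n"
      using frac2[of "A - x" m] frac2[of "B + x" n] AB mn by (simp_all only: k_def l_def)
    have H': "Hs$1$2 = k" "Hs$2$1 = k" "Hs$1$3 = - l" "Hs$3$1 = - l" "Hs$2$3 = 0" "Hs$3$2 = 0"
      unfolding H polytope_hessian_def eqs by (simp_all add: axis_def k_def l_def)
    have h: "h$1$1 = \<Theta> x" "h$1$2 = - \<Theta> x * m" "h$1$3 = \<Theta> x * n" "h$2$1 = - \<Theta> x * m"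
      "h$2$2 = \<Theta> x * m\<^sup>2 + 2 * (A - x) * m * (1 - m)" "h$2$3 = - \<Theta> x * m * n"
      "h$3$1 = \<Theta> x * n" "h$3$2 = - \<Theta> x * m * n" "h$3$3 = \<Theta> x * n\<^sup>2 + 2 * (B + x) * n * (1 - n)"
      by (simp_all add: h_def h_matrix_def Let_def x_def m_def n_def)
    \<comment> \<open>Naming the quotients turns the nine matrix entries into polynomial identities
      modulo the relations \<open>rel\<close>.\<close>
    define \<theta> k' l' where "\<theta> = 1 / \<Theta> x" and "k' = k / m" and "l' = l / n"
    have rel: "\<theta> * \<Theta> x = 1" "k' * m = k" "l' * n = l" "2 * (A - x) * (1 - m) * k = 1" "2 * (B + x) * (1 - n) * l = 1"
      using \<Theta> mn kl by (simp_all add: \<theta>_def k'_def l'_def)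
    have mm: "(Hs ** h)$i$j = Hs$i$1 * h$1$j + Hs$i$2 * h$2$j + Hs$i$3 * h$3$j" for i j
      by (simp add: matrix_matrix_mult_def sum_3)
    note fold = \<theta>_def[symmetric] k'_def[symmetric] l'_def[symmetric]
    have "(Hs ** h)$1$1 = 1" "(Hs ** h)$1$2 = 0" "(Hs ** h)$1$3 = 0" "(Hs ** h)$2$1 = 0" "(Hs ** h)$2$2 = 1"
      "(Hs ** h)$2$3 = 0" "(Hs ** h)$3$1 = 0" "(Hs ** h)$3$2 = 0" "(Hs ** h)$3$3 = 1"
      unfolding mm H11 H22 H33 H' h fold using rel by algebra+
    then show ?thesis by (simp add: vec_eq_iff forall_3 mat_def)
  qed
  have sym: "h$2$1 = h$1$2" "h$3$1 = h$1$3" "h$3$2 = h$2$3"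
    by (simp_all add: h_def h_matrix_def Let_def)
  have dx: "dirderiv (\<lambda>q. moment (chart \<sigma> q)) p u = h *v a u" for u
  proof -
    \<comment> \<open>In this chart the field is the j-th Euler field, so pairing with it reads off
      the j-th component of \<open>h\<close> applied to the real parts.\<close>
    have ir: "infinitesimal_rotation \<sigma> j p = p$j *s axis j 1" for j
      using exhaust_3[of j] by (auto simp: infinitesimal_rotation_def chart_angles_def \<sigma> sgn_of_def axis_def vec_eq_iff forall_3)
    have ReM: "Re (complex_of_real k * w / z) = k * Re (w / z)" for k w z
      unfolding times_divide_eq_right[symmetric] by (simp del: times_divide_eq_right)
    have Re_H: "Re (ch.H False p u (infinitesimal_rotation \<sigma> j p)) = (h *v a u) $ j" for u j
      using exhaust_3[of j] nz unfolding ir H_eq_h_matrix[OF nz[rule_format]] h_def[symmetric]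
      by (auto simp: sum_3 axis_def a_def matrix_vector_mult_def sym ReM)
    have "((\<lambda>q. moment (chart \<sigma> q)) has_derivative (\<lambda>u. h *v a u)) (at p)"
    proof (rule has_derivative_cart)
      fix j
      have "((\<lambda>q. moment (chart \<sigma> q) $ j) has_derivative
          (\<lambda>v. Re (ch.H (\<sigma>$1) p v (infinitesimal_rotation \<sigma> j p)))) (at p)"
        using moment_map_moment unfolding moment_map_def kaehler_form_torus_field by blast
      then show "((\<lambda>q. moment (chart \<sigma> q) $ j) has_derivative (\<lambda>v. (h *v a v) $ j)) (at p)"
        by (simp only: \<sigma> Re_H)
    qed
    then show ?thesis by (simp add: dirderiv_eq)
  qed
  have "Hs *v (h *v w) = w" for w
    unfolding matrix_vector_mul_assoc inv by simp
  note Hs_h = this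
  have "(\<Sum>i\<in>UNIV. \<Sum>j\<in>UNIV. Hs$i$j * X$i * Y$j) = (\<Sum>i\<in>UNIV. X$i * (Hs *v Y)$i)" for X Y
    by (simp add: matrix_vector_mult_def sum_distrib_left mult_ac)
  then have dxdx: "(\<Sum>i\<in>UNIV. \<Sum>j\<in>UNIV. Hs$i$j * (h *v a u)$i * (h *v a v)$j) = (\<Sum>i\<in>UNIV. (h *v a u)$i * a v$i)"
    by (simp add: Hs_h)
  define w where w: "w u j = u$j / p$j" for u :: "complex^3" and j
  show "G (\<chi> _. False) p u v = (\<Sum>i\<in>UNIV. \<Sum>j\<in>UNIV. hessian (\<lambda>y. Phi0 (A - 1) (B - 1) y + f (y$1)) (moment (chart (\<chi> _. False) p))$i$j
        * dirderiv (\<lambda>q. moment (chart (\<chi> _. False) q)) p u$i * dirderiv (\<lambda>q. moment (chart (\<chi> _. False) q)) p v$j)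
      + (\<Sum>i\<in>UNIV. \<Sum>j\<in>UNIV. matrix_inv (hessian (\<lambda>y. Phi0 (A - 1) (B - 1) y + f (y$1)) (moment (chart (\<chi> _. False) p)))$i$j
        * (\<chi> j. Im (u$j / p$j))$i * (\<chi> j. Im (v$j / p$j))$j)"
    unfolding \<sigma>_def[symmetric] y_def[symmetric] Hs_def[symmetric] dx dxdx matrix_inv_eqI[OF inv]
    unfolding G_def \<sigma> H_eq_h_matrix[OF nz[rule_format]] h_def[symmetric] a_def matrix_vector_mult_def w[symmetric]
    by (simp add: sum_3 sym algebra_simps)
qed

end

theorem proposition6p8:
  fixes a c :: real
  assumes "a > 0" and "c > 0"
  shows "\<exists>g x f. kaehler_metric g \<and> extremal g \<and> torus_invariant g \<and>
           moment_map g x \<and> x ` proj_bundle = moment_polytope a c \<and>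
           (\<exists>U. open U \<and> {-1..1} \<subseteq> U \<and> smooth_on U f) \<and>
           has_symplectic_potential g x (\<lambda>y. Phi0 a c y + f (y $ 1))"
proof -
  have "a + 1 > 1" "c + 1 > 1" using assms by simp_all
  then obtain l0 l1 r \<rho> where "extremal_profile (a + 1) (c + 1) l0 l1 r \<rho>"
    by (rule extremal_profile_exists)
  then interpret extremal_bundle "a + 1" "c + 1" l0 l1 r \<rho>
    "\<lambda>x. (a + 1 - x) * (c + 1 + x)" "\<lambda>x. (a + 1 - x) * (c + 1 + x) + (1 - x\<^sup>2) * (l0 + l1 * x)"
    by (simp_all add: extremal_bundle_def)
  obtain r' f f1 f2 where f: "1 < r'" "smooth_on {-r'<..<r'} f"
    "\<And>x. \<bar>x\<bar> < r' \<Longrightarrow> (f has_real_derivative f1 x) (at x)"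
    "\<And>x. \<bar>x\<bar> < r' \<Longrightarrow> (f1 has_real_derivative f2 x) (at x)"
    "\<And>x. \<bar>x\<bar> < 1 \<Longrightarrow> 1 / (1 - x\<^sup>2) + 1 / (2 * (a + 1 - x)) + 1 / (2 * (c + 1 + x)) + f2 x = 1 / \<Theta> x"
    using potential_exists by blast
  have "has_symplectic_potential G moment (\<lambda>y. Phi0 (a + 1 - 1) (c + 1 - 1) y + f (y$1))"
    by (rule has_symplectic_potential_G[of f f1 f2]) (use f in auto)
  moreover have "\<exists>U. open U \<and> {-1..1} \<subseteq> U \<and> smooth_on U f"
    using f(1,2) by (intro exI[of _ "{-r'<..<r'}"]) auto
  ultimately show ?thesis
    using kaehler_metric_G extremal_G torus_invariant_G moment_map_moment image_moment
    by (intro exI[of _ G] exI[of _ moment] exI[of _ f]) simp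
qed

end
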